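(* Let $V\in(L^2+L^\infty)(\mathbb{R}^3,\mathbb{R})$ and let $S=-\Delta+V$ be the Schrödinger operator in $L^2(\mathbb{R}^3,\mathbb{C})$ with domain $H^2(\mathbb{R}^3,\mathbb{C})$. Assume that $0\in\sigma(S)$ and $(-\delta,0)\subset\rho(S)$ for some $\delta>0$. Let $f\colon\mathbb{R}^3\times\mathbb{R}\to\mathbb{R}$ be a Carathéodory function with $f(x,0)=0$ for a.e. $x\in\mathbb{R}^3$ such that (i) for a.e. $x\in\mathbb{R}^3$ and each $t\in\mathbb{R}$, $|f(x,t)|\leqslant a(x)+b|t|$, where $a\in L^2(\mathbb{R}^3,\mathbb{R})$ and $b>0$; (ii) for a.e. $x\in\mathbb{R}^3$ the function $f(x,\cdot)$ is non-decreasing; (iii) there are $\alpha,\beta>0$ such that for a.e. $x\in\mathbb{R}^3$ and each $t\in\mathbb{R}$ $$\beta\leqslant\underline{D}_2f(x,t)\leqslant\overline{D}_2f(x,t)\leqslant\frac1\alpha ,$$ and moreover $\alpha>-\inf\sigma(S)/\delta^2$. Then for each $h\in L^2(\mathbb{R}^3,\mathbb{R})$ the equation $$-\Delta u+V(x)u+f(x,u)=h(x)$$ has a solution $u\in H^2(\mathbb{R}^3,\mathbb{R})$.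
   Context: $V\in(L^2+L^\infty)(\mathbb{R}^3,\mathbb{R})$ means $V=V_2+V_\infty$ with $V_2\in L^2(\mathbb{R}^3,\mathbb{R})$ and $V_\infty\in L^\infty(\mathbb{R}^3,\mathbb{R})$; for such $V$ the operator sum $S$ is self-adjoint and bounded from below with domain $H^2(\mathbb{R}^3,\mathbb{C})$. $f$ is Carathéodory if $f(\cdot,t)$ is measurable for every $t$ and $f(x,\cdot)$ is continuous for a.e. $x$. The upper and lower derivatives are $$\overline{D}_2f(x,t)=\lim_{\eta\to0^+}\sup\Big\{\tfrac{f(x,s)-f(x,t)}{s-t}:0<|s-t|<\eta\Big\},\qquad \underline{D}_2f(x,t)=\lim_{\eta\to0^+}\inf\Big\{\tfrac{f(x,s)-f(x,t)}{s-t}:0<|s-t|<\eta\Big\}.$$ *)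

theory Defs
  imports "HOL-Analysis.Analysis"
begin

text \<open>
  Elements of the function spaces below are represented by functions, and equality in the spaces
  is equality almost everywhere with respect to the (complete) Lebesgue measure.
\<close>

section \<open>Lebesgue spaces\<close>

definition L2 :: "('a::euclidean_space \<Rightarrow> 'b::real_normed_vector) set" where
  "L2 = {u. u \<in> borel_measurable lebesgue \<and> integrable lebesgue (\<lambda>x. (norm (u x))\<^sup>2)}"

definition L2_norm :: "('a::euclidean_space \<Rightarrow> 'b::real_normed_vector) \<Rightarrow> real" where
  "L2_norm u = sqrt (\<integral>x. (norm (u x))\<^sup>2 \<partial>lebesgue)"

definition Linfty :: "('a::euclidean_space \<Rightarrow> 'b::real_normed_vector) set" where
  "Linfty = {u. u \<in> borel_measurable lebesgue \<and> (\<exists>C. AE x in lebesgue. norm (u x) \<le> C)}"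

definition L2_plus_Linfty :: "('a::euclidean_space \<Rightarrow> 'b::real_normed_vector) set" where
  "L2_plus_Linfty = {V. \<exists>V2\<in>L2. \<exists>Vinf\<in>Linfty. \<forall>x. V x = V2 x + Vinf x}"

definition locally_integrable ::
    "('a::euclidean_space \<Rightarrow> 'b::{banach, second_countable_topology}) \<Rightarrow> bool" where
  "locally_integrable u \<longleftrightarrow> (\<forall>K. compact K \<longrightarrow> set_integrable lebesgue K u)"

section \<open>Weak derivatives and Sobolev spaces\<close>

definition partial :: "'n::finite \<Rightarrow> (real^'n \<Rightarrow> real) \<Rightarrow> real^'n \<Rightarrow> real" where
  "partial i \<phi> = (\<lambda>x. frechet_derivative \<phi> (at x) (axis i 1))"

text \<open>A list of coordinate directions plays the role of a multi-index; its length is the order.\<close>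

definition partials :: "'n::finite list \<Rightarrow> (real^'n \<Rightarrow> real) \<Rightarrow> real^'n \<Rightarrow> real" where
  "partials is \<phi> = foldr partial is \<phi>"

definition test_functions :: "(real^'n::finite \<Rightarrow> real) set" where
  "test_functions =
     {\<phi>. (\<forall>is x. partials is \<phi> differentiable (at x)) \<and> compact (closure {x. \<phi> x \<noteq> 0})}"

definition has_weak_deriv ::
    "'n::finite list \<Rightarrow> (real^'n \<Rightarrow> 'b::{banach, second_countable_topology}) \<Rightarrow> (real^'n \<Rightarrow> 'b) \<Rightarrow> bool"
  where
  "has_weak_deriv is u v \<longleftrightarrow> locally_integrable u \<and> locally_integrable v \<and>
     (\<forall>\<phi>\<in>test_functions.
        (\<integral>x. partials is \<phi> x *\<^sub>R u x \<partial>lebesgue) = (-1) ^ length is *\<^sub>R (\<integral>x. \<phi> x *\<^sub>R v x \<partial>lebesgue))"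

text \<open>If a weak derivative exists, it is determined up to a null set, which is all that is ever
  used of the representative chosen here.\<close>

definition weak_deriv ::
    "'n::finite list \<Rightarrow> (real^'n \<Rightarrow> 'b::{banach, second_countable_topology}) \<Rightarrow> real^'n \<Rightarrow> 'b" where
  "weak_deriv is u = (SOME v. has_weak_deriv is u v)"

definition sobolev_H ::
    "nat \<Rightarrow> (real^'n::finite \<Rightarrow> 'b::{banach, second_countable_topology}) set" where
  "sobolev_H k = {u. u \<in> L2 \<and> (\<forall>is. length is \<le> k \<longrightarrow> (\<exists>v\<in>L2. has_weak_deriv is u v))}"

definition laplacian ::
    "(real^'n::finite \<Rightarrow> 'b::{banach, second_countable_topology}) \<Rightarrow> real^'n \<Rightarrow> 'b" where
  "laplacian u = (\<lambda>x. \<Sum>i\<in>UNIV. weak_deriv [i, i] u x)"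

section \<open>Schroedinger operator and spectrum\<close>

text \<open>The resolvent set of an operator \<open>T\<close> in complex \<open>L2\<close> with domain \<open>D\<close>, where \<open>T\<close> maps
  \<open>D\<close> into \<open>L2\<close> and respects equality almost everywhere: those \<open>z\<close> for which \<open>T - z\<close> is
  injective on \<open>D\<close> and onto \<open>L2\<close>, and the inverse is bounded.\<close>

definition resolvent_set ::
    "('a::euclidean_space \<Rightarrow> complex) set \<Rightarrow> (('a \<Rightarrow> complex) \<Rightarrow> 'a \<Rightarrow> complex) \<Rightarrow> complex set" where
  "resolvent_set D T = {z.
     (\<forall>u\<in>D. \<forall>v\<in>D. (AE x in lebesgue. T u x - z * u x = T v x - z * v x) \<longrightarrow>
        (AE x in lebesgue. u x = v x)) \<and>
     (\<forall>g\<in>L2. \<exists>u\<in>D. AE x in lebesgue. T u x - z * u x = g x) \<and>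
     (\<exists>C. \<forall>u\<in>D. L2_norm u \<le> C * L2_norm (\<lambda>x. T u x - z * u x))}"

definition spectrum ::
    "('a::euclidean_space \<Rightarrow> complex) set \<Rightarrow> (('a \<Rightarrow> complex) \<Rightarrow> 'a \<Rightarrow> complex) \<Rightarrow> complex set" where
  "spectrum D T = - resolvent_set D T"

text \<open>The operator is considered on the domain \<^term>\<open>sobolev_H 2\<close>.\<close>

definition schroedinger :: "(real^3 \<Rightarrow> real) \<Rightarrow> (real^3 \<Rightarrow> complex) \<Rightarrow> real^3 \<Rightarrow> complex" where
  "schroedinger V u = (\<lambda>x. - laplacian u x + complex_of_real (V x) * u x)"

abbreviation schroedinger_resolvent_set :: "(real^3 \<Rightarrow> real) \<Rightarrow> complex set" where
  "schroedinger_resolvent_set V \<equiv> resolvent_set (sobolev_H 2) (schroedinger V)"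

abbreviation schroedinger_spectrum :: "(real^3 \<Rightarrow> real) \<Rightarrow> complex set" where
  "schroedinger_spectrum V \<equiv> spectrum (sobolev_H 2) (schroedinger V)"

section \<open>Nonlinearities\<close>

definition caratheodory :: "('a::euclidean_space \<Rightarrow> real \<Rightarrow> real) \<Rightarrow> bool" where
  "caratheodory f \<longleftrightarrow> (\<forall>t. (\<lambda>x. f x t) \<in> borel_measurable lebesgue) \<and>
     (AE x in lebesgue. continuous_on UNIV (f x))"

definition upper_D2 :: "('a \<Rightarrow> real \<Rightarrow> real) \<Rightarrow> 'a \<Rightarrow> real \<Rightarrow> ereal" where
  "upper_D2 f x t = Lim (at_right (0::real))
     (\<lambda>\<eta>. SUP s\<in>{s. 0 < \<bar>s - t\<bar> \<and> \<bar>s - t\<bar> < \<eta>}. ereal ((f x s - f x t) / (s - t)))"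

definition lower_D2 :: "('a \<Rightarrow> real \<Rightarrow> real) \<Rightarrow> 'a \<Rightarrow> real \<Rightarrow> ereal" where
  "lower_D2 f x t = Lim (at_right (0::real))
     (\<lambda>\<eta>. INF s\<in>{s. 0 < \<bar>s - t\<bar> \<and> \<bar>s - t\<bar> < \<eta>}. ereal ((f x s - f x t) / (s - t)))"

end

theory Submission
  imports Defs "HOL-Computational_Algebra.Polynomial"
begin

text \<open>
  Put \<open>\<gamma> = 1 / \<alpha>\<close>. The bounds on the upper and lower derivatives integrate to
  \<open>\<beta> (t - s) \<le> f x t - f x s \<le> \<gamma> (t - s)\<close> for \<open>s \<le> t\<close>, so after subtracting the line of mean slope
  \<open>c = (\<beta> + \<gamma>) / 2\<close> the nonlinearity is Lipschitz with the small constant \<open>q = (\<gamma> - \<beta>) / 2\<close>.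
  The equation becomes \<open>u = (S + c)\<^sup>-\<^sup>1 (h - (f(u) - c u))\<close>, and the right-hand side is a
  contraction of real \<open>L2\<close> as soon as \<open>(S + c)\<^sup>-\<^sup>1\<close> has norm at most \<open>1 / d\<close> for some \<open>d > q\<close>.
  For a symmetric operator this holds if the interval of radius \<open>d\<close> around \<open>-c\<close> lies in the resolvent set
  (\<open>symmetric_resolvent_bound\<close>). If the spectrum has no negative point, \<open>d = c\<close> will do.
  Otherwise the gap \<open>(-\<delta>, 0)\<close> puts \<open>inf \<sigma>(S)\<close> at or below \<open>-\<delta>\<close>; the condition \<open>\<alpha> > - inf \<sigma>(S) / \<delta>\<^sup>2\<close>
  then gives \<open>\<gamma> < \<delta>\<close>, and \<open>d = min c (\<delta> - c)\<close> exceeds \<open>q\<close> because \<open>c > q\<close> and \<open>\<delta> - c > \<gamma> - c = q\<close>.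

  The second case uses that the spectrum is bounded below, because the infimum of a set without
  lower bound is an unspecified number.
  As some real point is known to lie in the resolvent set, semiboundedness of the quadratic form is
  enough for this (\<open>semibounded_resolvent\<close>): a symmetric operator with a real point in its resolvent set
  is self-adjoint, and a number strictly below the form bound is then in the resolvent set as well.

  It remains to see that \<open>S\<close> is symmetric and semibounded on \<open>H\<^sup>2\<close>. Both are limits of statements on test
  functions, which approximate every \<open>u \<in> H\<^sup>2\<close> together with \<open>\<Delta>u\<close> in \<open>L2\<close> (\<open>weak_laplacian_approx\<close>:
  mollify, then cut off). The \<open>L2\<close> part of the potential is controlled in three dimensions by
  \<open>\<integral>u\<^sup>4 \<le> 8 |u| |\<nabla>u|\<^sup>3\<close> (\<open>ladyzhenskaya\<close>), where the gradient enters with a power that lets the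
  Dirichlet integral absorb it. That \<open>S\<close> maps \<open>H\<^sup>2\<close> into \<open>L2\<close> is read off from the resolvent bound at one
  point (\<open>schroedinger_L2\<close>).
\<close>

section \<open>Symmetric operators in a real Hilbert space\<close>

text \<open>
  The norm \<open>r\<close> of a bounded symmetric \<open>R\<close> is reached on approximate eigenvectors of \<open>R\<^sup>2\<close>:
  \<open>|R\<^sup>2x - r\<^sup>2x|\<^sup>2 \<le> r\<^sup>2 (r\<^sup>2|x|\<^sup>2 - |Rx|\<^sup>2)\<close>. As \<open>R\<^sup>2 - r\<^sup>2 = (R - r)(R + r)\<close>, the two factors
  cannot both be bounded below, so \<open>r\<close> cannot exceed \<open>m\<close>.
\<close>

lemma symmetric_norm_le:
  fixes R :: "'a::real_inner \<Rightarrow> 'a"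
  assumes lin: "bounded_linear R" and sym: "\<And>x y. R x \<bullet> y = x \<bullet> R y" and "m \<ge> 0"
    and plus: "\<And>r. r > m \<Longrightarrow> \<exists>k. \<forall>x. norm x \<le> k * norm (R x + r *\<^sub>R x)"
    and minus: "\<And>r. r > m \<Longrightarrow> \<exists>k. \<forall>x. norm x \<le> k * norm (R x - r *\<^sub>R x)"
  shows "norm (R x) \<le> m * norm x"
proof -
  interpret R: bounded_linear R by fact
  define r where "r = onorm R"
  have le: "norm (R x) \<le> r * norm x" for x
    unfolding r_def by (rule onorm[OF lin])
  have "r \<le> m"
  proof (rule ccontr)
    assume "\<not> r \<le> m"
    then have rm: "r > m" and r0: "r > 0" using \<open>m \<ge> 0\<close> by auto
    obtain k1 k2 where k1: "\<And>x. norm x \<le> k1 * norm (R x + r *\<^sub>R x)"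
      and k2: "\<And>x. norm x \<le> k2 * norm (R x - r *\<^sub>R x)"
      using plus[OF rm] minus[OF rm] by auto
    define K where "K = \<bar>k1\<bar> * \<bar>k2\<bar> + 1"
    have K: "K > 0" unfolding K_def by (simp add: add_nonneg_pos)
    have below: "norm x \<le> K * norm (R (R x) - r\<^sup>2 *\<^sub>R x)" for x
    proof -
      have "norm x \<le> \<bar>k1\<bar> * norm (R x + r *\<^sub>R x)"
        by (rule order_trans[OF k1]) (simp add: mult_right_mono)
      also have "norm (R x + r *\<^sub>R x) \<le> \<bar>k2\<bar> * norm (R (R x + r *\<^sub>R x) - r *\<^sub>R (R x + r *\<^sub>R x))"
        by (rule order_trans[OF k2]) (simp add: mult_right_mono)
      also have "R (R x + r *\<^sub>R x) - r *\<^sub>R (R x + r *\<^sub>R x) = R (R x) - r\<^sup>2 *\<^sub>R x"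
        by (simp add: R.add R.scaleR algebra_simps power2_eq_square)
      finally have "norm x \<le> \<bar>k1\<bar> * (\<bar>k2\<bar> * norm (R (R x) - r\<^sup>2 *\<^sub>R x))"
        by (simp add: mult_left_mono)
      also have "\<dots> \<le> K * norm (R (R x) - r\<^sup>2 *\<^sub>R x)"
        by (simp add: K_def algebra_simps)
      finally show ?thesis .
    qed
    have defect: "(norm (R (R x) - r\<^sup>2 *\<^sub>R x))\<^sup>2 \<le> r\<^sup>2 * (r\<^sup>2 * (norm x)\<^sup>2 - (norm (R x))\<^sup>2)" for x
    proof -
      have "R (R x) \<bullet> x = (norm (R x))\<^sup>2"
        by (simp add: sym power2_norm_eq_inner)
      then have "(norm (R (R x) - r\<^sup>2 *\<^sub>R x))\<^sup>2
        = (norm (R (R x)))\<^sup>2 - 2 * r\<^sup>2 * (norm (R x))\<^sup>2 + r\<^sup>2 * r\<^sup>2 * (norm x)\<^sup>2"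
        by (simp add: power2_norm_eq_inner inner_diff_left inner_diff_right inner_commute[of x "R (R x)"] right_diff_distrib power2_eq_square[of r] power4_eq_xxxx)
      moreover have "(norm (R (R x)))\<^sup>2 \<le> (r * norm (R x))\<^sup>2"
        by (intro power_mono le) simp
      ultimately show ?thesis by (simp add: power_mult_distrib algebra_simps)
    qed
    define s where "s = sqrt (r\<^sup>2 - 1 / (K\<^sup>2 * r\<^sup>2))"
    have gain: "(norm (R x))\<^sup>2 \<le> (r\<^sup>2 - 1 / (K\<^sup>2 * r\<^sup>2)) * (norm x)\<^sup>2" for x
    proof -
      have "(norm x)\<^sup>2 \<le> (K * norm (R (R x) - r\<^sup>2 *\<^sub>R x))\<^sup>2"
        by (intro power_mono below) simp
      also have "\<dots> \<le> K\<^sup>2 * (r\<^sup>2 * (r\<^sup>2 * (norm x)\<^sup>2 - (norm (R x))\<^sup>2))"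
        unfolding power_mult_distrib by (intro mult_left_mono defect) simp
      finally show ?thesis using K r0 by (simp add: field_simps)
    qed
    have "norm (R x) \<le> s * norm x" for x
    proof -
      have "norm (R x) = sqrt ((norm (R x))\<^sup>2)" by simp
      also have "\<dots> \<le> sqrt ((r\<^sup>2 - 1 / (K\<^sup>2 * r\<^sup>2)) * (norm x)\<^sup>2)"
        by (rule real_sqrt_le_mono[OF gain])
      also have "\<dots> = s * norm x" by (simp add: s_def real_sqrt_mult)
      finally show ?thesis .
    qed
    then have "norm (R x) / norm x \<le> max s 0" for x
      by (cases "x = 0") (auto simp: divide_le_eq le_max_iff_disj)
    then have "r \<le> max s 0" unfolding r_def onorm_def by (intro cSUP_least) auto
    moreover have "s < sqrt (r\<^sup>2)" unfolding s_def
      using K r0 by (intro real_sqrt_less_mono) simp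
    ultimately show False using r0 by (simp add: max_def split: if_splits)
  qed
  then show ?thesis
    by (rule order_trans[OF le mult_right_mono]) simp
qed

text \<open>
  \<open>T\<^sup>2\<close> is coercive because \<open>\<langle>T\<^sup>2x, x\<rangle> = |Tx|\<^sup>2\<close>. Hence \<open>x - s (T\<^sup>2x - y)\<close> is a contraction in \<open>x\<close>
  for a small step \<open>s\<close>, and its fixed point solves \<open>T (T x) = y\<close>.
\<close>

lemma symmetric_bounded_below_surj:
  fixes T :: "'a::{real_inner, complete_space} \<Rightarrow> 'a"
  assumes lin: "bounded_linear T" and sym: "\<And>x y. T x \<bullet> y = x \<bullet> T y"
    and below: "\<And>x. norm x \<le> k * norm (T x)"
  shows "\<exists>x. T x = y"
proof -
  interpret T: bounded_linear T by fact
  obtain b where b: "b > 0" "\<And>x. norm (T x) \<le> norm x * b"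
    using T.pos_bounded by auto
  define K where "K = \<bar>k\<bar> + 1"
  have K: "K > 0" by (simp add: K_def)
  have belowK: "norm x \<le> K * norm (T x)" for x
    by (rule order_trans[OF below]) (simp add: K_def mult_right_mono)
  (* the step s balances the gain 2s/K^2 against the loss s^2 b^4 *)
  define s where "s = 1 / (K\<^sup>2 * b^4 + K\<^sup>2)"
  have den: "K\<^sup>2 * b^4 + K\<^sup>2 > 0" using K b by (simp add: add_pos_pos)
  have s: "s > 0" using den by (simp add: s_def)
  define q where "q = 1 - 2 * s / K\<^sup>2 + s\<^sup>2 * b^4"
  have "s * b^4 < 1 / K\<^sup>2"
    using den K by (simp add: s_def field_simps)
  then have "s * (s * b^4) < s * (1 / K\<^sup>2)" using s by (intro mult_strict_left_mono) auto
  moreover have "s * (1 / K\<^sup>2) > 0" using s K by simp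
  moreover have "q = 1 - 2 * (s * (1 / K\<^sup>2)) + s * (s * b^4)"
    by (simp add: q_def power2_eq_square)
  ultimately have q1: "q < 1" by linarith
  have est: "(norm (x - s *\<^sub>R T (T x)))\<^sup>2 \<le> q * (norm x)\<^sup>2" for x
  proof -
    have "x \<bullet> T (T x) = (norm (T x))\<^sup>2"
      by (simp add: power2_norm_eq_inner sym)
    then have eq: "(norm (x - s *\<^sub>R T (T x)))\<^sup>2 = (norm x)\<^sup>2 - 2 * s * (norm (T x))\<^sup>2 + s\<^sup>2 * (norm (T (T x)))\<^sup>2"
      by (simp add: power2_norm_eq_inner inner_diff_left inner_diff_right inner_commute[of "T (T x)" x] power2_eq_square[of s] right_diff_distrib)
    have "(norm x)\<^sup>2 \<le> (K * norm (T x))\<^sup>2" by (intro power_mono belowK) simp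
    then have 1: "(norm x)\<^sup>2 / K\<^sup>2 \<le> (norm (T x))\<^sup>2" using K by (simp add: field_simps power_mult_distrib)
    have "norm (T (T x)) \<le> norm x * b * b"
      by (rule order_trans[OF b(2) mult_right_mono[OF b(2)]]) (use b in simp)
    then have "(norm (T (T x)))\<^sup>2 \<le> (norm x * b * b)\<^sup>2" by (intro power_mono) auto
    then have 2: "(norm (T (T x)))\<^sup>2 \<le> b^4 * (norm x)\<^sup>2"
      by (simp add: power_mult_distrib power2_eq_square power4_eq_xxxx mult_ac)
    have "2 * s * ((norm x)\<^sup>2 / K\<^sup>2) \<le> 2 * s * (norm (T x))\<^sup>2"
      using s by (intro mult_left_mono 1) simp
    moreover have "s\<^sup>2 * (norm (T (T x)))\<^sup>2 \<le> s\<^sup>2 * (b^4 * (norm x)\<^sup>2)"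
      by (intro mult_left_mono 2) simp
    ultimately show ?thesis unfolding eq q_def by (simp add: algebra_simps)
  qed
  define q' where "q' = max q 0"
  have "\<exists>!x. x - s *\<^sub>R (T (T x) - y) = x"
  proof (rule banach_fix_type[where c = "sqrt q'"])
    show "0 \<le> sqrt q'" "sqrt q' < 1" using q1 by (auto simp: q'_def)
    show "\<forall>x z. dist (x - s *\<^sub>R (T (T x) - y)) (z - s *\<^sub>R (T (T z) - y)) \<le> sqrt q' * dist x z"
    proof (intro allI)
      fix x z
      have "(x - s *\<^sub>R (T (T x) - y)) - (z - s *\<^sub>R (T (T z) - y)) = (x - z) - s *\<^sub>R T (T (x - z))"
        by (simp add: T.diff scaleR_diff_right)
      then have "dist (x - s *\<^sub>R (T (T x) - y)) (z - s *\<^sub>R (T (T z) - y)) = sqrt ((norm ((x - z) - s *\<^sub>R T (T (x - z))))\<^sup>2)"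
        unfolding dist_norm by (simp only: real_sqrt_pow2_iff real_sqrt_abs abs_norm_cancel)
      also have "\<dots> \<le> sqrt (q' * (norm (x - z))\<^sup>2)"
        by (intro real_sqrt_le_mono order_trans[OF est]) (simp add: q'_def mult_right_mono)
      also have "\<dots> = sqrt q' * dist x z" by (simp add: real_sqrt_mult dist_norm)
      finally show "dist (x - s *\<^sub>R (T (T x) - y)) (z - s *\<^sub>R (T (T z) - y)) \<le> sqrt q' * dist x z" .
    qed
  qed
  then obtain x where "x - s *\<^sub>R (T (T x) - y) = x" by auto
  then have "T (T x) = y" using s by simp
  then show ?thesis by blast
qed

text \<open>
  An unbounded operator is represented by its graph, because its domain consists of classes of
  functions and a partial map on classes is a relation between them.
\<close>

definition graph_symmetric :: "('a::real_inner \<times> 'a) set \<Rightarrow> bool" where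
  "graph_symmetric G \<longleftrightarrow> (\<forall>(x, x')\<in>G. \<forall>(y, y')\<in>G. x' \<bullet> y = x \<bullet> y')"

definition graph_resolvent_set :: "('a::real_inner \<times> 'a) set \<Rightarrow> real set" where
  "graph_resolvent_set G = {z.
     (\<forall>(x, x')\<in>G. \<forall>(y, y')\<in>G. x' - z *\<^sub>R x = y' - z *\<^sub>R y \<longrightarrow> x = y) \<and>
     (\<forall>g. \<exists>(x, x')\<in>G. x' - z *\<^sub>R x = g) \<and>
     (\<exists>C. \<forall>(x, x')\<in>G. norm x \<le> C * norm (x' - z *\<^sub>R x))}"

lemma graph_resolvent_set_lower_bound:
  assumes "z \<in> graph_resolvent_set G"
  obtains C where "\<And>x x'. (x, x') \<in> G \<Longrightarrow> norm x \<le> C * norm (x' - z *\<^sub>R x)"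
proof -
  have "\<exists>C. \<forall>(x, x')\<in>G. norm x \<le> C * norm (x' - z *\<^sub>R x)"
    using assms unfolding graph_resolvent_set_def mem_Collect_eq by (elim conjE)
  then show ?thesis using that by fast
qed

text \<open>
  The inverse \<open>R\<close> of \<open>G - z\<close> inherits symmetry from \<open>G\<close>, and a symmetric map that is defined on the
  whole space is additive and homogeneous: test \<open>R (x + y) - R x - R y\<close> against every vector.
\<close>

lemma graph_resolvent_operator:
  assumes sym: "graph_symmetric G" and z: "z \<in> graph_resolvent_set G"
  obtains R where "bounded_linear R" "\<And>x y. R x \<bullet> y = x \<bullet> R y"
    "\<And>g. (R g, g + z *\<^sub>R R g) \<in> G" "\<And>x x'. (x, x') \<in> G \<Longrightarrow> R (x' - z *\<^sub>R x) = x"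
proof -
  from z have inj: "\<And>x x' y y'. (x, x') \<in> G \<Longrightarrow> (y, y') \<in> G \<Longrightarrow> x' - z *\<^sub>R x = y' - z *\<^sub>R y \<Longrightarrow> x = y"
    and surj: "\<And>g. \<exists>x x'. (x, x') \<in> G \<and> x' - z *\<^sub>R x = g"
    unfolding graph_resolvent_set_def by fast+
  from z obtain C where C: "\<And>x x'. (x, x') \<in> G \<Longrightarrow> norm x \<le> C * norm (x' - z *\<^sub>R x)"
    using graph_resolvent_set_lower_bound by blast
  have "\<forall>g. \<exists>x. (x, g + z *\<^sub>R x) \<in> G"
  proof
    fix g obtain x x' where "(x, x') \<in> G" "x' - z *\<^sub>R x = g" using surj by blast
    then show "\<exists>x. (x, g + z *\<^sub>R x) \<in> G" by (intro exI[of _ x]) auto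
  qed
  then obtain R where R: "\<And>g. (R g, g + z *\<^sub>R R g) \<in> G" by metis
  have Rinv: "R (x' - z *\<^sub>R x) = x" if "(x, x') \<in> G" for x x'
    using inj[OF R that] by simp
  have Rsym: "R x \<bullet> y = x \<bullet> R y" for x y
  proof -
    have "(x + z *\<^sub>R R x) \<bullet> R y = R x \<bullet> (y + z *\<^sub>R R y)"
      using sym R[of x] R[of y] unfolding graph_symmetric_def by fast
    then show ?thesis by (simp add: inner_add_left inner_add_right)
  qed
  (* a symmetric everywhere defined map is automatically linear *)
  have "bounded_linear R"
  proof (rule bounded_linear_intro[where K = C])
    fix x y and r :: real
    have "(R (x + y) - (R x + R y)) \<bullet> w = 0" for w
      by (simp add: inner_diff_left inner_add_left Rsym)
    from this[of "R (x + y) - (R x + R y)"] show "R (x + y) = R x + R y" by simp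
    have "(R (r *\<^sub>R x) - r *\<^sub>R R x) \<bullet> w = 0" for w
      by (simp add: inner_diff_left inner_scaleR_left Rsym)
    from this[of "R (r *\<^sub>R x) - r *\<^sub>R R x"] show "R (r *\<^sub>R x) = r *\<^sub>R R x" by simp
    show "norm (R x) \<le> norm x * C"
      using C[OF R[of x]] by (simp add: mult.commute)
  qed
  with Rsym R Rinv show ?thesis using that by blast
qed

text \<open>
  For \<open>\<bar>r\<bar> > 1 / d\<close> the point \<open>z + 1 / r\<close> lies in the resolvent set, which makes \<open>R - r\<close> bounded
  below. By \<open>symmetric_norm_le\<close> the norm of \<open>R\<close> is then at most \<open>1 / d\<close>, the reciprocal of
  a distance to the spectrum.
\<close>

theorem symmetric_resolvent_bound:
  assumes sym: "graph_symmetric G" and "d > 0" and sub: "{z - d<..<z + d} \<subseteq> graph_resolvent_set G"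
  obtains R where "bounded_linear R" "\<And>g. (R g, g + z *\<^sub>R R g) \<in> G" "\<And>g. norm (R g) \<le> norm g / d"
proof -
  have "z \<in> graph_resolvent_set G" using sub \<open>d > 0\<close> by auto
  then obtain R where lin: "bounded_linear R" and Rsym: "\<And>x y. R x \<bullet> y = x \<bullet> R y"
    and R: "\<And>g. (R g, g + z *\<^sub>R R g) \<in> G" and Rinv: "\<And>x x'. (x, x') \<in> G \<Longrightarrow> R (x' - z *\<^sub>R x) = x"
    using graph_resolvent_operator[OF sym] by blast
  interpret R: bounded_linear R by fact
  (* R - r is bounded below because G - z - 1/r is: (R - r) g = -r (G - z - 1/r) (R g) *)
  have key: "\<exists>k. \<forall>x. norm x \<le> k * norm (R x - r *\<^sub>R x)" if r: "\<bar>r\<bar> > 1 / d" for r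
  proof -
    have r0: "r \<noteq> 0" using r \<open>d > 0\<close> by (auto simp: field_simps)
    have "\<bar>1 / r\<bar> < d" using r r0 \<open>d > 0\<close> by (simp add: field_simps abs_divide)
    then have "z + 1 / r \<in> {z - d<..<z + d}" unfolding abs_less_iff by simp
    then have "z + 1 / r \<in> graph_resolvent_set G" using sub by blast
    then obtain C where C: "\<And>x x'. (x, x') \<in> G \<Longrightarrow> norm x \<le> C * norm (x' - (z + 1 / r) *\<^sub>R x)"
      using graph_resolvent_set_lower_bound by blast
    have "norm x \<le> ((\<bar>C\<bar> / \<bar>r\<bar> + 1) / \<bar>r\<bar>) * norm (R x - r *\<^sub>R x)" for x
    proof -
      have "x + z *\<^sub>R R x - (z + 1 / r) *\<^sub>R R x = (- 1 / r) *\<^sub>R (R x - r *\<^sub>R x)"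
        using r0 by (simp add: scaleR_add_left scaleR_diff_right)
      then have "norm (R x) \<le> C * (norm (R x - r *\<^sub>R x) / \<bar>r\<bar>)"
        using C[OF R[of x]] by simp
      also have "\<dots> \<le> \<bar>C\<bar> * (norm (R x - r *\<^sub>R x) / \<bar>r\<bar>)"
        by (intro mult_right_mono) auto
      finally have 1: "norm (R x) \<le> \<bar>C\<bar> / \<bar>r\<bar> * norm (R x - r *\<^sub>R x)" by simp
      have "\<bar>r\<bar> * norm x = norm (R x - (R x - r *\<^sub>R x))" by simp
      also have "\<dots> \<le> norm (R x) + norm (R x - r *\<^sub>R x)" by (rule norm_triangle_ineq4)
      also have "\<dots> \<le> (\<bar>C\<bar> / \<bar>r\<bar> + 1) * norm (R x - r *\<^sub>R x)"
        using 1 by (simp add: distrib_right)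
      finally have "norm x * \<bar>r\<bar> \<le> (\<bar>C\<bar> / \<bar>r\<bar> + 1) * norm (R x - r *\<^sub>R x)" by (simp only: mult.commute)
      then have "norm x \<le> (\<bar>C\<bar> / \<bar>r\<bar> + 1) * norm (R x - r *\<^sub>R x) / \<bar>r\<bar>"
        by (rule mult_imp_le_div_pos[rotated]) (use r0 in simp)
      then show ?thesis by simp
    qed
    then show ?thesis by blast
  qed
  have "norm (R g) \<le> (1 / d) * norm g" for g
  proof (rule symmetric_norm_le[OF lin Rsym])
    show "1 / d \<ge> 0" using \<open>d > 0\<close> by simp
    fix r assume "r > 1 / d"
    moreover from this \<open>d > 0\<close> have "r > 0" by (intro less_trans[of 0 "1 / d" r]) auto
    ultimately have "\<bar>r\<bar> > 1 / d" "\<bar>- r\<bar> > 1 / d" by auto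
    from key[OF this(1)] key[OF this(2)]
    show "\<exists>k. \<forall>x. norm x \<le> k * norm (R x - r *\<^sub>R x)" "\<exists>k. \<forall>x. norm x \<le> k * norm (R x + r *\<^sub>R x)"
      by auto
  qed
  with lin R show ?thesis using that by simp
qed

text \<open>
  With the resolvent \<open>R\<close> at \<open>z0\<close>, the operator \<open>T = 1 - (z - z0) R\<close> is bounded and symmetric, and
  \<open>G - z\<close> composed with \<open>R\<close> is \<open>T\<close>. Semiboundedness bounds \<open>G - z\<close>, hence \<open>T\<close>, from below, and
  then \<open>T\<close> is onto.
\<close>

theorem semibounded_resolvent:
  fixes G :: "('a::{real_inner, complete_space} \<times> 'a) set"
  assumes sym: "graph_symmetric G" and z0: "z0 \<in> graph_resolvent_set G"
    and semi: "\<And>x x'. (x, x') \<in> G \<Longrightarrow> x' \<bullet> x \<ge> m * (x \<bullet> x)" and "z < m"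
  shows "z \<in> graph_resolvent_set G"
proof -
  obtain R where lin: "bounded_linear R" and Rsym: "\<And>x y. R x \<bullet> y = x \<bullet> R y"
    and R: "\<And>g. (R g, g + z0 *\<^sub>R R g) \<in> G" and Rinv: "\<And>x x'. (x, x') \<in> G \<Longrightarrow> R (x' - z0 *\<^sub>R x) = x"
    using graph_resolvent_operator[OF sym z0] by blast
  interpret R: bounded_linear R by fact
  define T where "T g = g - (z - z0) *\<^sub>R R g" for g
  have T: "g + z0 *\<^sub>R R g - z *\<^sub>R R g = T g" for g by (simp add: T_def algebra_simps)
  have linT: "bounded_linear T" unfolding T_def
    by (intro bounded_linear_sub bounded_linear_ident bounded_linear_scaleR_right[THEN bounded_linear_compose] lin)
  have low: "norm x \<le> 1 / (m - z) * norm (x' - z *\<^sub>R x)" if "(x, x') \<in> G" for x x'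
  proof (cases "x = 0")
    case False
    have "(m - z) * (norm x * norm x) \<le> (x' - z *\<^sub>R x) \<bullet> x"
      using semi[OF that] by (simp add: inner_diff_left algebra_simps power2_norm_eq_inner flip: power2_eq_square)
    also have "\<dots> \<le> norm (x' - z *\<^sub>R x) * norm x" by (rule norm_cauchy_schwarz)
    finally have "(m - z) * norm x \<le> norm (x' - z *\<^sub>R x)" using False by simp
    then show ?thesis using \<open>z < m\<close> by (simp add: field_simps)
  qed (use \<open>z < m\<close> in simp)
  have belowT: "norm g \<le> (1 + \<bar>z - z0\<bar> / (m - z)) * norm (T g)" for g
  proof -
    have "norm (R g) \<le> 1 / (m - z) * norm (T g)" using low[OF R[of g]] by (simp add: T)
    then have *: "\<bar>z - z0\<bar> * norm (R g) \<le> \<bar>z - z0\<bar> * (1 / (m - z) * norm (T g))"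
      by (intro mult_left_mono) auto
    have "norm g = norm (T g + (z - z0) *\<^sub>R R g)" by (simp add: T_def)
    also have "\<dots> \<le> norm (T g) + \<bar>z - z0\<bar> * norm (R g)"
      by (metis norm_scaleR norm_triangle_ineq)
    finally show ?thesis using * by (simp add: distrib_right)
  qed
  have surjT: "\<exists>x. T x = y" for y
    by (rule symmetric_bounded_below_surj[OF linT _ belowT])
      (simp add: T_def inner_diff_left inner_diff_right Rsym)
  interpret T: bounded_linear T by fact
  have injT: "x = y" if "T x = T y" for x y
    using belowT[of "x - y"] that by (simp add: T.diff)
  have graph: "x = R (x' - z0 *\<^sub>R x) \<and> x' - z *\<^sub>R x = T (x' - z0 *\<^sub>R x)" if "(x, x') \<in> G" for x x'
    using Rinv[OF that] by (simp add: T_def algebra_simps)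
  show ?thesis unfolding graph_resolvent_set_def
  proof (intro CollectI conjI)
    show "\<forall>(x, x')\<in>G. \<forall>(y, y')\<in>G. x' - z *\<^sub>R x = y' - z *\<^sub>R y \<longrightarrow> x = y"
    proof (clarify, rename_tac x x' y y')
      fix x x' y y' assume xy: "(x, x') \<in> G" "(y, y') \<in> G" "x' - z *\<^sub>R x = y' - z *\<^sub>R y"
      then have "T (x' - z0 *\<^sub>R x) = T (y' - z0 *\<^sub>R y)"
        using graph[OF xy(1)] graph[OF xy(2)] by simp
      then have "x' - z0 *\<^sub>R x = y' - z0 *\<^sub>R y" by (rule injT)
      then show "x = y" using Rinv[OF xy(1)] Rinv[OF xy(2)] by simp
    qed
    show "\<forall>g. \<exists>(x, x')\<in>G. x' - z *\<^sub>R x = g"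
    proof
      fix g
      obtain w where "T w = g" using surjT by blast
      then show "\<exists>(x, x')\<in>G. x' - z *\<^sub>R x = g" using R[of w] T[of w] by force
    qed
    show "\<exists>C. \<forall>(x, x')\<in>G. norm x \<le> C * norm (x' - z *\<^sub>R x)" using low by blast
  qed
qed

section \<open>The Hilbert space of square-integrable functions\<close>

lemma L2_measurable: "u \<in> L2 \<Longrightarrow> u \<in> borel_measurable lebesgue"
  by (simp add: L2_def)

lemma L2_integrable_square: "u \<in> L2 \<Longrightarrow> integrable lebesgue (\<lambda>x. (norm (u x))\<^sup>2)"
  by (simp add: L2_def)

lemma L2_I:
  "u \<in> borel_measurable lebesgue \<Longrightarrow> integrable lebesgue (\<lambda>x. (norm (u x))\<^sup>2) \<Longrightarrow> u \<in> L2"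
  by (simp add: L2_def)

lemma L2_dominated:
  fixes u :: "'a::euclidean_space \<Rightarrow> 'b::real_normed_vector" and g :: "'a \<Rightarrow> 'c::real_normed_vector"
  assumes "g \<in> L2" "u \<in> borel_measurable lebesgue" "AE x in lebesgue. norm (u x) \<le> C * norm (g x)"
  shows "u \<in> L2"
proof (rule L2_I)
  show "integrable lebesgue (\<lambda>x. (norm (u x))\<^sup>2)"
  proof (rule Bochner_Integration.integrable_bound)
    show "integrable lebesgue (\<lambda>x. C\<^sup>2 * (norm (g x))\<^sup>2)"
      using L2_integrable_square[OF assms(1)] by simp
    show "(\<lambda>x. (norm (u x))\<^sup>2) \<in> borel_measurable lebesgue" using assms(2) by measurable
    show "AE x in lebesgue. norm ((norm (u x))\<^sup>2) \<le> norm (C\<^sup>2 * (norm (g x))\<^sup>2)"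
      using assms(3)
    proof eventually_elim
      case (elim x)
      then have "(norm (u x))\<^sup>2 \<le> (C * norm (g x))\<^sup>2" by (intro power_mono) auto
      then show ?case by (simp add: power_mult_distrib)
    qed
  qed
qed fact

lemma L2_cong_AE:
  assumes "u \<in> L2" "v \<in> borel_measurable lebesgue" "AE x in lebesgue. u x = v x"
  shows "v \<in> L2"
proof (rule L2_dominated[OF assms(1,2)])
  show "AE x in lebesgue. norm (v x) \<le> 1 * norm (u x)" using assms(3) by eventually_elim simp
qed

lemma L2_add [intro]:
  fixes u v :: "'a::euclidean_space \<Rightarrow> 'b::euclidean_space"
  assumes "u \<in> L2" "v \<in> L2"
  shows "(\<lambda>x. u x + v x) \<in> L2"
proof (rule L2_I)
  note [measurable] = L2_measurable[OF assms(1)] L2_measurable[OF assms(2)]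
  show "(\<lambda>x. u x + v x) \<in> borel_measurable lebesgue" by measurable
  show "integrable lebesgue (\<lambda>x. (norm (u x + v x))\<^sup>2)"
  proof (rule Bochner_Integration.integrable_bound)
    show "integrable lebesgue (\<lambda>x. 2 * (norm (u x))\<^sup>2 + 2 * (norm (v x))\<^sup>2)"
      using assms by (intro Bochner_Integration.integrable_add integrable_mult_right L2_integrable_square)
    show "(\<lambda>x. (norm (u x + v x))\<^sup>2) \<in> borel_measurable lebesgue" by measurable
    have "(norm (u x + v x))\<^sup>2 \<le> 2 * (norm (u x))\<^sup>2 + 2 * (norm (v x))\<^sup>2" for x
    proof -
      have "(norm (u x + v x))\<^sup>2 \<le> (norm (u x) + norm (v x))\<^sup>2"
        by (intro power_mono norm_triangle_ineq) simp
      also have "\<dots> \<le> 2 * (norm (u x))\<^sup>2 + 2 * (norm (v x))\<^sup>2"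
        using sum_squares_bound[of "norm (u x)" "norm (v x)"] by (simp add: power2_sum)
      finally show ?thesis .
    qed
    then show "AE x in lebesgue. norm ((norm (u x + v x))\<^sup>2) \<le> norm (2 * (norm (u x))\<^sup>2 + 2 * (norm (v x))\<^sup>2)"
      by simp
  qed
qed

lemma L2_scaleR [intro]:
  fixes u :: "'a::euclidean_space \<Rightarrow> 'b::euclidean_space"
  assumes "u \<in> L2"
  shows "(\<lambda>x. c *\<^sub>R u x) \<in> L2"
  by (rule L2_dominated[OF assms, of _ "\<bar>c\<bar>"]) (use L2_measurable[OF assms] in auto)

lemma L2_uminus [intro]:
  fixes u :: "'a::euclidean_space \<Rightarrow> 'b::euclidean_space"
  assumes "u \<in> L2"
  shows "(\<lambda>x. - u x) \<in> L2"
  using L2_scaleR[OF assms, of "-1"] by simp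

lemma L2_diff [intro]:
  fixes u v :: "'a::euclidean_space \<Rightarrow> 'b::euclidean_space"
  assumes "u \<in> L2" "v \<in> L2"
  shows "(\<lambda>x. u x - v x) \<in> L2"
  using L2_add[OF assms(1) L2_uminus[OF assms(2)]] by simp

lemma L2_zero [simp, intro]: "(\<lambda>x. 0) \<in> L2"
  by (simp add: L2_def)

lemma L2_inner_integrable:
  fixes u v :: "'a::euclidean_space \<Rightarrow> 'b::euclidean_space"
  assumes "u \<in> L2" "v \<in> L2"
  shows "integrable lebesgue (\<lambda>x. u x \<bullet> v x)"
proof (rule Bochner_Integration.integrable_bound)
  note [measurable] = L2_measurable[OF assms(1)] L2_measurable[OF assms(2)]
  show "integrable lebesgue (\<lambda>x. (norm (u x))\<^sup>2 + (norm (v x))\<^sup>2)"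
    using assms by (intro Bochner_Integration.integrable_add L2_integrable_square)
  show "(\<lambda>x. u x \<bullet> v x) \<in> borel_measurable lebesgue" by measurable
  have "\<bar>u x \<bullet> v x\<bar> \<le> (norm (u x))\<^sup>2 + (norm (v x))\<^sup>2" for x
  proof -
    have "\<bar>u x \<bullet> v x\<bar> \<le> norm (u x) * norm (v x)" by (rule Cauchy_Schwarz_ineq2)
    also have "\<dots> \<le> (norm (u x))\<^sup>2 + (norm (v x))\<^sup>2"
      using sum_squares_bound[of "norm (u x)" "norm (v x)"]
        mult_nonneg_nonneg[OF norm_ge_zero norm_ge_zero, of "u x" "v x"] unfolding mult.assoc by linarith
    finally show ?thesis .
  qed
  then show "AE x in lebesgue. norm (u x \<bullet> v x) \<le> norm ((norm (u x))\<^sup>2 + (norm (v x))\<^sup>2)"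
    by simp
qed

definition L2_inner :: "('a::euclidean_space \<Rightarrow> 'b::euclidean_space) \<Rightarrow> ('a \<Rightarrow> 'b) \<Rightarrow> real" where
  "L2_inner u v = (\<integral>x. u x \<bullet> v x \<partial>lebesgue)"

lemma L2_norm_eq_inner: "L2_norm u = sqrt (L2_inner u u)"
  by (simp add: L2_norm_def L2_inner_def power2_norm_eq_inner)

lemma L2_inner_cong_AE:
  assumes "u \<in> borel_measurable lebesgue" "u' \<in> borel_measurable lebesgue"
    "v \<in> borel_measurable lebesgue" "v' \<in> borel_measurable lebesgue"
    "AE x in lebesgue. u x = u' x" "AE x in lebesgue. v x = v' x"
  shows "L2_inner u v = L2_inner u' v'"
  unfolding L2_inner_def
proof (rule integral_cong_AE)
  note [measurable] = assms(1-4)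
  show "(\<lambda>x. u x \<bullet> v x) \<in> borel_measurable lebesgue" "(\<lambda>x. u' x \<bullet> v' x) \<in> borel_measurable lebesgue"
    by measurable
  show "AE x in lebesgue. u x \<bullet> v x = u' x \<bullet> v' x" using assms(5,6) by eventually_elim simp
qed

definition L2_eq :: "('a::euclidean_space \<Rightarrow> 'b::euclidean_space) \<Rightarrow> ('a \<Rightarrow> 'b) \<Rightarrow> bool" where
  "L2_eq u v \<longleftrightarrow> u \<in> L2 \<and> v \<in> L2 \<and> (AE x in lebesgue. u x = v x)"

lemma L2_eq_refl_iff [simp]: "L2_eq u u \<longleftrightarrow> u \<in> L2"
  by (simp add: L2_eq_def)

quotient_type (overloaded) ('a, 'b) l2 = "'a::euclidean_space \<Rightarrow> 'b::euclidean_space" / partial: L2_eq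
proof (rule part_equivpI)
  show "\<exists>u::'a \<Rightarrow> 'b. L2_eq u u" by (intro exI[of _ "\<lambda>x. 0"]) simp
  show "symp (L2_eq :: ('a \<Rightarrow> 'b) \<Rightarrow> _)" by (auto simp: symp_def L2_eq_def eq_commute)
  show "transp (L2_eq :: ('a \<Rightarrow> 'b) \<Rightarrow> _)" unfolding transp_def L2_eq_def by auto
qed

instantiation l2 :: (euclidean_space, euclidean_space) real_inner
begin

lift_definition zero_l2 :: "('a, 'b) l2" is "\<lambda>x. 0" by simp

lift_definition plus_l2 :: "('a, 'b) l2 \<Rightarrow> ('a, 'b) l2 \<Rightarrow> ('a, 'b) l2" is "\<lambda>u v x. u x + v x"
  by (auto simp: L2_eq_def)

lift_definition minus_l2 :: "('a, 'b) l2 \<Rightarrow> ('a, 'b) l2 \<Rightarrow> ('a, 'b) l2" is "\<lambda>u v x. u x - v x"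
  by (auto simp: L2_eq_def)

lift_definition uminus_l2 :: "('a, 'b) l2 \<Rightarrow> ('a, 'b) l2" is "\<lambda>u x. - u x"
  by (auto simp: L2_eq_def)

lift_definition scaleR_l2 :: "real \<Rightarrow> ('a, 'b) l2 \<Rightarrow> ('a, 'b) l2" is "\<lambda>c u x. c *\<^sub>R u x"
  by (auto simp: L2_eq_def)

lift_definition inner_l2 :: "('a, 'b) l2 \<Rightarrow> ('a, 'b) l2 \<Rightarrow> real" is L2_inner
  by (auto simp: L2_eq_def intro!: L2_inner_cong_AE L2_measurable)

definition norm_l2 :: "('a, 'b) l2 \<Rightarrow> real" where "norm_l2 u = sqrt (inner u u)"
definition dist_l2 :: "('a, 'b) l2 \<Rightarrow> ('a, 'b) l2 \<Rightarrow> real" where "dist_l2 u v = norm (u - v)"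
definition sgn_l2 :: "('a, 'b) l2 \<Rightarrow> ('a, 'b) l2" where "sgn_l2 u = scaleR (inverse (norm u)) u"
definition uniformity_l2 :: "(('a, 'b) l2 \<times> ('a, 'b) l2) filter"
  where "uniformity_l2 = (INF e\<in>{0<..}. principal {(x, y). dist x y < e})"
definition open_l2 :: "('a, 'b) l2 set \<Rightarrow> bool"
  where "open_l2 S = (\<forall>x\<in>S. \<forall>\<^sub>F (x', y) in uniformity. x' = x \<longrightarrow> y \<in> S)"

instance
proof
  fix x y z :: "('a, 'b) l2" and a b :: real
  show "x + y + z = x + (y + z)" by transfer (auto simp: L2_eq_def add.assoc)
  show "x + y = y + x" by transfer (auto simp: L2_eq_def add.commute)
  show "0 + x = x" by transfer (auto simp: L2_eq_def)
  show "- x + x = 0" by transfer (auto simp: L2_eq_def)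
  show "x - y = x + - y" by transfer (auto simp: L2_eq_def)
  show "a *\<^sub>R (x + y) = a *\<^sub>R x + a *\<^sub>R y" by transfer (auto simp: L2_eq_def scaleR_add_right)
  show "(a + b) *\<^sub>R x = a *\<^sub>R x + b *\<^sub>R x" by transfer (auto simp: L2_eq_def scaleR_add_left)
  show "a *\<^sub>R b *\<^sub>R x = (a * b) *\<^sub>R x" by transfer (auto simp: L2_eq_def)
  show "1 *\<^sub>R x = x" by transfer (auto simp: L2_eq_def)
  show "inner x y = inner y x" by transfer (simp add: L2_inner_def inner_commute)
  show "inner (x + y) z = inner x z + inner y z"
  proof transfer
    fix u v w :: "'a \<Rightarrow> 'b" assume "L2_eq u u" "L2_eq v v" "L2_eq w w"
    then show "L2_inner (\<lambda>x. u x + v x) w = L2_inner u w + L2_inner v w"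
      by (simp add: L2_inner_def inner_add_left L2_inner_integrable)
  qed
  show "inner (a *\<^sub>R x) y = a * inner x y" by transfer (simp add: L2_inner_def)
  show "0 \<le> inner x x" by transfer (simp add: L2_inner_def)
  show "inner x x = 0 \<longleftrightarrow> x = 0"
  proof transfer
    fix u :: "'a \<Rightarrow> 'b" assume "L2_eq u u"
    then have u: "u \<in> L2" by simp
    have "L2_inner u u = 0 \<longleftrightarrow> (AE x in lebesgue. u x \<bullet> u x = 0)"
      unfolding L2_inner_def
      by (rule integral_nonneg_eq_0_iff_AE[OF L2_inner_integrable[OF u u]]) simp
    then show "L2_inner u u = 0 \<longleftrightarrow> L2_eq u (\<lambda>x. 0)" using u by (simp add: L2_eq_def)
  qed
qed (simp_all only: norm_l2_def dist_l2_def sgn_l2_def uniformity_l2_def open_l2_def)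

end

lift_definition l2_of :: "('a::euclidean_space \<Rightarrow> 'b::euclidean_space) \<Rightarrow> ('a, 'b) l2"
  is "\<lambda>u. if u \<in> L2 then u else (\<lambda>x. 0)" by simp

lemma l2_of_eq_iff: "u \<in> L2 \<Longrightarrow> v \<in> L2 \<Longrightarrow> l2_of u = l2_of v \<longleftrightarrow> (AE x in lebesgue. u x = v x)"
  by transfer (simp add: L2_eq_def)

lemma l2_of_cases:
  obtains u where "u \<in> L2" "x = l2_of u"
proof -
  have "\<exists>u. u \<in> L2 \<and> x = l2_of u"
    by transfer (metis L2_eq_refl_iff)
  then show ?thesis using that by blast
qed

lemma l2_of_add: "u \<in> L2 \<Longrightarrow> v \<in> L2 \<Longrightarrow> l2_of u + l2_of v = l2_of (\<lambda>x. u x + v x)"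
  by transfer (simp add: L2_add)

lemma l2_of_diff: "u \<in> L2 \<Longrightarrow> v \<in> L2 \<Longrightarrow> l2_of u - l2_of v = l2_of (\<lambda>x. u x - v x)"
  by transfer (simp add: L2_diff)

lemma l2_of_scaleR: "u \<in> L2 \<Longrightarrow> c *\<^sub>R l2_of u = l2_of (\<lambda>x. c *\<^sub>R u x)"
  by transfer (simp add: L2_scaleR)

lemma inner_l2_of: "u \<in> L2 \<Longrightarrow> v \<in> L2 \<Longrightarrow> l2_of u \<bullet> l2_of v = L2_inner u v"
  by transfer simp

lemma norm_l2_of: "u \<in> L2 \<Longrightarrow> norm (l2_of u) = L2_norm u"
  by (simp add: norm_l2_def inner_l2_of L2_norm_eq_inner)

lemma power2_norm_l2_of: "u \<in> L2 \<Longrightarrow> (norm (l2_of u))\<^sup>2 = (\<integral>x. (norm (u x))\<^sup>2 \<partial>lebesgue)"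
  by (simp add: norm_l2_of L2_norm_def)

lemma nn_integral_L2:
  assumes "u \<in> L2"
  shows "(\<integral>\<^sup>+x. ennreal ((norm (u x))\<^sup>2) \<partial>lebesgue) = ennreal ((norm (l2_of u))\<^sup>2)"
  using nn_integral_eq_integral[OF L2_integrable_square[OF assms]] assms
  by (simp add: power2_norm_l2_of)

lemma L2_I_nn_integral:
  fixes u :: "'a::euclidean_space \<Rightarrow> 'b::euclidean_space"
  assumes "u \<in> borel_measurable lebesgue" "(\<integral>\<^sup>+x. ennreal ((norm (u x))\<^sup>2) \<partial>lebesgue) \<le> ennreal (C\<^sup>2)" "C \<ge> 0"
  shows "u \<in> L2" "norm (l2_of u) \<le> C"
proof -
  note [measurable] = assms(1)
  show u: "u \<in> L2"
  proof (rule L2_I[OF assms(1)])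
    show "integrable lebesgue (\<lambda>x. (norm (u x))\<^sup>2)"
      by (rule integrableI_bounded) (use assms(2) in \<open>auto simp: ennreal_power intro: order_le_less_trans\<close>)
  qed
  have "(norm (l2_of u))\<^sup>2 \<le> C\<^sup>2"
    using assms(2) nn_integral_L2[OF u] by simp
  then show "norm (l2_of u) \<le> C" using \<open>C \<ge> 0\<close> by (rule power2_le_imp_le)
qed

text \<open>Riesz and Fischer: a subsequence with summable increments converges almost everywhere, and
  Fatou's lemma carries the Cauchy estimate over to the pointwise limit.\<close>

instance l2 :: (euclidean_space, euclidean_space) complete_space
proof
  fix X :: "nat \<Rightarrow> ('a, 'b) l2" assume X: "Cauchy X"
  have "\<forall>n. \<exists>N. \<forall>m\<ge>N. \<forall>k\<ge>N. norm (X m - X k) < (1/2)^n"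
    using X unfolding Cauchy_iff by (metis zero_less_divide_1_iff zero_less_numeral zero_less_power)
  then obtain N where N: "\<And>n m k. m \<ge> N n \<Longrightarrow> k \<ge> N n \<Longrightarrow> norm (X m - X k) < (1/2)^n" by metis
  define r where "r n = (\<Sum>i\<le>n. Suc (N i))" for n
  have r: "strict_mono r" by (rule strict_mono_Suc_iff[THEN iffD2]) (simp add: r_def)
  have rN: "r m \<ge> N n" if "m \<ge> n" for m n
  proof -
    have "Suc (N n) \<le> r m" unfolding r_def using that
      by (intro member_le_sum[of n "{..m}" "\<lambda>i. Suc (N i)"]) auto
    then show ?thesis by simp
  qed
  have "\<forall>n. \<exists>u. u \<in> L2 \<and> X (r n) = l2_of u" by (metis l2_of_cases)
  then obtain u where u: "\<And>n. u n \<in> L2" and Xu: "\<And>n. X (r n) = l2_of (u n)" by metis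
  note [measurable] = L2_measurable[OF u]
  have close: "norm (l2_of (\<lambda>x. u m x - u n x)) \<le> (1/2)^n" if "m \<ge> n" for m n
    using N[OF rN[OF that] rN[OF order_refl]] by (simp add: Xu l2_of_diff u)
  have nn_close: "(\<integral>\<^sup>+x. ennreal ((norm (u m x - u n x))\<^sup>2) \<partial>lebesgue) \<le> ennreal (((1/2)^n)\<^sup>2)" if "m \<ge> n" for m n
    using close[OF that] nn_integral_L2[OF L2_diff[OF u u], of m n] by (simp add: power_mono)
  (* with the weight 2^n the squared increments still have a finite sum, and its terms bound the increments geometrically *)
  have "(\<integral>\<^sup>+x. (\<Sum>n. ennreal (2^n * (norm (u (Suc n) x - u n x))\<^sup>2)) \<partial>lebesgue)
      = (\<Sum>n. \<integral>\<^sup>+x. ennreal (2^n * (norm (u (Suc n) x - u n x))\<^sup>2) \<partial>lebesgue)"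
    by (rule nn_integral_suminf) measurable
  also have "\<dots> \<le> (\<Sum>n. ennreal ((1/2)^n))"
  proof (intro suminf_le allI)
    fix n
    have "(\<integral>\<^sup>+x. ennreal (2^n * (norm (u (Suc n) x - u n x))\<^sup>2) \<partial>lebesgue)
      = ennreal (2^n) * (\<integral>\<^sup>+x. ennreal ((norm (u (Suc n) x - u n x))\<^sup>2) \<partial>lebesgue)"
      by (subst nn_integral_cmult[symmetric]) (auto simp: ennreal_mult)
    also have "\<dots> \<le> ennreal (2^n) * ennreal (((1/2)^n)\<^sup>2)"
      by (intro mult_left_mono nn_close) auto
    also have "\<dots> = ennreal ((1/2)^n)"
      by (simp add: ennreal_mult[symmetric] power2_eq_square power_divide)
    finally show "(\<integral>\<^sup>+x. ennreal (2^n * (norm (u (Suc n) x - u n x))\<^sup>2) \<partial>lebesgue) \<le> ennreal ((1/2)^n)" .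
  qed auto
  also have "\<dots> = ennreal (\<Sum>n. (1/2)^n)" by (rule suminf_ennreal2) auto
  also have "\<dots> < \<infinity>" by simp
  finally have "AE x in lebesgue. (\<Sum>n. ennreal (2^n * (norm (u (Suc n) x - u n x))\<^sup>2)) \<noteq> \<infinity>"
    by (intro nn_integral_PInf_AE) auto
  then have conv: "AE x in lebesgue. convergent (\<lambda>n. u n x)"
  proof eventually_elim
    case (elim x)
    have "summable (\<lambda>n. 2^n * (norm (u (Suc n) x - u n x))\<^sup>2)"
      by (rule summable_suminf_not_top) (use elim in auto)
    then have "Bseq (\<lambda>n. 2^n * (norm (u (Suc n) x - u n x))\<^sup>2)"
      by (intro convergent_imp_Bseq convergentI[OF summable_LIMSEQ_zero])
    then obtain K where K: "K > 0" "\<And>n. norm (2^n * (norm (u (Suc n) x - u n x))\<^sup>2) \<le> K"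
      by (auto elim: BseqE)
    have "norm (u (Suc n) x - u n x) \<le> sqrt K * (1 / sqrt 2)^n" for n
    proof -
      have "(norm (u (Suc n) x - u n x))\<^sup>2 \<le> K / 2^n"
        using K(2)[of n] by (simp add: field_simps)
      then have "norm (u (Suc n) x - u n x) \<le> sqrt (K / 2^n)" by (rule real_le_rsqrt)
      also have "\<dots> = sqrt K * (1 / sqrt 2)^n"
        by (simp add: real_sqrt_divide real_sqrt_power power_divide)
      finally show ?thesis .
    qed
    then have bound: "norm (u (Suc n) x - u n x) \<le> sqrt K * (1 / sqrt 2)^n" if "n \<ge> 0" for n by blast
    have "summable (\<lambda>n. sqrt K * (1 / sqrt 2)^n)"
      by (rule summable_mult[OF summable_geometric]) simp
    then have "summable (\<lambda>n. u (Suc n) x - u n x)"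
      by (rule summable_comparison_test'[OF _ bound])
    then have "convergent (\<lambda>N. (\<Sum>n<N. u (Suc n) x - u n x) + u 0 x)"
      unfolding summable_iff_convergent by (rule convergent_add[OF _ convergent_const])
    moreover have "(\<Sum>n<N. u (Suc n) x - u n x) + u 0 x = u N x" for N
      using sum_lessThan_telescope[of "\<lambda>n. u n x" N] by simp
    ultimately show ?case by simp
  qed
  define w where "w x = lim (\<lambda>n. u n x)" for x
  have [measurable]: "w \<in> borel_measurable lebesgue"
    unfolding w_def by (rule borel_measurable_lim_metric) measurable
  have fatou: "(\<integral>\<^sup>+x. ennreal ((norm (w x - u n x))\<^sup>2) \<partial>lebesgue) \<le> ennreal (((1/2)^n)\<^sup>2)" for n
  proof -
    have "(\<integral>\<^sup>+x. ennreal ((norm (w x - u n x))\<^sup>2) \<partial>lebesgue)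
      = (\<integral>\<^sup>+x. liminf (\<lambda>m. ennreal ((norm (u m x - u n x))\<^sup>2)) \<partial>lebesgue)"
    proof (rule nn_integral_cong_AE)
      show "AE x in lebesgue. ennreal ((norm (w x - u n x))\<^sup>2) = liminf (\<lambda>m. ennreal ((norm (u m x - u n x))\<^sup>2))"
        using conv
      proof eventually_elim
        case (elim x)
        then have "(\<lambda>m. u m x) \<longlonglongrightarrow> w x" by (simp add: w_def convergent_LIMSEQ_iff)
        then have "(\<lambda>m. ennreal ((norm (u m x - u n x))\<^sup>2)) \<longlonglongrightarrow> ennreal ((norm (w x - u n x))\<^sup>2)"
          by (intro tendsto_intros)
        then show ?case by (rule lim_imp_Liminf[OF trivial_limit_sequentially, symmetric])
      qed
    qed
    also have "\<dots> \<le> liminf (\<lambda>m. \<integral>\<^sup>+x. ennreal ((norm (u m x - u n x))\<^sup>2) \<partial>lebesgue)"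
      by (rule nn_integral_liminf) measurable
    also have "\<dots> \<le> ennreal (((1/2)^n)\<^sup>2)"
      by (rule Liminf_le) (auto simp: eventually_sequentially intro!: exI[of _ n] nn_close)
    finally show ?thesis .
  qed
  have wu: "(\<lambda>x. w x - u n x) \<in> L2" "norm (l2_of (\<lambda>x. w x - u n x)) \<le> (1/2)^n" for n
    using L2_I_nn_integral[OF _ fatou[of n]] by auto
  have w: "w \<in> L2" using L2_add[OF wu(1)[of 0] u[of 0]] by simp
  have "(X \<circ> r) \<longlonglongrightarrow> l2_of w"
  proof (rule LIM_zero_cancel, rule Lim_null_comparison)
    show "\<forall>\<^sub>F n in sequentially. norm ((X \<circ> r) n - l2_of w) \<le> (1/2)^n"
      using wu(2) unfolding o_def Xu norm_minus_commute[of "l2_of (u _)"] by (simp add: l2_of_diff u w)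
    show "(\<lambda>n. (1 / 2)^n :: real) \<longlonglongrightarrow> 0" by (rule LIMSEQ_power_zero) simp
  qed
  then have "X \<longlonglongrightarrow> l2_of w" by (rule Cauchy_converges_subseq[OF X r])
  then show "convergent X" by (rule convergentI)
qed

section \<open>Test functions\<close>

text \<open>With \<open>p = 1\<close> this is the classical function that is flat at the origin; the class is closed under differentiation,
  which is why a polynomial factor is carried along.\<close>

definition flat_exp :: "real poly \<Rightarrow> real \<Rightarrow> real" where
  "flat_exp p t = (if t > 0 then poly p (1 / t) * exp (- (1 / t)) else 0)"

lemma power_poly_exp_tendsto_0:
  fixes p :: "real poly"
  shows "((\<lambda>s. s ^ k * poly p s * exp (- s)) \<longlongrightarrow> 0) at_top"
proof (induction p arbitrary: k)
  case 0
  then show ?case by simp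
next
  case (pCons a p)
  have "((\<lambda>s::real. a * (s ^ k / exp s) + s ^ Suc k * poly p s * exp (- s)) \<longlongrightarrow> a * 0 + 0) at_top"
    by (intro tendsto_add tendsto_mult tendsto_const tendsto_power_div_exp_0 pCons.IH)
  moreover have "a * (s ^ k / exp s) + s ^ Suc k * poly p s * exp (- s) = s ^ k * poly (pCons a p) s * exp (- s)" for s
    by (simp add: exp_minus field_simps)
  ultimately show ?case by simp
qed

lemma flat_exp_has_derivative:
  "(flat_exp p has_real_derivative flat_exp ([:0, 0, 1:] * (p - pderiv p)) t) (at t)"
proof -
  consider "t > 0" | "t < 0" | "t = 0" by linarith
  then show ?thesis
  proof cases
    case 1
    have "((\<lambda>t. poly p (1 / t) * exp (- (1 / t))) has_real_derivative flat_exp ([:0, 0, 1:] * (p - pderiv p)) t) (at t)"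
      using 1 by (auto intro!: derivative_eq_intros simp: flat_exp_def field_simps power2_eq_square)
    then show ?thesis
      by (rule has_field_derivative_transform_within_open[of _ _ _ "{0<..}"]) (use 1 in \<open>auto simp: flat_exp_def\<close>)
  next
    case 2
    have "((\<lambda>t. 0) has_real_derivative flat_exp ([:0, 0, 1:] * (p - pderiv p)) t) (at t)"
      using 2 by (simp add: flat_exp_def)
    then show ?thesis
      by (rule has_field_derivative_transform_within_open[of _ _ _ "{..<0}"]) (use 2 in \<open>auto simp: flat_exp_def\<close>)
  next
    case 3
    have "((\<lambda>h. inverse h ^ 1 * poly p (inverse h) * exp (- inverse h)) \<longlongrightarrow> 0) (at_right 0)"
      by (rule filterlim_compose[OF power_poly_exp_tendsto_0 filterlim_inverse_at_top_right])
    then have right: "((\<lambda>h. flat_exp p h / h) \<longlongrightarrow> 0) (at_right 0)"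
    proof (rule Lim_transform_eventually)
      show "\<forall>\<^sub>F h in at_right 0. inverse h ^ 1 * poly p (inverse h) * exp (- inverse h) = flat_exp p h / h"
        by (rule eventually_mono[OF eventually_at_right_less]) (simp add: flat_exp_def field_simps inverse_eq_divide)
    qed
    have left: "((\<lambda>h. flat_exp p h / h) \<longlongrightarrow> 0) (at_left 0)"
      by (rule Lim_transform_eventually[OF tendsto_const])
        (rule eventually_mono[OF eventually_at_left_real[of "-1" 0]], auto simp: flat_exp_def)
    have "((\<lambda>h. flat_exp p h / h) \<longlongrightarrow> 0) (at 0)"
      using left right by (simp add: filterlim_at_split)
    then show ?thesis using 3 by (simp add: has_field_derivative_iff flat_exp_def)
  qed
qed

text \<open>
  Smoothness is proved by induction on the number of derivatives, because the product rule turns one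
  product into a sum of two, which rules out a direct induction over the list of directions.
\<close>

primrec Ck :: "nat \<Rightarrow> (real^'n::finite \<Rightarrow> real) \<Rightarrow> bool" where
  "Ck 0 \<phi> \<longleftrightarrow> (\<forall>x. \<phi> differentiable (at x))"
| "Ck (Suc k) \<phi> \<longleftrightarrow> (\<forall>x. \<phi> differentiable (at x)) \<and> (\<forall>i. Ck k (partial i \<phi>))"

lemma Ck_differentiable: "Ck k \<phi> \<Longrightarrow> \<phi> differentiable (at x)"
  by (cases k) auto

lemma Ck_SucD: "Ck (Suc k) \<phi> \<Longrightarrow> Ck k \<phi>"
  by (induction k arbitrary: \<phi>) auto

lemma partials_Nil [simp]: "partials [] \<phi> = \<phi>"
  by (simp add: partials_def)

lemma partials_snoc: "partials (is @ [i]) \<phi> = partials is (partial i \<phi>)"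
  by (simp add: partials_def)

lemma partials_Cons: "partials (i # is) \<phi> = partial i (partials is \<phi>)"
  by (simp add: partials_def)

lemma Ck_iff: "Ck k \<phi> \<longleftrightarrow> (\<forall>is x. length is \<le> k \<longrightarrow> partials is \<phi> differentiable (at x))"
proof (induction k arbitrary: \<phi>)
  case 0
  then show ?case by simp
next
  case (Suc k)
  show ?case
  proof (intro iffI allI impI)
    fix "is" :: "'a list" and x
    assume C: "Ck (Suc k) \<phi>" and len: "length is \<le> Suc k"
    show "partials is \<phi> differentiable (at x)"
    proof (cases "is" rule: rev_cases)
      case Nil
      then show ?thesis using C by simp
    next
      case (snoc js i)
      then show ?thesis using C len Suc.IH[of "partial i \<phi>"] by (simp add: partials_snoc)
    qed
  next
    assume A: "\<forall>is x. length is \<le> Suc k \<longrightarrow> partials is \<phi> differentiable (at x)"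
    have "\<phi> differentiable (at x)" for x using A[rule_format, of "[]"] by simp
    moreover have "Ck k (partial i \<phi>)" for i
      unfolding Suc.IH using A[rule_format, of "_ @ [i]"] by (simp add: partials_snoc)
    ultimately show "Ck (Suc k) \<phi>" by simp
  qed
qed

definition smooth :: "(real^'n::finite \<Rightarrow> real) \<Rightarrow> bool" where
  "smooth \<phi> \<longleftrightarrow> (\<forall>k. Ck k \<phi>)"

lemma smooth_iff: "smooth \<phi> \<longleftrightarrow> (\<forall>is x. partials is \<phi> differentiable (at x))"
  by (auto simp: smooth_def Ck_iff)

lemma smooth_differentiable: "smooth \<phi> \<Longrightarrow> \<phi> differentiable (at x)"
  using Ck_differentiable unfolding smooth_def by blast

lemma smooth_partial: "smooth \<phi> \<Longrightarrow> smooth (partial i \<phi>)"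
  unfolding smooth_def by (metis Ck.simps(2))

lemma smooth_partials: "smooth \<phi> \<Longrightarrow> smooth (partials is \<phi>)"
  by (induction "is") (simp_all add: partials_Cons smooth_partial)

lemma smooth_continuous: "smooth \<phi> \<Longrightarrow> continuous_on S \<phi>"
  by (meson smooth_differentiable differentiable_imp_continuous_within continuous_at_imp_continuous_on)

lemma partial_eqI: "(\<phi> has_derivative D) (at x) \<Longrightarrow> partial i \<phi> x = D (axis i 1)"
  unfolding partial_def using frechet_derivative_at by metis

lemma differentiable_has_derivative_partial:
  assumes "\<phi> differentiable (at x)"
  shows "(\<phi> has_derivative (\<lambda>h. \<Sum>i\<in>UNIV. h $ i * partial i \<phi> x)) (at x)"
proof -
  obtain D where D: "(\<phi> has_derivative D) (at x)" using assms by (auto simp: differentiable_def)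
  interpret D: bounded_linear D using D by (rule has_derivative_bounded_linear)
  have "D h = (\<Sum>i\<in>UNIV. h $ i * partial i \<phi> x)" for h
  proof -
    have "D h = D (\<Sum>i\<in>UNIV. h $ i *\<^sub>R axis i 1)"
      by (simp add: basis_expansion scalar_mult_eq_scaleR[symmetric])
    also have "\<dots> = (\<Sum>i\<in>UNIV. h $ i * D (axis i 1))" by (simp add: D.sum D.scaleR)
    finally show ?thesis by (simp add: partial_eqI[OF D])
  qed
  then show ?thesis using D by (metis (no_types, lifting) ext)
qed

lemma partial_add:
  assumes "\<And>x. \<phi> differentiable (at x)" "\<And>x. \<psi> differentiable (at x)"
  shows "partial i (\<lambda>x. \<phi> x + \<psi> x) = (\<lambda>x. partial i \<phi> x + partial i \<psi> x)"
proof
  fix x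
  obtain D where D: "(\<phi> has_derivative D) (at x)"
    using assms(1)[of x] by (auto simp: differentiable_def)
  obtain E where E: "(\<psi> has_derivative E) (at x)"
    using assms(2)[of x] by (auto simp: differentiable_def)
  show "partial i (\<lambda>x. \<phi> x + \<psi> x) x = partial i \<phi> x + partial i \<psi> x"
    by (simp add: partial_eqI[OF has_derivative_add[OF D E]] partial_eqI[OF D] partial_eqI[OF E])
qed

lemma partial_mult:
  assumes "\<And>x. \<phi> differentiable (at x)" "\<And>x. \<psi> differentiable (at x)"
  shows "partial i (\<lambda>x. \<phi> x * \<psi> x) = (\<lambda>x. partial i \<phi> x * \<psi> x + \<phi> x * partial i \<psi> x)"
proof
  fix x
  obtain D where D: "(\<phi> has_derivative D) (at x)"
    using assms(1)[of x] by (auto simp: differentiable_def)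
  obtain E where E: "(\<psi> has_derivative E) (at x)"
    using assms(2)[of x] by (auto simp: differentiable_def)
  show "partial i (\<lambda>x. \<phi> x * \<psi> x) x = partial i \<phi> x * \<psi> x + \<phi> x * partial i \<psi> x"
    by (simp add: partial_eqI[OF has_derivative_mult[OF D E]] partial_eqI[OF D] partial_eqI[OF E])
qed

lemma partial_const [simp]: "partial i (\<lambda>x. c) = (\<lambda>x. 0)"
  using partial_eqI[OF has_derivative_const] by fastforce

lemma affine_has_derivative:
  assumes "(\<phi> has_derivative D) (at (c *\<^sub>R x + b))"
  shows "((\<lambda>x. \<phi> (c *\<^sub>R x + b)) has_derivative (\<lambda>h. D (c *\<^sub>R h))) (at x)"
proof -
  have "((\<lambda>x. c *\<^sub>R x + b) has_derivative (\<lambda>h. c *\<^sub>R h)) (at x)"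
    by (auto intro!: derivative_eq_intros)
  from has_derivative_compose[OF this assms] show ?thesis .
qed

lemma partial_affine:
  assumes "\<And>x. \<phi> differentiable (at x)"
  shows "partial i (\<lambda>x. \<phi> (c *\<^sub>R x + b)) = (\<lambda>x. c * partial i \<phi> (c *\<^sub>R x + b))"
proof
  fix x
  obtain D where D: "(\<phi> has_derivative D) (at (c *\<^sub>R x + b))"
    using assms by (auto simp: differentiable_def)
  interpret D: bounded_linear D using D by (rule has_derivative_bounded_linear)
  show "partial i (\<lambda>x. \<phi> (c *\<^sub>R x + b)) x = c * partial i \<phi> (c *\<^sub>R x + b)"
    by (simp add: partial_eqI[OF affine_has_derivative[OF D]] partial_eqI[OF D] D.scaleR)
qed

lemma Ck_const: "Ck k (\<lambda>x. c)"
  by (induction k arbitrary: c) auto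

lemma Ck_add: "Ck k \<phi> \<Longrightarrow> Ck k \<psi> \<Longrightarrow> Ck k (\<lambda>x. \<phi> x + \<psi> x)"
  by (induction k arbitrary: \<phi> \<psi>) (auto simp: partial_add intro!: differentiable_add)

lemma Ck_mult: "Ck k \<phi> \<Longrightarrow> Ck k \<psi> \<Longrightarrow> Ck k (\<lambda>x. \<phi> x * \<psi> x)"
proof (induction k arbitrary: \<phi> \<psi>)
  case 0
  then show ?case by (auto intro!: differentiable_mult)
next
  case (Suc k)
  have "Ck k (\<lambda>x. partial i \<phi> x * \<psi> x + \<phi> x * partial i \<psi> x)" for i
    using Suc.prems Ck_SucD[OF Suc.prems(1)] Ck_SucD[OF Suc.prems(2)] by (intro Ck_add Suc.IH) auto
  then show ?case using Suc.prems by (auto simp: partial_mult intro!: differentiable_mult)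
qed

lemma Ck_affine: "Ck k \<phi> \<Longrightarrow> Ck k (\<lambda>x. \<phi> (c *\<^sub>R x + b))"
proof (induction k arbitrary: \<phi>)
  case 0
  then show ?case unfolding Ck.simps differentiable_def using affine_has_derivative by blast
next
  case (Suc k)
  have "(\<lambda>x. \<phi> (c *\<^sub>R x + b)) differentiable (at x)" for x
    using Suc.prems unfolding Ck.simps differentiable_def using affine_has_derivative by blast
  moreover have "Ck k (\<lambda>x. c * partial i \<phi> (c *\<^sub>R x + b))" for i
    using Suc by (intro Ck_mult Ck_const) auto
  ultimately show ?case using Suc.prems by (simp add: partial_affine)
qed

lemma smooth_const: "smooth (\<lambda>x. c)"
  by (simp add: smooth_def Ck_const)

lemma smooth_add: "smooth \<phi> \<Longrightarrow> smooth \<psi> \<Longrightarrow> smooth (\<lambda>x. \<phi> x + \<psi> x)"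
  by (simp add: smooth_def Ck_add)

lemma smooth_mult: "smooth \<phi> \<Longrightarrow> smooth \<psi> \<Longrightarrow> smooth (\<lambda>x. \<phi> x * \<psi> x)"
  by (simp add: smooth_def Ck_mult)

lemma smooth_affine: "smooth \<phi> \<Longrightarrow> smooth (\<lambda>x. \<phi> (c *\<^sub>R x + b))"
  by (simp add: smooth_def Ck_affine)

lemma smooth_prod:
  "finite I \<Longrightarrow> (\<And>i. i \<in> I \<Longrightarrow> smooth (\<phi> i)) \<Longrightarrow> smooth (\<lambda>x. \<Prod>i\<in>I. \<phi> i x)"
  by (induction I rule: finite_induct) (auto simp: smooth_const smooth_mult)

lemma smooth_flat_exp: "smooth (\<lambda>x::real^'n::finite. flat_exp p (c * x $ i + d))"
proof -
  have der: "((\<lambda>x::real^'n. flat_exp p (c * x $ i + d)) has_derivative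
      (\<lambda>h. flat_exp ([:0, 0, 1:] * (p - pderiv p)) (c * x $ i + d) * (c * h $ i))) (at x)" for p x
  proof -
    have "((\<lambda>x::real^'n. c * x $ i + d) has_derivative (\<lambda>h. c * h $ i)) (at x)"
      by (auto intro!: derivative_eq_intros bounded_linear.has_derivative[OF bounded_linear_vec_nth])
    from has_derivative_compose[OF this flat_exp_has_derivative[of p "c * x $ i + d", unfolded has_field_derivative_def]]
    show ?thesis .
  qed
  have "Ck k (\<lambda>x::real^'n. flat_exp p (c * x $ i + d))" for k
  proof (induction k arbitrary: p)
    case 0
    then show ?case using der unfolding Ck.simps differentiable_def by blast
  next
    case (Suc k)
    have "partial j (\<lambda>x::real^'n. flat_exp p (c * x $ i + d))
      = (\<lambda>x. flat_exp ([:0, 0, 1:] * (p - pderiv p)) (c * x $ i + d) * (c * axis j 1 $ i))" for j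
      using partial_eqI[OF der] by fastforce
    moreover have "Ck k (\<lambda>x. flat_exp ([:0, 0, 1:] * (p - pderiv p)) (c * x $ i + d) * (c * axis j 1 $ i))" for j
      by (intro Ck_mult Ck_const Suc.IH)
    moreover have "(\<lambda>x::real^'n. flat_exp p (c * x $ i + d)) differentiable (at x)" for x
      using der unfolding differentiable_def by blast
    ultimately show ?case by simp
  qed
  then show ?thesis by (simp add: smooth_def)
qed

lemma test_function_iff:
  "\<phi> \<in> test_functions \<longleftrightarrow> smooth \<phi> \<and> (\<exists>R. \<forall>x. norm x > R \<longrightarrow> \<phi> x = 0)"
proof -
  have "bounded {x. \<phi> x \<noteq> 0} \<longleftrightarrow> (\<exists>R. \<forall>x. norm x > R \<longrightarrow> \<phi> x = 0)"
    unfolding bounded_iff by (auto simp: not_less[symmetric])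
  then show ?thesis by (simp add: test_functions_def smooth_iff compact_closure)
qed

lemma test_smooth: "\<phi> \<in> test_functions \<Longrightarrow> smooth \<phi>"
  by (simp add: test_function_iff)

lemma test_support:
  assumes "\<phi> \<in> test_functions"
  obtains R where "R > 0" "\<And>x. norm x > R \<Longrightarrow> \<phi> x = 0"
proof -
  obtain R where "\<And>x. norm x > R \<Longrightarrow> \<phi> x = 0" using assms by (auto simp: test_function_iff)
  then show ?thesis using that[of "max R 1"] by auto
qed

lemma test_mult: "\<phi> \<in> test_functions \<Longrightarrow> smooth \<psi> \<Longrightarrow> (\<lambda>x. \<phi> x * \<psi> x) \<in> test_functions"
  by (auto simp: test_function_iff smooth_mult)

lemma test_cmult: "\<phi> \<in> test_functions \<Longrightarrow> (\<lambda>x. c * \<phi> x) \<in> test_functions"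
  using test_mult[of \<phi> "\<lambda>x. c"] by (simp add: smooth_const mult.commute)

lemma test_add:
  assumes "\<phi> \<in> test_functions" "\<psi> \<in> test_functions"
  shows "(\<lambda>x. \<phi> x + \<psi> x) \<in> test_functions"
proof -
  obtain R S where "\<And>x. norm x > R \<Longrightarrow> \<phi> x = 0" "\<And>x. norm x > S \<Longrightarrow> \<psi> x = 0"
    using assms by (meson test_support)
  then have "\<forall>x. norm x > max R S \<longrightarrow> \<phi> x + \<psi> x = 0" by auto
  then show ?thesis using assms unfolding test_function_iff by (blast intro: smooth_add)
qed

lemma test_affine:
  assumes "\<phi> \<in> test_functions" "c \<noteq> 0"
  shows "(\<lambda>x. \<phi> (c *\<^sub>R x + b)) \<in> test_functions"
proof -
  obtain R where R: "\<And>x. norm x > R \<Longrightarrow> \<phi> x = 0" using test_support[OF assms(1)] by metis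
  have "\<phi> (c *\<^sub>R x + b) = 0" if "norm x > (R + norm b) / \<bar>c\<bar>" for x
  proof (rule R)
    have "R + norm b < \<bar>c\<bar> * norm x" using that assms(2) by (simp add: field_simps)
    moreover have "\<bar>c\<bar> * norm x \<le> norm (c *\<^sub>R x + b) + norm b"
      using norm_triangle_ineq4[of "c *\<^sub>R x + b" b] by simp
    ultimately show "norm (c *\<^sub>R x + b) > R" by linarith
  qed
  then show ?thesis using assms(1) by (auto simp: test_function_iff smooth_affine)
qed

lemma test_partial:
  assumes "\<phi> \<in> test_functions"
  shows "partial i \<phi> \<in> test_functions"
proof -
  obtain R where R: "\<And>x. norm x > R \<Longrightarrow> \<phi> x = 0" using test_support[OF assms] by metis
  have "partial i \<phi> x = 0" if "norm x > R" for x
  proof -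
    have "((\<lambda>x. 0) has_derivative (\<lambda>h. 0)) (at x)" by simp
    then have "(\<phi> has_derivative (\<lambda>h. 0)) (at x)"
    proof (rule has_derivative_transform_within_open[of _ _ _ _ "{x. norm x > R}"])
      show "open {x::real^'a. norm x > R}" by (intro open_Collect_less continuous_intros)
    qed (use that R in auto)
    from partial_eqI[OF this] show ?thesis .
  qed
  then show ?thesis using assms by (auto simp: test_function_iff smooth_partial)
qed

lemma test_partials: "\<phi> \<in> test_functions \<Longrightarrow> partials is \<phi> \<in> test_functions"
  by (induction "is") (simp_all add: partials_Cons test_partial)

lemma partials_affine:
  assumes "smooth \<phi>"
  shows "partials is (\<lambda>x. \<phi> (c *\<^sub>R x + b)) = (\<lambda>x. c ^ length is * partials is \<phi> (c *\<^sub>R x + b))"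
proof (induction "is")
  case (Cons i "is")
  have s: "smooth (partials is \<phi>)" using assms by (rule smooth_partials)
  have "partial i (\<lambda>x. c ^ length is * partials is \<phi> (c *\<^sub>R x + b))
      = (\<lambda>x. c ^ length is * (c * partial i (partials is \<phi>) (c *\<^sub>R x + b)))"
    using smooth_differentiable[OF s] smooth_differentiable[OF smooth_affine[OF s]]
    by (subst partial_mult) (auto simp: partial_affine)
  then show ?case by (simp add: partials_Cons Cons.IH mult_ac)
qed simp

lemma test_continuous: "\<phi> \<in> test_functions \<Longrightarrow> continuous_on S \<phi>"
  by (simp add: test_smooth smooth_continuous)

lemma test_measurable [measurable_dest]: "\<phi> \<in> test_functions \<Longrightarrow> \<phi> \<in> borel_measurable borel"
  by (intro borel_measurable_continuous_onI test_continuous)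

lemma test_measurable_lebesgue: "\<phi> \<in> test_functions \<Longrightarrow> \<phi> \<in> borel_measurable lebesgue"
  using test_measurable[of \<phi>] measurable_completion[of \<phi> lborel borel] by simp

lemma test_bounded:
  assumes "\<phi> \<in> test_functions"
  obtains B where "B > 0" "\<And>x. \<bar>\<phi> x\<bar> \<le> B"
proof -
  obtain R where R: "\<And>x. norm x > R \<Longrightarrow> \<phi> x = 0" using test_support[OF assms] by metis
  have "bounded (\<phi> ` cball 0 R)"
    by (intro compact_imp_bounded compact_continuous_image test_continuous assms) simp
  then obtain B where "B > 0" "\<And>x. x \<in> cball 0 R \<Longrightarrow> \<bar>\<phi> x\<bar> \<le> B" unfolding bounded_pos by auto
  then show ?thesis using that[of B] R by (metis abs_zero less_imp_le mem_cball_0 not_le)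
qed

lemma test_lipschitz:
  assumes "\<phi> \<in> test_functions"
  obtains L where "L > 0" "\<And>x y. \<bar>\<phi> x - \<phi> y\<bar> \<le> L * norm (x - y)"
proof -
  have "\<forall>i. \<exists>B>0. \<forall>x. \<bar>partial i \<phi> x\<bar> \<le> B"
    using test_bounded[OF test_partial[OF assms]] by metis
  then obtain B where B: "\<And>i. B i > 0" "\<And>i x. \<bar>partial i \<phi> x\<bar> \<le> B i" by metis
  define L where "L = (\<Sum>i\<in>UNIV. B i)"
  have "L > 0" unfolding L_def by (intro sum_pos B) auto
  moreover have "\<bar>\<phi> x - \<phi> y\<bar> \<le> L * norm (x - y)" for x y
  proof -
    have "norm (\<phi> x - \<phi> y) \<le> L * norm (x - y)"
    proof (rule differentiable_bound[of UNIV])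
      fix z :: "real^'a"
      show "(\<phi> has_derivative (\<lambda>h. \<Sum>i\<in>UNIV. h $ i * partial i \<phi> z)) (at z within UNIV)"
        using differentiable_has_derivative_partial[OF smooth_differentiable[OF test_smooth[OF assms]]] by simp
      show "onorm (\<lambda>h. \<Sum>i\<in>UNIV. h $ i * partial i \<phi> z) \<le> L"
      proof (rule onorm_le)
        fix h :: "real^'a"
        have "norm (\<Sum>i\<in>UNIV. h $ i * partial i \<phi> z) \<le> (\<Sum>i\<in>UNIV. norm h * B i)"
          unfolding real_norm_def
          by (rule order_trans[OF sum_abs sum_mono])
            (auto simp: abs_mult intro!: mult_mono B component_le_norm_cart)
        also have "\<dots> = L * norm h" by (simp add: L_def sum_distrib_left mult.commute)
        finally show "norm (\<Sum>i\<in>UNIV. h $ i * partial i \<phi> z) \<le> L * norm h" .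
      qed
    qed auto
    then show ?thesis by simp
  qed
  ultimately show ?thesis using that by blast
qed

text \<open>
  The parameter \<open>k\<close> serves to let the bump grow to the indicator of the open box: \<open>exp (- 1 / (k t))\<close>
  tends to 1 for every \<open>t > 0\<close> and never exceeds 1.
\<close>

definition bump :: "real \<Rightarrow> real^'n \<Rightarrow> real^'n \<Rightarrow> real^'n::finite \<Rightarrow> real" where
  "bump k a b x = (\<Prod>i\<in>UNIV. flat_exp 1 (k * (x $ i - a $ i)) * flat_exp 1 (k * (b $ i - x $ i)))"

lemma flat_exp_1_bounds: "0 \<le> flat_exp 1 t" "flat_exp 1 t \<le> 1"
  by (auto simp: flat_exp_def)

lemma bump_bounds: "0 \<le> bump k a b x" "bump k a b x \<le> 1"
  unfolding bump_def by (auto intro!: prod_nonneg prod_le_1 mult_le_one mult_nonneg_nonneg flat_exp_1_bounds)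

lemma bump_eq_0:
  assumes "k > 0" "x \<notin> box a b"
  shows "bump k a b x = 0"
proof -
  obtain i where "x $ i \<le> a $ i \<or> b $ i \<le> x $ i"
    using assms(2) by (auto simp: mem_box_cart not_less)
  then have "flat_exp 1 (k * (x $ i - a $ i)) * flat_exp 1 (k * (b $ i - x $ i)) = 0"
    using assms(1) by (auto simp: flat_exp_def zero_less_mult_iff)
  then show ?thesis unfolding bump_def by (auto intro!: prod_zero)
qed

lemma bump_test:
  assumes "k > 0"
  shows "bump k a b \<in> test_functions"
proof -
  have "smooth (\<lambda>x. flat_exp 1 (k * (x $ i - a $ i)) * flat_exp 1 (k * (b $ i - x $ i)))" for i
    using smooth_mult[OF smooth_flat_exp[of 1 k i "- k * a $ i"] smooth_flat_exp[of 1 "- k" i "k * b $ i"]]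
    by (simp add: algebra_simps)
  then have "smooth (bump k a b)"
    unfolding bump_def[abs_def] by (intro smooth_prod) auto
  moreover obtain R where "\<And>x. x \<in> box a b \<Longrightarrow> norm x \<le> R"
    using bounded_box[of a b] unfolding bounded_iff by blast
  then have "\<forall>x. norm x > R \<longrightarrow> bump k a b x = 0"
    using bump_eq_0[OF assms] by (meson not_le)
  ultimately show ?thesis by (auto simp: test_function_iff)
qed

lemma bump_tendsto_indicator:
  "(\<lambda>n. bump (real (Suc n)) a b x) \<longlonglongrightarrow> indicator (box a b) x"
proof (cases "x \<in> box a b")
  case True
  have *: "(\<lambda>n. flat_exp 1 (real (Suc n) * t)) \<longlonglongrightarrow> 1" if "t > 0" for t
  proof -
    have "(\<lambda>n. exp (- (inverse (real (Suc n)) * (1 / t)))) \<longlonglongrightarrow> exp (- (0 * (1 / t)))"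
      by (intro tendsto_intros LIMSEQ_inverse_real_of_nat)
    moreover have "flat_exp 1 (real (Suc n) * t) = exp (- (inverse (real (Suc n)) * (1 / t)))" for n
    proof -
      have "real (Suc n) * t > 0" using that by (intro mult_pos_pos) auto
      then show ?thesis by (simp add: flat_exp_def inverse_eq_divide del: of_nat_Suc)
    qed
    ultimately show ?thesis by simp
  qed
  have "(\<lambda>n. bump (real (Suc n)) a b x) \<longlonglongrightarrow> (\<Prod>i\<in>(UNIV :: 'a set). 1 * 1)"
    unfolding bump_def by (intro tendsto_prod tendsto_mult *) (use True in \<open>auto simp: mem_box_cart\<close>)
  then show ?thesis using True by simp
next
  case False
  then show ?thesis by (simp add: bump_eq_0 del: of_nat_Suc)
qed

lemma ex_cutoff:
  obtains \<theta> :: "real^'n::finite \<Rightarrow> real"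
  where "\<theta> \<in> test_functions" "\<theta> 0 = 1" "\<And>x. 0 \<le> \<theta> x"
proof -
  define \<beta> :: "real^'n \<Rightarrow> real" where "\<beta> = bump 1 (\<chi> i. -1) (\<chi> i. 1)"
  have b0: "\<beta> 0 > 0" by (auto simp: \<beta>_def bump_def flat_exp_def intro!: prod_pos)
  have "(\<lambda>x. (1 / \<beta> 0) * \<beta> x) \<in> test_functions"
    unfolding \<beta>_def by (intro test_cmult bump_test) simp
  moreover have "0 \<le> (1 / \<beta> 0) * \<beta> x" for x
    using b0 bump_bounds(1)[of 1 _ _ x] by (simp add: \<beta>_def)
  ultimately show ?thesis using that[of "\<lambda>x. (1 / \<beta> 0) * \<beta> x"] b0 by simp
qed

lemma compact_support_integrable:
  fixes \<phi> :: "'a::euclidean_space \<Rightarrow> real"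
  assumes "continuous_on UNIV \<phi>" "\<And>x. norm x > R \<Longrightarrow> \<phi> x = 0"
  shows "integrable lborel \<phi>"
proof -
  have "integrable lborel (\<lambda>x. indicator (cball 0 R) x *\<^sub>R \<phi> x)"
    by (intro borel_integrable_compact continuous_on_subset[OF assms(1)]) auto
  also have "(\<lambda>x. indicator (cball 0 R) x *\<^sub>R \<phi> x) = \<phi>"
    using assms(2) by (auto simp: indicator_def fun_eq_iff not_le)
  finally show ?thesis .
qed

lemma test_integrable_lborel: "\<phi> \<in> test_functions \<Longrightarrow> integrable lborel \<phi>"
  by (metis test_support test_continuous compact_support_integrable)

lemma test_integrable: "\<phi> \<in> test_functions \<Longrightarrow> integrable lebesgue \<phi>"
  using test_integrable_lborel by (simp add: integrable_completion test_measurable)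

lemma test_L2: "\<phi> \<in> test_functions \<Longrightarrow> \<phi> \<in> L2"
  using test_integrable[OF test_mult[of \<phi> \<phi>]]
  by (simp add: L2_def test_measurable_lebesgue test_smooth power2_eq_square)

section \<open>Weak derivatives\<close>

lemma locally_integrable_measurable:
  fixes u :: "'a::euclidean_space \<Rightarrow> 'b::{banach, second_countable_topology}"
  assumes "locally_integrable u"
  shows "u \<in> borel_measurable lebesgue"
proof (rule borel_measurable_LIMSEQ_metric)
  fix n :: nat
  have "set_integrable lebesgue (cball 0 (real n)) u"
    using assms by (simp add: locally_integrable_def)
  then show "(\<lambda>x. indicator (cball 0 (real n)) x *\<^sub>R u x) \<in> borel_measurable lebesgue"
    unfolding set_integrable_def by (rule borel_measurable_integrable)
next
  fix x :: 'a
  obtain N :: nat where N: "norm x \<le> real N" using real_arch_simple by blast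
  have "\<forall>\<^sub>F n in sequentially. indicator (cball 0 (real n)) x *\<^sub>R u x = u x"
    using N by (auto simp: eventually_sequentially intro!: exI[of _ N])
  then show "(\<lambda>n. indicator (cball 0 (real n)) x *\<^sub>R u x) \<longlonglongrightarrow> u x"
    by (rule tendsto_eventually)
qed

lemma L2_locally_integrable:
  fixes u :: "'a::euclidean_space \<Rightarrow> 'b::euclidean_space"
  assumes "u \<in> L2"
  shows "locally_integrable u"
  unfolding locally_integrable_def set_integrable_def
proof (intro allI impI)
  fix K :: "'a set" assume K: "compact K"
  note [measurable] = L2_measurable[OF assms]
  have [measurable]: "K \<in> sets lebesgue" using K by (simp add: compact_imp_closed lmeasurable_compact fmeasurableD)
  show "integrable lebesgue (\<lambda>x. indicator K x *\<^sub>R u x)"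
  proof (rule Bochner_Integration.integrable_bound)
    have "integrable lebesgue (indicator K :: 'a \<Rightarrow> real)"
      using lmeasurable_compact[OF K] by (simp add: fmeasurable_def)
    then show "integrable lebesgue (\<lambda>x. indicator K x + (norm (u x))\<^sup>2)"
      using L2_integrable_square[OF assms] by (rule Bochner_Integration.integrable_add)
    show "(\<lambda>x. indicator K x *\<^sub>R u x) \<in> borel_measurable lebesgue" by measurable
    have "norm (u x) \<le> 1 + (norm (u x))\<^sup>2" for x
      using sum_squares_bound[of "norm (u x)" 1] zero_le_power2[of "norm (u x)"] norm_ge_zero[of "u x"] by (simp only: power_one mult_1_right)
    then show "AE x in lebesgue. norm (indicator K x *\<^sub>R u x) \<le> norm (indicator K x + (norm (u x))\<^sup>2)"
      by (auto simp: indicator_def)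
  qed
qed

lemma test_scaleR_integrable:
  fixes u :: "real^'n::finite \<Rightarrow> 'b::{banach, second_countable_topology}"
  assumes "\<phi> \<in> test_functions" "locally_integrable u"
  shows "integrable lebesgue (\<lambda>x. \<phi> x *\<^sub>R u x)"
proof -
  note [measurable] = test_measurable_lebesgue[OF assms(1)] locally_integrable_measurable[OF assms(2)]
  obtain R where R: "\<And>x. norm x > R \<Longrightarrow> \<phi> x = 0" using test_support[OF assms(1)] by metis
  obtain B where B: "B > 0" "\<And>x. \<bar>\<phi> x\<bar> \<le> B" using test_bounded[OF assms(1)] by metis
  have "integrable lebesgue (\<lambda>x. indicator (cball 0 R) x *\<^sub>R u x)"
    using assms(2) by (simp add: locally_integrable_def set_integrable_def)
  then have "integrable lebesgue (\<lambda>x. B *\<^sub>R (indicator (cball 0 R) x *\<^sub>R u x))"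
    by (rule integrable_scaleR_right)
  then show ?thesis
  proof (rule Bochner_Integration.integrable_bound)
    have "norm (\<phi> x *\<^sub>R u x) \<le> norm (B *\<^sub>R (indicator (cball 0 R) x *\<^sub>R u x))" for x
      using R[of x] B by (cases "norm x > R") (auto simp: indicator_def mult_right_mono)
    then show "AE x in lebesgue. norm (\<phi> x *\<^sub>R u x) \<le> norm (B *\<^sub>R (indicator (cball 0 R) x *\<^sub>R u x))" by simp
  qed measurable
qed

text \<open>
  The positive and the negative part of \<open>w\<close> are densities of two measures that agree on boxes,
  an intersection-stable generator of the Borel sets.
\<close>

lemma AE_zero_if_box_integrals_zero:
  fixes w :: "real^'n::finite \<Rightarrow> real"
  assumes int: "integrable lborel w" and box: "\<And>a b. (\<integral>x. indicator (box a b) x * w x \<partial>lborel) = 0"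
  shows "AE x in lborel. w x = 0"
proof -
  have [measurable]: "w \<in> borel_measurable borel" using borel_measurable_integrable[OF int] by simp
  define M where "M = density lborel (\<lambda>x. ennreal (w x))"
  define N where "N = density lborel (\<lambda>x. ennreal (- w x))"
  have emeasure_box: "emeasure (density lborel (\<lambda>x. ennreal (v x))) (box a b)
      = ennreal (\<integral>x. indicator (box a b) x * max 0 (v x) \<partial>lborel)"
    if v: "integrable lborel v" for v :: "real^'n \<Rightarrow> real" and a b
  proof -
    have [measurable]: "v \<in> borel_measurable borel" using borel_measurable_integrable[OF v] by simp
    have int: "integrable lborel (\<lambda>x. indicator (box a b) x * max 0 (v x))"
      by (rule Bochner_Integration.integrable_bound[OF v]) (auto simp: indicator_def)
    have "emeasure (density lborel (\<lambda>x. ennreal (v x))) (box a b)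
      = (\<integral>\<^sup>+x. ennreal (indicator (box a b) x * max 0 (v x)) \<partial>lborel)"
      by (subst emeasure_density) (auto intro!: nn_integral_cong simp: indicator_def max_def ennreal_neg)
    also have "\<dots> = ennreal (\<integral>x. indicator (box a b) x * max 0 (v x) \<partial>lborel)"
      by (rule nn_integral_eq_integral[OF int]) (simp add: indicator_def)
    finally show ?thesis .
  qed
  have eq: "emeasure M (box a b) = emeasure N (box a b)" for a b
  proof -
    have int': "integrable lborel (\<lambda>x. indicator (box a b) x * max 0 (w x))"
      "integrable lborel (\<lambda>x. indicator (box a b) x * max 0 (- w x))"
      by (rule Bochner_Integration.integrable_bound[OF int], auto simp: indicator_def)+
    have "(\<integral>x. indicator (box a b) x * max 0 (w x) \<partial>lborel) - (\<integral>x. indicator (box a b) x * max 0 (- w x) \<partial>lborel)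
      = (\<integral>x. indicator (box a b) x * max 0 (w x) - indicator (box a b) x * max 0 (- w x) \<partial>lborel)"
      using int' by (rule Bochner_Integration.integral_diff[symmetric])
    also have "\<dots> = (\<integral>x. indicator (box a b) x * w x \<partial>lborel)"
      by (intro Bochner_Integration.integral_cong) (auto simp: max_def)
    finally show ?thesis unfolding M_def N_def
      using int by (simp add: emeasure_box box)
  qed
  have "M = N"
  proof (rule measure_eqI_generator_eq)
    let ?E = "range (\<lambda>(a, b). box a b :: (real^'n) set)"
    show "Int_stable ?E" by (auto simp: Int_stable_def box_Int_box)
    show "?E \<subseteq> Pow UNIV" "sets M = sigma_sets UNIV ?E" "sets N = sigma_sets UNIV ?E"
      by (simp_all add: borel_eq_box M_def N_def)
    let ?A = "\<lambda>n::nat. box (- (real n *\<^sub>R One)) (real n *\<^sub>R One) :: (real^'n) set"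
    show "range ?A \<subseteq> ?E" "(\<Union>i. ?A i) = UNIV" unfolding UN_box_eq_UNIV by auto
    show "emeasure M (?A i) \<noteq> \<infinity>" for i unfolding M_def by (simp add: emeasure_box int)
    show "emeasure M X = emeasure N X" if "X \<in> ?E" for X using that eq by auto
  qed
  then have "AE x in lborel. ennreal (w x) = ennreal (- w x)"
    unfolding M_def N_def by (intro sigma_finite_measure.density_unique[OF sigma_finite_lborel]) auto
  then show ?thesis
  proof eventually_elim
    case (elim x)
    then show ?case by (cases "w x \<ge> 0") (auto simp: ennreal_neg ennreal_eq_0_iff)
  qed
qed

text \<open>
  By dominated convergence along the bumps, \<open>v\<close> has integral zero over every box.
\<close>

theorem fundamental_lemma:
  fixes v :: "real^'n::finite \<Rightarrow> real"
  assumes v: "locally_integrable v"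
    and zero: "\<And>\<phi>. \<phi> \<in> test_functions \<Longrightarrow> (\<integral>x. \<phi> x * v x \<partial>lebesgue) = 0"
  shows "AE x in lebesgue. v x = 0"
proof -
  note [measurable] = locally_integrable_measurable[OF v]
  have box0: "(\<integral>x. indicator (box a b) x * v x \<partial>lebesgue) = 0" for a b
  proof -
    have "(\<lambda>n. \<integral>x. bump (real (Suc n)) a b x * v x \<partial>lebesgue) \<longlonglongrightarrow> (\<integral>x. indicator (box a b) x * v x \<partial>lebesgue)"
    proof (rule integral_dominated_convergence)
      show "integrable lebesgue (\<lambda>x. indicator (cbox a b) x * \<bar>v x\<bar>)"
        using integrable_norm[of lebesgue "\<lambda>x. indicator (cbox a b) x *\<^sub>R v x"] v
        by (simp add: locally_integrable_def set_integrable_def abs_mult)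
      show "(\<lambda>x. indicator (box a b) x * v x) \<in> borel_measurable lebesgue"
        by (rule borel_measurable_times[OF borel_measurable_indicator locally_integrable_measurable[OF v]]) simp
      show "(\<lambda>x. bump (real (Suc n)) a b x * v x) \<in> borel_measurable lebesgue" for n
        by (rule borel_measurable_times[OF test_measurable_lebesgue[OF bump_test] locally_integrable_measurable[OF v]]) simp
      show "AE x in lebesgue. (\<lambda>n. bump (real (Suc n)) a b x * v x) \<longlonglongrightarrow> indicator (box a b) x * v x"
        by (intro AE_I2 tendsto_mult bump_tendsto_indicator tendsto_const)
      have "\<bar>bump (real (Suc n)) a b x * v x\<bar> \<le> indicator (cbox a b) x * \<bar>v x\<bar>" for n x
      proof (cases "x \<in> box a b")
        case True
        then have "x \<in> cbox a b" using box_subset_cbox by blast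
        then show ?thesis using bump_bounds[of "real (Suc n)" a b x] by (simp add: abs_mult mult_left_le_one_le)
      next
        case False
        then show ?thesis by (simp add: bump_eq_0 indicator_def del: of_nat_Suc)
      qed
      then show "AE x in lebesgue. norm (bump (real (Suc n)) a b x * v x) \<le> indicator (cbox a b) x * \<bar>v x\<bar>" for n
        by simp
    qed
    moreover have "(\<integral>x. bump (real (Suc n)) a b x * v x \<partial>lebesgue) = 0" for n
      by (rule zero) (simp add: bump_test)
    ultimately show ?thesis by (simp add: LIMSEQ_const_iff)
  qed
  let ?A = "\<lambda>n::nat. box (- (real n *\<^sub>R One)) (real n *\<^sub>R One) :: (real^'n) set"
  have "AE x in lebesgue. \<forall>n. indicator (?A n) x * v x = 0"
    unfolding AE_all_countable
  proof
    fix n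
    have int: "integrable lebesgue (\<lambda>x. indicator (?A n) x * v x)"
    proof (rule Bochner_Integration.integrable_bound)
      show "integrable lebesgue (\<lambda>x. indicator (cbox (- (real n *\<^sub>R One)) (real n *\<^sub>R One)) x *\<^sub>R v x)"
        using v by (simp add: locally_integrable_def set_integrable_def)
      show "AE x in lebesgue. norm (indicator (?A n) x * v x)
          \<le> norm (indicator (cbox (- (real n *\<^sub>R One)) (real n *\<^sub>R One)) x *\<^sub>R v x)"
        using box_subset_cbox by (intro AE_I2) (auto simp: indicator_def)
    qed (rule borel_measurable_times[OF borel_measurable_indicator locally_integrable_measurable[OF v]], simp)
    obtain w where [measurable]: "w \<in> borel_measurable lborel" and w: "AE x in lborel. indicator (?A n) x * v x = w x"
      using completion_ex_borel_measurable_real[OF borel_measurable_integrable[OF int]] by auto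
    have wL: "AE x in lebesgue. indicator (?A n) x * v x = w x" using w by (rule AE_completion)
    have wm: "w \<in> borel_measurable lebesgue" by (intro measurable_completion) measurable
    have "integrable lebesgue w"
      using int wm wL by (subst integrable_cong_AE[symmetric]) auto
    then have "integrable lborel w" by (simp add: integrable_completion)
    moreover have "(\<integral>x. indicator (box a b) x * w x \<partial>lborel) = 0" for a b
    proof -
      have "(\<integral>x. indicator (box a b) x * w x \<partial>lborel) = (\<integral>x. indicator (box a b) x * w x \<partial>lebesgue)"
        by (rule integral_completion[symmetric]) measurable
      also have "\<dots> = (\<integral>x. indicator (box a b) x * (indicator (?A n) x * v x) \<partial>lebesgue)"
      proof (rule integral_cong_AE)
        show "(\<lambda>x. indicator (box a b) x * w x) \<in> borel_measurable lebesgue"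
          by (intro borel_measurable_times borel_measurable_indicator wm) simp
        show "AE x in lebesgue. indicator (box a b) x * w x = indicator (box a b) x * (indicator (?A n) x * v x)"
          using wL by eventually_elim simp
        show "(\<lambda>x. indicator (box a b) x * (indicator (?A n) x * v x)) \<in> borel_measurable lebesgue"
          by (intro borel_measurable_times borel_measurable_indicator locally_integrable_measurable[OF v]) simp_all
      qed
      also have "\<dots> = (\<integral>x. indicator (box a b \<inter> ?A n) x * v x \<partial>lebesgue)"
        by (simp add: indicator_inter_arith mult.assoc)
      also have "\<dots> = 0" unfolding Int_interval box_Int_box by (rule box0)
      finally show ?thesis .
    qed
    ultimately have "AE x in lborel. w x = 0" by (rule AE_zero_if_box_integrals_zero)
    then have "AE x in lebesgue. w x = 0" by (rule AE_completion)
    with wL show "AE x in lebesgue. indicator (?A n) x * v x = 0" by eventually_elim simp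
  qed
  then show ?thesis
  proof eventually_elim
    case (elim x)
    obtain n where "x \<in> ?A n" using UN_box_eq_UNIV by blast
    then show ?case using elim[rule_format, of n] by simp
  qed
qed

lemma locally_integrable_bounded_linear:
  fixes T :: "'b::{banach, second_countable_topology} \<Rightarrow> 'c::{banach, second_countable_topology}"
  assumes "bounded_linear T" "locally_integrable u"
  shows "locally_integrable (\<lambda>x. T (u x))"
proof -
  interpret T: bounded_linear T by fact
  have "integrable lebesgue (\<lambda>x. T (indicator K x *\<^sub>R u x))" if K: "compact K" for K
    by (rule integrable_bounded_linear[OF assms(1) assms(2)[unfolded locally_integrable_def set_integrable_def, rule_format, OF K]])
  then show ?thesis by (simp add: locally_integrable_def set_integrable_def T.scaleR)
qed

lemma has_weak_deriv_locally_integrable: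
  assumes "has_weak_deriv is u v"
  shows "locally_integrable u" "locally_integrable v"
  using conjunct1[OF assms[unfolded has_weak_deriv_def]]
    conjunct1[OF conjunct2[OF assms[unfolded has_weak_deriv_def]]] .

lemma has_weak_deriv_test:
  assumes "has_weak_deriv is u v" "\<phi> \<in> test_functions"
  shows "(\<integral>x. partials is \<phi> x *\<^sub>R u x \<partial>lebesgue) = (-1) ^ length is *\<^sub>R (\<integral>x. \<phi> x *\<^sub>R v x \<partial>lebesgue)"
  by (rule bspec[OF conjunct2[OF conjunct2[OF assms(1)[unfolded has_weak_deriv_def]]] assms(2)])

lemma has_weak_deriv_bounded_linear:
  fixes T :: "'b::{banach, second_countable_topology} \<Rightarrow> 'c::{banach, second_countable_topology}"
    and u v :: "real^'n::finite \<Rightarrow> 'b"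
  assumes T: "bounded_linear T" and uv: "has_weak_deriv is u v"
  shows "has_weak_deriv is (\<lambda>x. T (u x)) (\<lambda>x. T (v x))"
proof -
  interpret T: bounded_linear T by fact
  note u = has_weak_deriv_locally_integrable(1)[OF uv] and v = has_weak_deriv_locally_integrable(2)[OF uv]
  have pull: "(\<integral>x. \<phi> x *\<^sub>R T (w x) \<partial>lebesgue) = T (\<integral>x. \<phi> x *\<^sub>R w x \<partial>lebesgue)"
    if "\<phi> \<in> test_functions" "locally_integrable w" for \<phi> and w :: "real^'n \<Rightarrow> 'b"
    using integral_bounded_linear[OF T test_scaleR_integrable[OF that]] by (simp add: T.scaleR)
  show ?thesis unfolding has_weak_deriv_def
  proof (intro conjI ballI)
    show "locally_integrable (\<lambda>x. T (u x))" "locally_integrable (\<lambda>x. T (v x))"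
      by (rule locally_integrable_bounded_linear[OF T u], rule locally_integrable_bounded_linear[OF T v])
    fix \<phi> :: "real^'n \<Rightarrow> real" assume \<phi>: "\<phi> \<in> test_functions"
    show "(\<integral>x. partials is \<phi> x *\<^sub>R T (u x) \<partial>lebesgue) = (-1) ^ length is *\<^sub>R (\<integral>x. \<phi> x *\<^sub>R T (v x) \<partial>lebesgue)"
    proof -
      have "(\<integral>x. partials is \<phi> x *\<^sub>R T (u x) \<partial>lebesgue) = T (\<integral>x. partials is \<phi> x *\<^sub>R u x \<partial>lebesgue)"
        by (rule pull[OF test_partials[OF \<phi>] u])
      also have "\<dots> = T ((-1) ^ length is *\<^sub>R (\<integral>x. \<phi> x *\<^sub>R v x \<partial>lebesgue))"
        by (rule arg_cong[OF has_weak_deriv_test[OF uv \<phi>]])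
      also have "\<dots> = (-1) ^ length is *\<^sub>R T (\<integral>x. \<phi> x *\<^sub>R v x \<partial>lebesgue)"
        by (rule T.scaleR)
      also have "\<dots> = (-1) ^ length is *\<^sub>R (\<integral>x. \<phi> x *\<^sub>R T (v x) \<partial>lebesgue)"
        by (rule arg_cong[OF pull[OF \<phi> v, symmetric]])
      finally show ?thesis .
    qed
  qed
qed

text \<open>
  Uniqueness matters here because \<^const>\<open>weak_deriv\<close> picks an arbitrary representative: it transports
  membership in \<open>L2\<close> and commutation with linear maps such as \<open>Re\<close> to that choice.
\<close>

lemma has_weak_deriv_unique:
  fixes u v v' :: "real^'n::finite \<Rightarrow> 'b::euclidean_space"
  assumes "has_weak_deriv is u v" "has_weak_deriv is u v'"
  shows "AE x in lebesgue. v x = v' x"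
proof -
  note v = has_weak_deriv_locally_integrable(2)[OF assms(1)] and v' = has_weak_deriv_locally_integrable(2)[OF assms(2)]
  have "AE x in lebesgue. (v x - v' x) \<bullet> b = 0" for b
  proof (rule fundamental_lemma)
    have diff: "locally_integrable (\<lambda>x. v x - v' x)"
      unfolding locally_integrable_def
    proof (intro allI impI)
      fix K :: "(real^'n) set" assume K: "compact K"
      show "set_integrable lebesgue K (\<lambda>x. v x - v' x)"
        using v[unfolded locally_integrable_def, rule_format, OF K] v'[unfolded locally_integrable_def, rule_format, OF K]
        by (rule set_integral_diff(1))
    qed
    show "locally_integrable (\<lambda>x. (v x - v' x) \<bullet> b)"
      by (rule locally_integrable_bounded_linear[OF bounded_linear_inner_left diff])
    fix \<phi> :: "real^'n \<Rightarrow> real" assume \<phi>: "\<phi> \<in> test_functions"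
    have "(\<integral>x. \<phi> x * ((v x - v' x) \<bullet> b) \<partial>lebesgue) = (\<integral>x. (\<phi> x *\<^sub>R (v x - v' x)) \<bullet> b \<partial>lebesgue)"
      by simp
    also have "\<dots> = (\<integral>x. \<phi> x *\<^sub>R (v x - v' x) \<partial>lebesgue) \<bullet> b"
      by (rule integral_inner_left) (rule test_scaleR_integrable[OF \<phi> diff])
    also have "(\<integral>x. \<phi> x *\<^sub>R (v x - v' x) \<partial>lebesgue) = (\<integral>x. \<phi> x *\<^sub>R v x \<partial>lebesgue) - (\<integral>x. \<phi> x *\<^sub>R v' x \<partial>lebesgue)"
      unfolding scaleR_diff_right
      by (intro Bochner_Integration.integral_diff test_scaleR_integrable \<phi> v v')
    also have "(\<integral>x. \<phi> x *\<^sub>R v x \<partial>lebesgue) = (\<integral>x. \<phi> x *\<^sub>R v' x \<partial>lebesgue)"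
    proof -
      have "(-1) ^ length is *\<^sub>R (\<integral>x. \<phi> x *\<^sub>R v x \<partial>lebesgue) = (-1) ^ length is *\<^sub>R (\<integral>x. \<phi> x *\<^sub>R v' x \<partial>lebesgue)"
        unfolding has_weak_deriv_test[OF assms(1) \<phi>, symmetric] has_weak_deriv_test[OF assms(2) \<phi>, symmetric] ..
      then show ?thesis by simp
    qed
    finally show "(\<integral>x. \<phi> x * ((v x - v' x) \<bullet> b) \<partial>lebesgue) = 0" by simp
  qed
  then have "AE x in lebesgue. \<forall>b\<in>Basis. (v x - v' x) \<bullet> b = 0"
    by (intro AE_finite_allI) auto
  then show ?thesis by eventually_elim (simp add: euclidean_all_zero_iff)
qed

lemma has_weak_deriv_weak_deriv: "has_weak_deriv is u v \<Longrightarrow> has_weak_deriv is u (weak_deriv is u)"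
  unfolding weak_deriv_def by (rule someI[of "has_weak_deriv is u" v])

lemma weak_deriv_AE_eq:
  fixes u v :: "real^'n::finite \<Rightarrow> 'b::euclidean_space"
  assumes "has_weak_deriv is u v"
  shows "AE x in lebesgue. weak_deriv is u x = v x"
  by (rule has_weak_deriv_unique[OF has_weak_deriv_weak_deriv[OF assms] assms])

lemma sobolev_L2: "u \<in> sobolev_H k \<Longrightarrow> u \<in> L2"
  unfolding sobolev_H_def by blast

lemma sobolev_weak_deriv:
  fixes u :: "real^'n::finite \<Rightarrow> 'b::euclidean_space"
  assumes "u \<in> sobolev_H k" "length is \<le> k"
  shows "has_weak_deriv is u (weak_deriv is u)" "weak_deriv is u \<in> L2"
proof -
  obtain v where v: "v \<in> L2" "has_weak_deriv is u v" using assms unfolding sobolev_H_def by blast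
  show h: "has_weak_deriv is u (weak_deriv is u)" by (rule has_weak_deriv_weak_deriv[OF v(2)])
  show "weak_deriv is u \<in> L2"
  proof (rule L2_cong_AE[OF v(1)])
    show "weak_deriv is u \<in> borel_measurable lebesgue"
      by (rule locally_integrable_measurable[OF has_weak_deriv_locally_integrable(2)[OF h]])
    show "AE x in lebesgue. v x = weak_deriv is u x"
      using weak_deriv_AE_eq[OF v(2)] by eventually_elim simp
  qed
qed

lemma L2_sum:
  fixes f :: "'i \<Rightarrow> 'a::euclidean_space \<Rightarrow> 'b::euclidean_space"
  assumes "finite I" "\<And>i. i \<in> I \<Longrightarrow> f i \<in> L2"
  shows "(\<lambda>x. \<Sum>i\<in>I. f i x) \<in> L2"
  using assms by (induction I rule: finite_induct) (auto intro: L2_add)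

lemma laplacian_L2:
  fixes u :: "real^'n::finite \<Rightarrow> 'b::euclidean_space"
  assumes "u \<in> sobolev_H 2"
  shows "laplacian u \<in> L2"
  unfolding laplacian_def by (intro L2_sum sobolev_weak_deriv[OF assms]) auto

lemma L2_bounded_linear:
  fixes u :: "'a::euclidean_space \<Rightarrow> 'b::euclidean_space" and T :: "'b \<Rightarrow> 'c::euclidean_space"
  assumes T: "bounded_linear T" and u: "u \<in> L2"
  shows "(\<lambda>x. T (u x)) \<in> L2"
proof -
  obtain K where K: "\<And>x. norm (T x) \<le> norm x * K" using bounded_linear.bounded[OF T] by blast
  show ?thesis
  proof (rule L2_dominated[OF u])
    have "T \<in> borel_measurable borel"
      by (intro borel_measurable_continuous_onI linear_continuous_on T)
    then show "(\<lambda>x. T (u x)) \<in> borel_measurable lebesgue"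
      using L2_measurable[OF u] by (rule measurable_compose[rotated])
    show "AE x in lebesgue. norm (T (u x)) \<le> K * norm (u x)" using K by (simp add: mult.commute)
  qed
qed

lemma sobolev_bounded_linear:
  fixes u :: "real^'n::finite \<Rightarrow> 'b::euclidean_space" and T :: "'b \<Rightarrow> 'c::euclidean_space"
  assumes T: "bounded_linear T" and u: "u \<in> sobolev_H k"
  shows "(\<lambda>x. T (u x)) \<in> sobolev_H k"
  unfolding sobolev_H_def
proof (intro CollectI conjI allI impI)
  show "(\<lambda>x. T (u x)) \<in> L2" by (rule L2_bounded_linear[OF T sobolev_L2[OF u]])
  fix "is" :: "'n list" assume len: "length is \<le> k"
  show "\<exists>v\<in>L2. has_weak_deriv is (\<lambda>x. T (u x)) v"
    by (intro bexI[of _ "\<lambda>x. T (weak_deriv is u x)"] has_weak_deriv_bounded_linear[OF T]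
        L2_bounded_linear[OF T] sobolev_weak_deriv[OF u len])
qed

lemma laplacian_bounded_linear:
  fixes u :: "real^'n::finite \<Rightarrow> 'b::euclidean_space" and T :: "'b \<Rightarrow> 'c::euclidean_space"
  assumes T: "bounded_linear T" and u: "u \<in> sobolev_H 2"
  shows "AE x in lebesgue. laplacian (\<lambda>x. T (u x)) x = T (laplacian u x)"
proof -
  interpret T: bounded_linear T by fact
  have "AE x in lebesgue. \<forall>i\<in>UNIV. weak_deriv [i, i] (\<lambda>x. T (u x)) x = T (weak_deriv [i, i] u x)"
    by (intro AE_finite_allI weak_deriv_AE_eq has_weak_deriv_bounded_linear[OF T] sobolev_weak_deriv(1)[OF u]) auto
  then show ?thesis by eventually_elim (simp add: laplacian_def T.sum)
qed

lemma laplacian_AE_zero: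
  fixes u :: "real^'n::finite \<Rightarrow> 'b::euclidean_space"
  assumes u: "u \<in> sobolev_H 2" and "AE x in lebesgue. u x = 0"
  shows "AE x in lebesgue. laplacian u x = 0"
proof -
  have loc: "locally_integrable u" using L2_locally_integrable[OF sobolev_L2[OF u]] .
  have "has_weak_deriv is u (\<lambda>x. 0)" for "is"
  proof -
    have "(\<integral>x. partials is \<phi> x *\<^sub>R u x \<partial>lebesgue) = 0" for \<phi>
      by (rule integral_eq_zero_AE) (use assms(2) in eventually_elim, simp)
    moreover have "locally_integrable (\<lambda>x::real^'n. 0 :: 'b)"
      by (simp add: locally_integrable_def set_integrable_def)
    ultimately show ?thesis unfolding has_weak_deriv_def using loc by (intro conjI ballI) simp_all
  qed
  then have "AE x in lebesgue. \<forall>i\<in>UNIV. weak_deriv [i, i] u x = 0"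
    by (intro AE_finite_allI weak_deriv_AE_eq) auto
  then show ?thesis by eventually_elim (simp add: laplacian_def)
qed

definition test_laplacian :: "(real^'n::finite \<Rightarrow> real) \<Rightarrow> real^'n \<Rightarrow> real" where
  "test_laplacian \<phi> x = (\<Sum>i\<in>UNIV. partials [i, i] \<phi> x)"

lemma test_sum:
  assumes "finite I" "\<And>i. i \<in> I \<Longrightarrow> f i \<in> test_functions"
  shows "(\<lambda>x. \<Sum>i\<in>I. f i x) \<in> test_functions"
  using assms
proof (induction I rule: finite_induct)
  case empty
  show ?case by (simp add: test_function_iff smooth_const)
qed (auto intro: test_add)

lemma test_laplacian_test: "\<phi> \<in> test_functions \<Longrightarrow> test_laplacian \<phi> \<in> test_functions"
  unfolding test_laplacian_def[abs_def] by (intro test_sum test_partials) auto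

text \<open>
  The adjoint of the Laplacian on test functions. For \<open>u \<in> H\<^sup>2\<close> all that the estimates below use is
  that \<open>u\<close> and \<open>\<Delta>u\<close> are related in this way.
\<close>

definition weak_laplacian :: "(real^'n::finite \<Rightarrow> real) \<Rightarrow> (real^'n \<Rightarrow> real) \<Rightarrow> bool" where
  "weak_laplacian u w \<longleftrightarrow> u \<in> L2 \<and> w \<in> L2 \<and>
     (\<forall>\<phi>\<in>test_functions. (\<integral>x. test_laplacian \<phi> x * u x \<partial>lebesgue) = (\<integral>x. \<phi> x * w x \<partial>lebesgue))"

lemma weak_laplacian_laplacian:
  fixes u :: "real^'n::finite \<Rightarrow> real"
  assumes u: "u \<in> sobolev_H 2"
  shows "weak_laplacian u (laplacian u)"
  unfolding weak_laplacian_def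
proof (intro conjI ballI)
  show "u \<in> L2" "laplacian u \<in> L2" using u by (simp_all add: sobolev_L2 laplacian_L2)
  fix \<phi> :: "real^'n \<Rightarrow> real" assume \<phi>: "\<phi> \<in> test_functions"
  have h: "has_weak_deriv [i, i] u (weak_deriv [i, i] u)" for i
    by (rule sobolev_weak_deriv[OF u]) simp
  note loc = has_weak_deriv_locally_integrable[OF h]
  have "(\<integral>x. test_laplacian \<phi> x * u x \<partial>lebesgue) = (\<Sum>i\<in>UNIV. \<integral>x. partials [i, i] \<phi> x * u x \<partial>lebesgue)"
    unfolding test_laplacian_def sum_distrib_right
    using test_scaleR_integrable[OF test_partials[OF \<phi>] loc(1)] by (intro Bochner_Integration.integral_sum) simp
  also have "\<dots> = (\<Sum>i\<in>UNIV. \<integral>x. \<phi> x * weak_deriv [i, i] u x \<partial>lebesgue)"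
  proof (rule sum.cong[OF refl])
    fix i
    show "(\<integral>x. partials [i, i] \<phi> x * u x \<partial>lebesgue) = (\<integral>x. \<phi> x * weak_deriv [i, i] u x \<partial>lebesgue)"
      using has_weak_deriv_test[OF h \<phi>, of i] by simp
  qed
  also have "\<dots> = (\<integral>x. \<phi> x * laplacian u x \<partial>lebesgue)"
    unfolding laplacian_def sum_distrib_left
    using test_scaleR_integrable[OF \<phi> loc(2)] by (intro Bochner_Integration.integral_sum[symmetric]) simp
  finally show "(\<integral>x. test_laplacian \<phi> x * u x \<partial>lebesgue) = (\<integral>x. \<phi> x * laplacian u x \<partial>lebesgue)" .
qed

section \<open>Density of test functions and mollification\<close>

lemma parallelogram_law:
  fixes a b :: "'a::real_inner"
  shows "(norm (a - b))\<^sup>2 + (norm (a + b))\<^sup>2 = 2 * (norm a)\<^sup>2 + 2 * (norm b)\<^sup>2"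
  by (simp add: power2_norm_eq_inner inner_diff_left inner_diff_right inner_add_left inner_add_right)

text \<open>
  The projection theorem in the form needed for density: a minimising sequence of the distance to \<open>M\<close>
  is Cauchy by the parallelogram law, and the error of its limit is orthogonal to \<open>M\<close>.
\<close>

lemma subspace_dense_if_orthogonal_trivial:
  fixes M :: "'a::{real_inner, complete_space} set"
  assumes M: "subspace M" and triv: "\<And>y. (\<And>x. x \<in> M \<Longrightarrow> x \<bullet> y = 0) \<Longrightarrow> y = 0"
  shows "closure M = UNIV"
proof -
  have "p \<in> closure M" for p
  proof -
    define d where "d = infdist p M"
    have ne: "M \<noteq> {}" using M by (auto simp: subspace_def)
    have d0: "d \<ge> 0" unfolding d_def by (rule infdist_nonneg)
    have dle: "d \<le> norm (p - z)" if "z \<in> M" for z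
      unfolding d_def dist_norm[symmetric] by (rule infdist_le[OF that])
    have "\<exists>z\<in>M. norm (p - z) < d + 1 / real (Suc n)" for n
    proof (rule ccontr)
      assume "\<not> ?thesis"
      then have "d + 1 / real (Suc n) \<le> infdist p M"
        unfolding infdist_notempty[OF ne] by (intro cINF_greatest ne) (auto simp: dist_norm not_less)
      then show False unfolding d_def[symmetric] by simp
    qed
    then obtain z where z: "\<And>n. z n \<in> M" "\<And>n. norm (p - z n) < d + 1 / real (Suc n)" by metis
    have parallelogram: "(norm (z n - z m))\<^sup>2 \<le> 2 * (norm (p - z n))\<^sup>2 + 2 * (norm (p - z m))\<^sup>2 - 4 * d\<^sup>2" for n m
    proof -
      have "(1/2) *\<^sub>R (z n + z m) \<in> M" using M z(1) by (simp add: subspace_add subspace_scale)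
      from dle[OF this] have "d\<^sup>2 \<le> (norm (p - (1/2) *\<^sub>R (z n + z m)))\<^sup>2" using d0 by (intro power_mono)
      moreover have "4 * (norm (p - (1/2) *\<^sub>R (z n + z m)))\<^sup>2 = (norm ((p - z n) + (p - z m)))\<^sup>2"
      proof -
        have "p - (1/2) *\<^sub>R (z n + z m) = (1/2) *\<^sub>R ((p - z n) + (p - z m))"
          by (simp add: scaleR_add_right scaleR_diff_right flip: scaleR_2)
        then show ?thesis by (simp add: power_divide)
      qed
      moreover have "(norm (z n - z m))\<^sup>2 = (norm ((p - z n) - (p - z m)))\<^sup>2"
        by (simp add: norm_minus_commute)
      moreover have "(norm ((p - z n) - (p - z m)))\<^sup>2 + (norm ((p - z n) + (p - z m)))\<^sup>2 = 2 * (norm (p - z n))\<^sup>2 + 2 * (norm (p - z m))\<^sup>2"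
        by (rule parallelogram_law)
      ultimately show ?thesis by linarith
    qed
    have lim: "(\<lambda>n. norm (p - z n)) \<longlonglongrightarrow> d"
    proof (rule real_tendsto_sandwich)
      show "\<forall>\<^sub>F n in sequentially. d \<le> norm (p - z n)" using dle z(1) by simp
      show "\<forall>\<^sub>F n in sequentially. norm (p - z n) \<le> d + 1 / real (Suc n)"
        using z(2) by (intro always_eventually allI less_imp_le)
      show "(\<lambda>n. d + 1 / real (Suc n)) \<longlonglongrightarrow> d"
        using tendsto_add[OF tendsto_const LIMSEQ_inverse_real_of_nat, of d] by (simp add: inverse_eq_divide)
    qed simp
    have "Cauchy z"
    proof (rule metric_CauchyI)
      fix e :: real assume "e > 0"
      have "(\<lambda>n. (norm (p - z n))\<^sup>2) \<longlonglongrightarrow> d\<^sup>2" by (intro tendsto_power lim)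
      moreover have "d\<^sup>2 < d\<^sup>2 + e\<^sup>2 / 4" using \<open>e > 0\<close> by simp
      ultimately have "\<forall>\<^sub>F n in sequentially. (norm (p - z n))\<^sup>2 < d\<^sup>2 + e\<^sup>2 / 4" by (rule order_tendstoD(2))
      then obtain N where N: "\<And>n. n \<ge> N \<Longrightarrow> (norm (p - z n))\<^sup>2 < d\<^sup>2 + e\<^sup>2 / 4"
        by (auto simp: eventually_sequentially)
      have "dist (z m) (z n) < e" if "m \<ge> N" "n \<ge> N" for m n
      proof -
        have "(norm (z m - z n))\<^sup>2 < e\<^sup>2"
          using parallelogram[of m n] N[OF that(1)] N[OF that(2)] by simp
        then show ?thesis using power2_less_imp_less[of "norm (z m - z n)" e] \<open>e > 0\<close> by (simp add: dist_norm)
      qed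
      then show "\<exists>N. \<forall>m\<ge>N. \<forall>n\<ge>N. dist (z m) (z n) < e" by blast
    qed
    then obtain q where q: "z \<longlonglongrightarrow> q" using Cauchy_convergent convergent_def by blast
    have "(\<lambda>n. norm (p - z n)) \<longlonglongrightarrow> norm (p - q)" by (intro tendsto_intros q)
    then have dq: "norm (p - q) = d" using lim by (rule LIMSEQ_unique)
    have near: "d \<le> norm (p - q - x)" if "x \<in> M" for x
    proof (rule LIMSEQ_le_const)
      show "(\<lambda>n. norm (p - z n - x)) \<longlonglongrightarrow> norm (p - q - x)" by (intro tendsto_intros q)
      show "\<exists>N. \<forall>n\<ge>N. d \<le> norm (p - z n - x)"
        using dle[OF subspace_add[OF M z(1) that]] by (simp add: algebra_simps)
    qed
    have "x \<bullet> (p - q) = 0" if x: "x \<in> M" for x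
    proof (cases "x = 0")
      case False
      define t where "t = x \<bullet> (p - q) / (norm x)\<^sup>2"
      have "d\<^sup>2 \<le> (norm (p - q - t *\<^sub>R x))\<^sup>2"
        using near[OF subspace_scale[OF M x, of t]] d0 by (intro power_mono) auto
      also have "\<dots> = (norm (p - q))\<^sup>2 - 2 * t * (x \<bullet> (p - q)) + t\<^sup>2 * (norm x)\<^sup>2"
        unfolding power2_norm_eq_inner inner_diff_left[of "p - q"] inner_diff_right[of _ "p - q"]
        by (simp add: inner_commute[of "p - q" x] power2_eq_square)
      also have "\<dots> = d\<^sup>2 - (x \<bullet> (p - q))\<^sup>2 / (norm x)\<^sup>2"
        using False by (simp add: dq t_def power2_eq_square)
      finally have "(x \<bullet> (p - q))\<^sup>2 / (norm x)\<^sup>2 \<le> 0" by simp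
      then show ?thesis using False by (simp add: divide_le_0_iff)
    qed simp
    from triv[OF this] have "p = q" by simp
    then show ?thesis using q z(1) closure_sequential by blast
  qed
  then show ?thesis by blast
qed

text \<open>
  A function orthogonal to all test functions vanishes by the fundamental lemma.
\<close>

theorem test_functions_dense:
  fixes u :: "real^'n::finite \<Rightarrow> real"
  assumes u: "u \<in> L2" and "e > 0"
  shows "\<exists>\<phi>\<in>test_functions. norm (l2_of \<phi> - l2_of u) < e"
proof -
  let ?M = "l2_of ` (test_functions :: (real^'n \<Rightarrow> real) set)"
  have zero: "(\<lambda>x::real^'n. 0) \<in> test_functions" using test_sum[of "{}"] by simp
  have "closure ?M = UNIV"
  proof (rule subspace_dense_if_orthogonal_trivial)
    show "subspace ?M"
    proof (rule subspaceI)
      have "(0 :: (real^'n, real) l2) = l2_of (\<lambda>x. 0)" by transfer simp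
      then show "0 \<in> ?M" using zero by blast
      show "x + y \<in> ?M" if "x \<in> ?M" "y \<in> ?M" for x y
        using that test_add by (auto simp: l2_of_add test_L2 intro!: imageI)
      show "c *\<^sub>R x \<in> ?M" if "x \<in> ?M" for c x
        using that test_cmult by (auto simp: l2_of_scaleR test_L2 intro!: imageI)
    qed
    fix y :: "(real^'n, real) l2" assume orth: "\<And>x. x \<in> ?M \<Longrightarrow> x \<bullet> y = 0"
    obtain v where v: "v \<in> L2" "y = l2_of v" by (rule l2_of_cases)
    have "AE x in lebesgue. v x = 0"
    proof (rule fundamental_lemma[OF L2_locally_integrable[OF v(1)]])
      fix \<phi> :: "real^'n \<Rightarrow> real" assume \<phi>: "\<phi> \<in> test_functions"
      from orth[OF imageI[OF \<phi>]] show "(\<integral>x. \<phi> x * v x \<partial>lebesgue) = 0"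
        by (simp add: v inner_l2_of test_L2[OF \<phi>] L2_inner_def)
    qed
    then have "l2_of v = l2_of (\<lambda>x. 0)" using v(1) by (simp add: l2_of_eq_iff)
    also have "\<dots> = 0" by transfer simp
    finally show "y = 0" using v by simp
  qed
  then have "l2_of u \<in> closure ?M" by simp
  then show ?thesis using \<open>e > 0\<close> unfolding closure_approachable dist_norm by blast
qed

definition conv :: "(real^'n::finite \<Rightarrow> real) \<Rightarrow> (real^'n \<Rightarrow> real) \<Rightarrow> real^'n \<Rightarrow> real" where
  "conv k u x = (\<integral>y. k (x - y) * u y \<partial>lebesgue)"

lemma test_reflect: "k \<in> test_functions \<Longrightarrow> (\<lambda>y. k (x - y)) \<in> test_functions"
  using test_affine[of k "-1" x] by simp

lemma conv_integrable:
  assumes "k \<in> test_functions" "locally_integrable u"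
  shows "integrable lebesgue (\<lambda>y. k (x - y) * u y)"
  using test_scaleR_integrable[OF test_reflect[OF assms(1)] assms(2)] by simp

text \<open>
  Dominated convergence along an arbitrary sequence \<open>X n \<longlonglongrightarrow> x\<close>: the difference quotients of the
  kernel are bounded by a Lipschitz constant and supported in one fixed ball.
\<close>

lemma conv_has_derivative:
  fixes k u :: "real^'n::finite \<Rightarrow> real"
  assumes k: "k \<in> test_functions" and u: "locally_integrable u"
  shows "(conv k u has_derivative (\<lambda>h. \<Sum>i\<in>UNIV. h $ i * conv (partial i k) u x)) (at x)"
proof -
  obtain L where L: "L > 0" "\<And>x y. \<bar>k x - k y\<bar> \<le> L * norm (x - y)" using test_lipschitz[OF k] by metis
  have "\<forall>i. \<exists>B>0. \<forall>x. \<bar>partial i k x\<bar> \<le> B"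
    using test_bounded[OF test_partial[OF k]] by metis
  then obtain B where B: "\<And>i. B i > 0" "\<And>i x. \<bar>partial i k x\<bar> \<le> B i" by metis
  define K where "K = L + (\<Sum>i\<in>UNIV. B i)"
  have "\<exists>R. \<forall>z. norm z > R \<longrightarrow> k z = 0 \<and> (\<forall>i. partial i k z = 0)"
  proof -
    obtain R where R: "\<And>z. norm z > R \<Longrightarrow> k z = 0" using test_support[OF k] by metis
    have "\<forall>i. \<exists>S. \<forall>z. norm z > S \<longrightarrow> partial i k z = 0" using test_support[OF test_partial[OF k]] by metis
    then obtain S where S: "\<And>i z. norm z > S i \<Longrightarrow> partial i k z = 0" by metis
    have "k z = 0 \<and> (\<forall>i. partial i k z = 0)" if "norm z > max R (Max (range S))" for z
    proof -
      have "S i \<le> Max (range S)" for i by (rule Max_ge) auto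
      then have "norm z > S i" for i using that by (metis less_le_trans max_less_iff_conj not_less)
      then show ?thesis using that R S by simp
    qed
    then show ?thesis by blast
  qed
  then obtain R where R: "\<And>z. norm z > R \<Longrightarrow> k z = 0" "\<And>z i. norm z > R \<Longrightarrow> partial i k z = 0" by metis
  show ?thesis unfolding has_derivative_at_within
  proof
    show "bounded_linear (\<lambda>h. \<Sum>i\<in>UNIV. h $ i * conv (partial i k) u x)"
      by (intro bounded_linear_sum bounded_linear_mult_left[THEN bounded_linear_compose] bounded_linear_vec_nth)
    show "((\<lambda>y. (conv k u y - conv k u x - (\<Sum>i\<in>UNIV. (y - x) $ i * conv (partial i k) u x)) /\<^sub>R norm (y - x)) \<longlongrightarrow> 0) (at x)"
      unfolding tendsto_at_iff_sequentially
    proof (intro allI impI)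
      fix X assume "\<forall>n. X n \<in> UNIV - {x}" and lim: "X \<longlonglongrightarrow> x"
      then have ne: "X n \<noteq> x" for n by auto
      have "bounded (range X)" using lim by (intro convergent_imp_bounded)
      then obtain S where S: "\<And>n. norm (X n) \<le> S" unfolding bounded_iff by auto
      have S0: "S \<ge> 0" by (rule order_trans[OF norm_ge_zero S])
      define F where "F n y = (k (X n - y) - k (x - y) - (\<Sum>i\<in>UNIV. (X n - x) $ i * partial i k (x - y))) / norm (X n - x) * u y" for n y
      have F_int: "integrable lebesgue (F n)" and F_eq: "(\<integral>y. F n y \<partial>lebesgue) = (conv k u (X n) - conv k u x - (\<Sum>i\<in>UNIV. (X n - x) $ i * conv (partial i k) u x)) / norm (X n - x)" for n
      proof -
        note i1 = conv_integrable[OF k u, of "X n"] and i2 = conv_integrable[OF k u, of x]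
        note i3 = conv_integrable[OF test_partial[OF k] u, of _ x]
        have i4: "integrable lebesgue (\<lambda>y. (X n - x) $ i * (partial i k (x - y) * u y))" for i
          by (rule integrable_mult_right[OF i3])
        have i5: "integrable lebesgue (\<lambda>y. \<Sum>i\<in>UNIV. (X n - x) $ i * (partial i k (x - y) * u y))"
          by (rule Bochner_Integration.integrable_sum[OF i4])
        note i6 = Bochner_Integration.integrable_diff[OF Bochner_Integration.integrable_diff[OF i1 i2] i5]
        have F: "F n y = (k (X n - y) * u y - k (x - y) * u y - (\<Sum>i\<in>UNIV. (X n - x) $ i * (partial i k (x - y) * u y))) / norm (X n - x)" for y
          unfolding F_def by (simp add: left_diff_distrib sum_distrib_right mult.assoc)
        show "integrable lebesgue (F n)" unfolding F[abs_def] by (rule integrable_divide_zero) (rule i6)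
        have "(\<integral>y. F n y \<partial>lebesgue) = (\<integral>y. k (X n - y) * u y - k (x - y) * u y - (\<Sum>i\<in>UNIV. (X n - x) $ i * (partial i k (x - y) * u y)) \<partial>lebesgue) / norm (X n - x)"
          unfolding F by (rule integral_divide_zero)
        also have "(\<integral>y. k (X n - y) * u y - k (x - y) * u y - (\<Sum>i\<in>UNIV. (X n - x) $ i * (partial i k (x - y) * u y)) \<partial>lebesgue)
          = conv k u (X n) - conv k u x - (\<Sum>i\<in>UNIV. (X n - x) $ i * conv (partial i k) u x)"
          unfolding conv_def Bochner_Integration.integral_diff[OF Bochner_Integration.integrable_diff[OF i1 i2] i5]
            Bochner_Integration.integral_diff[OF i1 i2] Bochner_Integration.integral_sum[OF i4] integral_mult_right_zero ..
        finally show "(\<integral>y. F n y \<partial>lebesgue) = (conv k u (X n) - conv k u x - (\<Sum>i\<in>UNIV. (X n - x) $ i * conv (partial i k) u x)) / norm (X n - x)" .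
      qed
      have "(\<lambda>n. \<integral>y. F n y \<partial>lebesgue) \<longlonglongrightarrow> (\<integral>y. 0 \<partial>(lebesgue :: (real^'n) measure))"
      proof (rule integral_dominated_convergence)
        let ?C = "cball 0 (R + S + norm x) :: (real^'n) set"
        have "integrable lebesgue (\<lambda>y. indicator ?C y *\<^sub>R u y)"
          using u[unfolded locally_integrable_def set_integrable_def, rule_format, OF compact_cball] .
        from integrable_mult_right[OF integrable_norm[OF this], of K]
        show "integrable lebesgue (\<lambda>y. K * norm (indicator ?C y *\<^sub>R u y))" .
        show "F n \<in> borel_measurable lebesgue" for n using F_int by (rule borel_measurable_integrable)
        show "AE y in lebesgue. (\<lambda>n. F n y) \<longlonglongrightarrow> 0"
        proof (rule AE_I2)
          fix y
          have "((\<lambda>z. (k z - k (x - y) - (\<Sum>i\<in>UNIV. (z - (x - y)) $ i * partial i k (x - y))) /\<^sub>R norm (z - (x - y))) \<longlongrightarrow> 0) (at (x - y))"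
            using differentiable_has_derivative_partial[OF smooth_differentiable[OF test_smooth[OF k]], of "x - y"]
            unfolding has_derivative_at_within by (rule conjunct2)
          from this[unfolded tendsto_at_iff_sequentially, rule_format, of "\<lambda>n. X n - y"]
          have "(\<lambda>n. (k (X n - y) - k (x - y) - (\<Sum>i\<in>UNIV. (X n - x) $ i * partial i k (x - y))) /\<^sub>R norm (X n - x)) \<longlonglongrightarrow> 0"
            using ne lim by (simp add: o_def tendsto_diff)
          from tendsto_mult_left_zero[OF this, of "u y"] show "(\<lambda>n. F n y) \<longlonglongrightarrow> 0"
            unfolding F_def by (simp add: divide_inverse mult.commute[of "inverse _"])
        qed
        fix n
        have "\<bar>F n y\<bar> \<le> K * norm (indicator ?C y *\<^sub>R u y)" for y
        proof (cases "y \<in> ?C")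
          case True
          have "\<bar>\<Sum>i\<in>UNIV. (X n - x) $ i * partial i k (x - y)\<bar> \<le> (\<Sum>i\<in>UNIV. norm (X n - x) * B i)"
            by (rule order_trans[OF sum_abs sum_mono])
              (auto simp only: abs_mult intro!: mult_mono B(2) component_le_norm_cart abs_ge_zero norm_ge_zero)
          also have "\<dots> = (\<Sum>i\<in>UNIV. B i) * norm (X n - x)" by (simp add: sum_distrib_right mult.commute)
          finally have "\<bar>k (X n - y) - k (x - y) - (\<Sum>i\<in>UNIV. (X n - x) $ i * partial i k (x - y))\<bar> \<le> K * norm (X n - x)"
            using L(2)[of "X n - y" "x - y"] unfolding K_def by (simp add: distrib_right)
          then have "\<bar>(k (X n - y) - k (x - y) - (\<Sum>i\<in>UNIV. (X n - x) $ i * partial i k (x - y))) / norm (X n - x)\<bar> \<le> K"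
            using ne[of n] by (simp add: abs_divide divide_le_eq)
          then have "\<bar>F n y\<bar> \<le> K * \<bar>u y\<bar>"
            unfolding F_def abs_mult[of _ "u y"] by (rule mult_right_mono) simp
          then show ?thesis using True by simp
        next
          case False
          then have y: "norm y > R + S + norm x" by simp
          have "norm (X n - y) > R" using norm_triangle_ineq2[of y "X n"] S[of n] y
            by (simp add: norm_minus_commute) (use norm_ge_zero[of x] in linarith)
          moreover have "norm (x - y) > R" using norm_triangle_ineq2[of y x] S0 y
            by (simp add: norm_minus_commute)
          ultimately have "F n y = 0" unfolding F_def by (simp add: R)
          then show ?thesis using L(1) B(1) by (simp add: K_def sum_nonneg less_imp_le)
        qed
        then show "AE y in lebesgue. norm (F n y) \<le> K * norm (indicator ?C y *\<^sub>R u y)" by simp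
      qed simp
      then show "((\<lambda>y. (conv k u y - conv k u x - (\<Sum>i\<in>UNIV. (y - x) $ i * conv (partial i k) u x)) /\<^sub>R norm (y - x)) \<circ> X) \<longlonglongrightarrow> 0"
        unfolding F_eq by (simp add: o_def divide_inverse mult.commute)
    qed
  qed
qed

lemma partial_conv:
  fixes k u :: "real^'n::finite \<Rightarrow> real"
  assumes "k \<in> test_functions" "locally_integrable u"
  shows "partial i (conv k u) = conv (partial i k) u"
proof
  fix x
  have "partial i (conv k u) x = (\<Sum>j\<in>UNIV. axis i 1 $ j * conv (partial j k) u x)"
    by (rule partial_eqI[OF conv_has_derivative[OF assms]])
  also have "\<dots> = (\<Sum>j\<in>UNIV. if j = i then conv (partial j k) u x else 0)"
    by (intro sum.cong) (auto simp: axis_def)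
  finally show "partial i (conv k u) x = conv (partial i k) u x" by simp
qed

lemma partials_conv:
  fixes k u :: "real^'n::finite \<Rightarrow> real"
  assumes "k \<in> test_functions" "locally_integrable u"
  shows "partials is (conv k u) = conv (partials is k) u"
  by (induction "is") (simp_all add: partials_Cons partial_conv test_partials assms)

lemma smooth_conv:
  fixes k u :: "real^'n::finite \<Rightarrow> real"
  assumes "k \<in> test_functions" "locally_integrable u"
  shows "smooth (conv k u)"
  unfolding smooth_iff partials_conv[OF assms] differentiable_def
  using conv_has_derivative[OF test_partials[OF assms(1)] assms(2)] by blast

text \<open>
  \<open>y \<mapsto> k (x - y)\<close> is a test function, and reflection does not change second derivatives, so the
  defining identity of \<open>\<Delta>u = w\<close> applies to it.
\<close>

lemma conv_weak_laplacian:
  fixes k u :: "real^'n::finite \<Rightarrow> real"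
  assumes k: "k \<in> test_functions" and W: "weak_laplacian u w"
  shows "(\<Sum>i\<in>UNIV. partials [i, i] (conv k u) x) = conv k w x"
proof -
  have u: "locally_integrable u" using W by (simp add: weak_laplacian_def L2_locally_integrable)
  have refl: "partials [i, i] (\<lambda>y. k (x - y)) y = partials [i, i] k (x - y)" for i y
    using partials_affine[OF test_smooth[OF k], of "[i, i]" "-1" x] by (simp add: fun_eq_iff)
  have "(\<Sum>i\<in>UNIV. partials [i, i] (conv k u) x) = (\<Sum>i\<in>UNIV. \<integral>y. partials [i, i] k (x - y) * u y \<partial>lebesgue)"
    unfolding partials_conv[OF k u] conv_def ..
  also have "\<dots> = (\<integral>y. (\<Sum>i\<in>UNIV. partials [i, i] k (x - y) * u y) \<partial>lebesgue)"
    by (rule Bochner_Integration.integral_sum[symmetric]) (rule conv_integrable[OF test_partials[OF k] u])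
  also have "\<dots> = (\<integral>y. test_laplacian (\<lambda>y. k (x - y)) y * u y \<partial>lebesgue)"
    unfolding test_laplacian_def refl sum_distrib_right ..
  also have "\<dots> = conv k w x"
    using W test_reflect[OF k] unfolding weak_laplacian_def conv_def by blast
  finally show ?thesis .
qed

lemma nn_integral_lborel_reflect:
  fixes f :: "'a::euclidean_space \<Rightarrow> ennreal"
  assumes [measurable]: "f \<in> borel_measurable borel"
  shows "(\<integral>\<^sup>+y. f (x - y) \<partial>lborel) = (\<integral>\<^sup>+y. f y \<partial>lborel)"
proof -
  have "(\<integral>\<^sup>+y. f y \<partial>lborel) = (\<integral>\<^sup>+y. f y \<partial>density (distr lborel borel (\<lambda>y. x + (-1) *\<^sub>R y)) (\<lambda>_. \<bar>-1::real\<bar>^DIM('a)))"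
    by (subst lborel_affine[of "-1" x]) auto
  also have "\<dots> = (\<integral>\<^sup>+y. f (x - y) \<partial>lborel)"
    by (subst nn_integral_density) (auto simp: nn_integral_distr)
  finally show ?thesis by simp
qed

lemma nn_integral_lborel_translate:
  fixes f :: "'a::euclidean_space \<Rightarrow> ennreal"
  assumes [measurable]: "f \<in> borel_measurable borel"
  shows "(\<integral>\<^sup>+x. f (x - y) \<partial>lborel) = (\<integral>\<^sup>+x. f x \<partial>lborel)"
  by (subst lborel_distr_plus[of "- y", symmetric]) (simp add: nn_integral_distr)

lemma borel_measurable_lebesgueI: "f \<in> borel_measurable borel \<Longrightarrow> f \<in> borel_measurable lebesgue"
  by (rule measurable_completion) simp

lemma L2_borel_representative:
  fixes u :: "'a::euclidean_space \<Rightarrow> real"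
  assumes "u \<in> L2"
  obtains v where "v \<in> borel_measurable borel" "v \<in> L2" "AE x in lebesgue. u x = v x"
proof -
  obtain v where v: "v \<in> borel_measurable lborel" and "AE x in lborel. u x = v x"
    using completion_ex_borel_measurable_real[OF L2_measurable[OF assms]] by auto
  then have ae: "AE x in lebesgue. u x = v x" using AE_completion by blast
  then have "v \<in> L2" using L2_cong_AE[OF assms measurable_completion[OF v]] by blast
  then show ?thesis using v ae that by simp
qed

lemma conv_cong_AE:
  assumes "AE x in lebesgue. u x = v x"
    "u \<in> borel_measurable lebesgue" "v \<in> borel_measurable lebesgue" "k \<in> test_functions"
  shows "conv k u = conv k v"
proof
  fix x
  note [measurable] = assms(2,3) test_measurable_lebesgue[OF test_reflect[OF assms(4), of x]]
  show "conv k u x = conv k v x" unfolding conv_def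
  proof (rule integral_cong_AE)
    show "AE y in lebesgue. k (x - y) * u y = k (x - y) * v y" using assms(1) by eventually_elim simp
  qed measurable
qed

lemma l2_of_cong_AE: "u \<in> L2 \<Longrightarrow> v \<in> L2 \<Longrightarrow> AE x in lebesgue. u x = v x \<Longrightarrow> l2_of u = l2_of v"
  by (simp add: l2_of_eq_iff)

text \<open>
  Young's inequality with an integrable kernel: split \<open>\<bar>k\<bar>\<close> into two square roots, apply the
  Cauchy-Schwarz inequality at each point and then Tonelli's theorem.
\<close>

lemma conv_L2:
  fixes k u :: "real^'n::finite \<Rightarrow> real"
  assumes k: "k \<in> test_functions" and u: "u \<in> L2"
  shows "conv k u \<in> L2" "norm (l2_of (conv k u)) \<le> (\<integral>x. \<bar>k x\<bar> \<partial>lborel) * norm (l2_of u)"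
proof -
  obtain v where v [measurable]: "v \<in> borel_measurable borel" and vL: "v \<in> L2" and uv: "AE x in lebesgue. u x = v x"
    using L2_borel_representative[OF u] by metis
  have conv_eq: "conv k u = conv k v"
    by (rule conv_cong_AE[OF uv L2_measurable[OF u] L2_measurable[OF vL] k])
  have l2_eq: "l2_of u = l2_of v" by (rule l2_of_cong_AE[OF u vL uv])
  note [measurable] = test_measurable[OF k]
  define M where "M = (\<integral>x. \<bar>k x\<bar> \<partial>lborel)"
  have M0: "M \<ge> 0" unfolding M_def by simp
  have M: "(\<integral>\<^sup>+x. ennreal \<bar>k x\<bar> \<partial>lborel) = ennreal M"
    unfolding M_def using integrable_norm[OF test_integrable_lborel[OF k]]
    by (intro nn_integral_eq_integral) auto
  have loc: "locally_integrable v" by (rule L2_locally_integrable[OF vL])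
  have cont: "continuous_on UNIV (conv k v)" by (rule smooth_continuous[OF smooth_conv[OF k loc]])
  then have [measurable]: "conv k v \<in> borel_measurable borel" by (rule borel_measurable_continuous_onI)
  have pointwise: "ennreal ((conv k v x)\<^sup>2) \<le> ennreal M * (\<integral>\<^sup>+y. ennreal \<bar>k (x - y)\<bar> * ennreal ((v y)\<^sup>2) \<partial>lborel)" for x
  proof -
    have int: "integrable lborel (\<lambda>y. k (x - y) * v y)"
      using conv_integrable[OF k loc, of x] by (subst (asm) integrable_completion) auto
    have "conv k v x = (\<integral>y. k (x - y) * v y \<partial>lborel)"
      unfolding conv_def by (rule integral_completion) measurable
    then have "ennreal \<bar>conv k v x\<bar> \<le> (\<integral>\<^sup>+y. ennreal (norm (k (x - y) * v y)) \<partial>lborel)"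
      using integral_norm_bound_ennreal[OF int] by simp
    also have "\<dots> = (\<integral>\<^sup>+y. ennreal (sqrt \<bar>k (x - y)\<bar>) * ennreal (sqrt \<bar>k (x - y)\<bar> * \<bar>v y\<bar>) \<partial>lborel)"
      by (intro nn_integral_cong) (simp add: ennreal_mult[symmetric] abs_mult mult.assoc[symmetric] del: real_sqrt_abs)
    finally have "(ennreal \<bar>conv k v x\<bar>)\<^sup>2 \<le> (\<integral>\<^sup>+y. ennreal (sqrt \<bar>k (x - y)\<bar>) * ennreal (sqrt \<bar>k (x - y)\<bar> * \<bar>v y\<bar>) \<partial>lborel)\<^sup>2"
      by (intro power_mono) auto
    also have "\<dots> \<le> (\<integral>\<^sup>+y. (ennreal (sqrt \<bar>k (x - y)\<bar>))\<^sup>2 \<partial>lborel) * (\<integral>\<^sup>+y. (ennreal (sqrt \<bar>k (x - y)\<bar> * \<bar>v y\<bar>))\<^sup>2 \<partial>lborel)"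
      by (rule Cauchy_Schwarz_nn_integral) measurable
    also have "(\<integral>\<^sup>+y. (ennreal (sqrt \<bar>k (x - y)\<bar>))\<^sup>2 \<partial>lborel) = (\<integral>\<^sup>+y. ennreal \<bar>k (x - y)\<bar> \<partial>lborel)"
      by (simp add: ennreal_power)
    also have "\<dots> = ennreal M"
      using nn_integral_lborel_reflect[of "\<lambda>y. ennreal \<bar>k y\<bar>" x] by (simp add: M)
    also have "(\<integral>\<^sup>+y. (ennreal (sqrt \<bar>k (x - y)\<bar> * \<bar>v y\<bar>))\<^sup>2 \<partial>lborel) = (\<integral>\<^sup>+y. ennreal \<bar>k (x - y)\<bar> * ennreal ((v y)\<^sup>2) \<partial>lborel)"
      by (simp add: ennreal_power power_mult_distrib ennreal_mult)
    finally show ?thesis by (simp add: ennreal_power)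
  qed
  have "(\<integral>\<^sup>+x. ennreal ((norm (conv k v x))\<^sup>2) \<partial>lebesgue) = (\<integral>\<^sup>+x. ennreal ((conv k v x)\<^sup>2) \<partial>lborel)"
    by (simp add: nn_integral_completion)
  also have "\<dots> \<le> (\<integral>\<^sup>+x. ennreal M * (\<integral>\<^sup>+y. ennreal \<bar>k (x - y)\<bar> * ennreal ((v y)\<^sup>2) \<partial>lborel) \<partial>lborel)"
    by (rule nn_integral_mono) (rule pointwise)
  also have "\<dots> = ennreal M * (\<integral>\<^sup>+x. (\<integral>\<^sup>+y. ennreal \<bar>k (x - y)\<bar> * ennreal ((v y)\<^sup>2) \<partial>lborel) \<partial>lborel)"
    by (rule nn_integral_cmult) measurable
  also have "(\<integral>\<^sup>+x. (\<integral>\<^sup>+y. ennreal \<bar>k (x - y)\<bar> * ennreal ((v y)\<^sup>2) \<partial>lborel) \<partial>lborel)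
    = (\<integral>\<^sup>+y. (\<integral>\<^sup>+x. ennreal \<bar>k (x - y)\<bar> * ennreal ((v y)\<^sup>2) \<partial>lborel) \<partial>lborel)"
    by (rule lborel_pair.Fubini'[symmetric]) measurable
  also have "\<dots> = (\<integral>\<^sup>+y. ennreal M * ennreal ((v y)\<^sup>2) \<partial>lborel)"
  proof (rule nn_integral_cong)
    fix y
    have "(\<integral>\<^sup>+x. ennreal \<bar>k (x - y)\<bar> * ennreal ((v y)\<^sup>2) \<partial>lborel) = (\<integral>\<^sup>+x. ennreal \<bar>k (x - y)\<bar> \<partial>lborel) * ennreal ((v y)\<^sup>2)"
      by (rule nn_integral_multc) measurable
    then show "(\<integral>\<^sup>+x. ennreal \<bar>k (x - y)\<bar> * ennreal ((v y)\<^sup>2) \<partial>lborel) = ennreal M * ennreal ((v y)\<^sup>2)"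
      using nn_integral_lborel_translate[of "\<lambda>x. ennreal \<bar>k x\<bar>" y] by (simp add: M)
  qed
  also have "\<dots> = ennreal M * (\<integral>\<^sup>+y. ennreal ((v y)\<^sup>2) \<partial>lborel)"
    by (rule nn_integral_cmult) measurable
  also have "(\<integral>\<^sup>+y. ennreal ((v y)\<^sup>2) \<partial>lborel) = ennreal ((norm (l2_of v))\<^sup>2)"
    using nn_integral_L2[OF vL] by (simp add: nn_integral_completion)
  also have "ennreal M * (ennreal M * ennreal ((norm (l2_of v))\<^sup>2)) = ennreal ((M * norm (l2_of v))\<^sup>2)"
    using M0 by (simp add: ennreal_mult[symmetric] power2_eq_square mult_ac)
  finally have "(\<integral>\<^sup>+x. ennreal ((norm (conv k v x))\<^sup>2) \<partial>lebesgue) \<le> ennreal ((M * norm (l2_of v))\<^sup>2)" .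
  from L2_I_nn_integral[OF borel_measurable_lebesgueI this] M0
  show "conv k u \<in> L2" "norm (l2_of (conv k u)) \<le> (\<integral>x. \<bar>k x\<bar> \<partial>lborel) * norm (l2_of u)"
    unfolding conv_eq l2_eq M_def[symmetric] by auto
qed

lemma conv_diff:
  assumes "k \<in> test_functions" "locally_integrable u" "locally_integrable v"
  shows "conv k (\<lambda>x. u x - v x) x = conv k u x - conv k v x"
  unfolding conv_def right_diff_distrib
  by (intro Bochner_Integration.integral_diff conv_integrable assms)

lemma ex_mollifier:
  obtains k :: "nat \<Rightarrow> real^'n::finite \<Rightarrow> real" and R
  where "\<And>n. k n \<in> test_functions" "\<And>n x. 0 \<le> k n x" "\<And>n. (\<integral>x. k n x \<partial>lborel) = 1"
    "R > 0" "\<And>n x. norm x > R / real (Suc n) \<Longrightarrow> k n x = 0"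
proof -
  obtain \<theta> :: "real^'n \<Rightarrow> real" where t: "\<theta> \<in> test_functions" "\<theta> 0 = 1" "\<And>x. 0 \<le> \<theta> x" using ex_cutoff by metis
  obtain R where R: "R > 0" "\<And>x. norm x > R \<Longrightarrow> \<theta> x = 0" using test_support[OF t(1)] by metis
  define j where "j n x = \<theta> (real (Suc n) *\<^sub>R x)" for n x
  have j: "j n \<in> test_functions" for n
    using test_affine[OF t(1), of "real (Suc n)" 0] unfolding j_def[abs_def] by (simp del: of_nat_Suc)
  define I where "I n = (\<integral>x. j n x \<partial>lborel)" for n
  have I: "I n > 0" for n
  proof -
    have nonneg: "I n \<ge> 0" unfolding I_def by (simp add: j_def t)
    moreover have "I n \<noteq> 0"
    proof
      assume "I n = 0"
      then have "AE x in lborel. j n x = 0"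
        unfolding I_def
        by (rule iffD1[OF integral_nonneg_eq_0_iff_AE[OF test_integrable_lborel[OF j]], rotated]) (simp add: j_def t)
      then have "AE x in lebesgue. x \<in> {x. j n x = 0}" by (simp add: AE_completion)
      moreover have "closed {x. j n x = 0}"
        by (intro closed_Collect_eq test_continuous j continuous_on_const)
      ultimately have "0 \<in> {x. j n x = 0}" by (rule mem_closed_if_AE_lebesgue[rotated])
      then show False by (simp add: j_def t)
    qed
    ultimately show ?thesis by simp
  qed
  show ?thesis
  proof
    show "(\<lambda>x. (1 / I n) * j n x) \<in> test_functions" for n by (rule test_cmult[OF j])
    show "0 \<le> (1 / I n) * j n x" for n x using I[of n] t(3) by (simp add: j_def)
    show "(\<integral>x. (1 / I n) * j n x \<partial>lborel) = 1" for n using I[of n] unfolding I_def by simp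
    show "R > 0" by fact
    fix n and x :: "real^'n" assume "norm x > R / real (Suc n)"
    then have "norm (real (Suc n) *\<^sub>R x) > R"
      by (simp add: pos_divide_less_eq mult.commute del: of_nat_Suc)
    then show "(1 / I n) * j n x = 0" unfolding j_def by (simp add: R)
  qed
qed

lemma L2_bounded_support:
  fixes v :: "'a::euclidean_space \<Rightarrow> real"
  assumes "v \<in> borel_measurable borel" "\<And>x. \<bar>v x\<bar> \<le> C" "\<And>x. norm x > S \<Longrightarrow> v x = 0"
  shows "norm (l2_of v) \<le> C * sqrt (measure lborel (cball (0::'a) S))"
proof -
  have C: "C \<ge> 0" using assms(2)[of 0] by linarith
  note [measurable] = assms(1)
  have "(\<integral>\<^sup>+x. ennreal ((norm (v x))\<^sup>2) \<partial>lebesgue) \<le> (\<integral>\<^sup>+x. ennreal (C\<^sup>2) * indicator (cball (0::'a) S) x \<partial>lborel)"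
    unfolding nn_integral_completion
  proof (rule nn_integral_mono)
    fix x :: 'a
    show "ennreal ((norm (v x))\<^sup>2) \<le> ennreal (C\<^sup>2) * indicator (cball 0 S) x"
      using assms(2)[of x] assms(3)[of x] C
      by (cases "norm x > S") (auto simp: indicator_def intro!: ennreal_leI abs_le_square_iff[THEN iffD1])
  qed
  also have "\<dots> = ennreal (C\<^sup>2) * emeasure lborel (cball (0::'a) S)"
    by (rule nn_integral_cmult_indicator) simp
  also have "\<dots> = ennreal ((C * sqrt (measure lborel (cball (0::'a) S)))\<^sup>2)"
    using emeasure_lborel_cball_finite[of "0::'a" S]
    by (subst emeasure_eq_ennreal_measure) (auto simp: ennreal_mult power_mult_distrib)
  finally show ?thesis
    by (intro L2_I_nn_integral(2)[of v]) (auto simp: C assms(1) intro!: borel_measurable_lebesgueI mult_nonneg_nonneg)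
qed

text \<open>
  The error is at most the Lipschitz constant of \<open>g\<close> times the radius of the support of \<open>k n\<close>, and it
  vanishes outside one fixed ball.
\<close>

lemma mollify_test:
  fixes k :: "nat \<Rightarrow> real^'n::finite \<Rightarrow> real"
  assumes k: "\<And>n. k n \<in> test_functions" "\<And>n x. 0 \<le> k n x" "\<And>n. (\<integral>x. k n x \<partial>lborel) = 1"
    "R > 0" "\<And>n x. norm x > R / real (Suc n) \<Longrightarrow> k n x = 0"
    and g: "g \<in> test_functions"
  shows "(\<lambda>n. l2_of (conv (k n) g)) \<longlonglongrightarrow> l2_of g"
proof -
  obtain L where L: "L > 0" "\<And>x y. \<bar>g x - g y\<bar> \<le> L * norm (x - y)" using test_lipschitz[OF g] by metis
  obtain S where S: "S > 0" "\<And>x. norm x > S \<Longrightarrow> g x = 0" using test_support[OF g] by metis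
  have loc: "locally_integrable g" by (rule L2_locally_integrable[OF test_L2[OF g]])
  have mass: "(\<integral>y. k n (x - y) \<partial>lebesgue) = 1" for n x
  proof -
    have [measurable]: "k n \<in> borel_measurable borel" using test_measurable[OF k(1)] .
    have "ennreal (\<integral>y. k n (x - y) \<partial>lebesgue) = (\<integral>\<^sup>+y. ennreal (k n (x - y)) \<partial>lebesgue)"
      by (rule nn_integral_eq_integral[symmetric, OF test_integrable[OF test_reflect[OF k(1)]]]) (simp add: k)
    also have "\<dots> = (\<integral>\<^sup>+y. ennreal (k n y) \<partial>lborel)"
      unfolding nn_integral_completion by (rule nn_integral_lborel_reflect) measurable
    also have "\<dots> = ennreal 1"
      unfolding k(3)[of n, symmetric] by (rule nn_integral_eq_integral[OF test_integrable_lborel[OF k(1)]]) (simp add: k)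
    finally show ?thesis by (subst (asm) ennreal_inj) (auto simp: k)
  qed
  have pointwise: "\<bar>conv (k n) g x - g x\<bar> \<le> L * (R / real (Suc n))" for n x
  proof -
    note i1 = conv_integrable[OF k(1) loc, of n x] and i2 = test_integrable[OF test_reflect[OF k(1)], of n x]
    have "conv (k n) g x - g x = (\<integral>y. k n (x - y) * g y \<partial>lebesgue) - (\<integral>y. k n (x - y) * g x \<partial>lebesgue)"
      by (simp add: conv_def mass)
    also have "\<dots> = (\<integral>y. k n (x - y) * g y - k n (x - y) * g x \<partial>lebesgue)"
      by (rule Bochner_Integration.integral_diff[symmetric, OF i1 integrable_mult_left[OF i2]])
    finally have eq: "conv (k n) g x - g x = (\<integral>y. k n (x - y) * (g y - g x) \<partial>lebesgue)"
      by (simp add: right_diff_distrib)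
    have "\<bar>conv (k n) g x - g x\<bar> \<le> (\<integral>y. k n (x - y) * (L * (R / real (Suc n))) \<partial>lebesgue)"
      unfolding eq
    proof (rule order_trans[OF integral_abs_bound integral_mono_AE])
      show "integrable lebesgue (\<lambda>y. \<bar>k n (x - y) * (g y - g x)\<bar>)"
        using Bochner_Integration.integrable_diff[OF i1 integrable_mult_left[OF i2, of "g x"]]
        by (intro integrable_abs) (simp add: right_diff_distrib)
      show "integrable lebesgue (\<lambda>y. k n (x - y) * (L * (R / real (Suc n))))" by (rule integrable_mult_left[OF i2])
      have "\<bar>k n (x - y) * (g y - g x)\<bar> \<le> k n (x - y) * (L * (R / real (Suc n)))" for y
      proof (cases "norm (x - y) > R / real (Suc n)")
        case False
        have "\<bar>g y - g x\<bar> \<le> L * norm (x - y)" using L(2)[of y x] by (simp add: norm_minus_commute)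
        also have "\<dots> \<le> L * (R / real (Suc n))" using False L(1) by (intro mult_left_mono) auto
        finally show ?thesis unfolding abs_mult abs_of_nonneg[OF k(2)] by (rule mult_left_mono[OF _ k(2)])
      qed (simp add: k)
      then show "AE y in lebesgue. \<bar>k n (x - y) * (g y - g x)\<bar> \<le> k n (x - y) * (L * (R / real (Suc n)))" by simp
    qed
    also have "\<dots> = L * (R / real (Suc n))" by (simp add: mass del: of_nat_Suc)
    finally show ?thesis .
  qed
  have support: "conv (k n) g x - g x = 0" if "norm x > S + R" for n x
  proof -
    have "k n (x - y) * g y = 0" for y
    proof (cases "norm y > S")
      case False
      have "R / real (Suc n) \<le> R" using k(4) by (simp add: field_simps)
      then have "norm (x - y) > R / real (Suc n)"
        using False that norm_triangle_ineq2[of x y] by linarith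
      then show ?thesis by (simp add: k)
    qed (simp add: S)
    then have "conv (k n) g x = 0" unfolding conv_def by (simp only: integral_zero)
    moreover have "g x = 0" using that k(4) by (intro S) simp
    ultimately show ?thesis by simp
  qed
  define V where "V = sqrt (measure lborel (cball (0::real^'n) (S + R)))"
  have est: "norm (l2_of (conv (k n) g) - l2_of g) \<le> L * (R / real (Suc n)) * V" for n
  proof -
    have "(\<lambda>x. conv (k n) g x - g x) \<in> borel_measurable borel"
      by (intro borel_measurable_continuous_onI continuous_on_diff test_continuous[OF g]
          smooth_continuous[OF smooth_conv[OF k(1) loc]])
    from L2_bounded_support[OF this pointwise support]
    show ?thesis by (simp add: l2_of_diff conv_L2 k test_L2[OF g] V_def del: of_nat_Suc)
  qed
  show ?thesis
  proof (rule LIM_zero_cancel, rule Lim_null_comparison)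
    show "\<forall>\<^sub>F n in sequentially. norm (l2_of (conv (k n) g) - l2_of g) \<le> L * (R * inverse (real (Suc n))) * V"
      using est by (simp add: divide_inverse)
    have "(\<lambda>n. L * (R * inverse (real (Suc n))) * V) \<longlonglongrightarrow> L * (R * 0) * V"
      by (intro tendsto_intros LIMSEQ_inverse_real_of_nat)
    then show "(\<lambda>n. L * (R * inverse (real (Suc n))) * V) \<longlonglongrightarrow> 0" by simp
  qed
qed

text \<open>
  Convolution with \<open>k n\<close> has norm at most 1, so convergence passes from test functions, where it
  follows from the Lipschitz bound, to their closure.
\<close>

lemma mollify_L2:
  fixes k :: "nat \<Rightarrow> real^'n::finite \<Rightarrow> real"
  assumes k: "\<And>n. k n \<in> test_functions" "\<And>n x. 0 \<le> k n x" "\<And>n. (\<integral>x. k n x \<partial>lborel) = 1"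
    "R > 0" "\<And>n x. norm x > R / real (Suc n) \<Longrightarrow> k n x = 0"
    and u: "u \<in> L2"
  shows "(\<lambda>n. l2_of (conv (k n) u)) \<longlonglongrightarrow> l2_of u"
proof (rule metric_LIMSEQ_I)
  fix e :: real assume "e > 0"
  then have "e / 3 > 0" by simp
  from test_functions_dense[OF u this]
  obtain \<phi> where \<phi>: "\<phi> \<in> test_functions" and close: "norm (l2_of \<phi> - l2_of u) < e / 3" by blast
  obtain N where N: "\<And>n. n \<ge> N \<Longrightarrow> norm (l2_of (conv (k n) \<phi>) - l2_of \<phi>) < e / 3"
    using metric_LIMSEQ_D[OF mollify_test[where k = k and R = R, OF k \<phi>] \<open>e / 3 > 0\<close>] unfolding dist_norm by blast
  have "dist (l2_of (conv (k n) u)) (l2_of u) < e" if "n \<ge> N" for n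
  proof -
    have loc: "locally_integrable u" "locally_integrable \<phi>"
      by (rule L2_locally_integrable[OF u], rule L2_locally_integrable[OF test_L2[OF \<phi>]])
    have "l2_of (conv (k n) u) - l2_of (conv (k n) \<phi>) = l2_of (conv (k n) (\<lambda>x. u x - \<phi> x))"
      unfolding l2_of_diff[OF conv_L2(1)[OF k(1) u] conv_L2(1)[OF k(1) test_L2[OF \<phi>]]] conv_diff[OF k(1) loc, symmetric] ..
    then have "norm (l2_of (conv (k n) u) - l2_of (conv (k n) \<phi>)) \<le> norm (l2_of u - l2_of \<phi>)"
      using conv_L2(2)[OF k(1) L2_diff[OF u test_L2[OF \<phi>]], of n] by (simp add: k l2_of_diff u test_L2[OF \<phi>])
    also have "\<dots> < e / 3" using close by (simp add: norm_minus_commute)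
    finally have "norm (l2_of (conv (k n) u) - l2_of (conv (k n) \<phi>)) < e / 3" .
    with N[OF that] close
    have "norm ((l2_of (conv (k n) u) - l2_of (conv (k n) \<phi>)) + (l2_of (conv (k n) \<phi>) - l2_of \<phi>) + (l2_of \<phi> - l2_of u)) < e"
      by (intro norm_triangle_lt[OF _ ] order_le_less_trans[OF add_right_mono[OF norm_triangle_ineq]]) simp
    then show ?thesis by (simp add: dist_norm)
  qed
  then show "\<exists>N. \<forall>n\<ge>N. dist (l2_of (conv (k n) u)) (l2_of u) < e" by blast
qed

section \<open>Test functions are a core of the Laplacian\<close>

lemma L2_mult_bounded:
  fixes u g :: "'a::euclidean_space \<Rightarrow> real"
  assumes u: "u \<in> L2" and g: "g \<in> borel_measurable borel" "\<And>x. \<bar>g x\<bar> \<le> B"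
  shows "(\<lambda>x. g x * u x) \<in> L2" "norm (l2_of (\<lambda>x. g x * u x)) \<le> B * norm (l2_of u)"
proof -
  have B: "B \<ge> 0" using g(2)[of 0] by linarith
  have [measurable]: "g \<in> borel_measurable lebesgue" using g(1) by (intro measurable_completion) simp
  note [measurable] = L2_measurable[OF u]
  have "(\<integral>\<^sup>+x. ennreal ((norm (g x * u x))\<^sup>2) \<partial>lebesgue) \<le> (\<integral>\<^sup>+x. ennreal (B\<^sup>2) * ennreal ((norm (u x))\<^sup>2) \<partial>lebesgue)"
  proof (rule nn_integral_mono)
    fix x
    have "(norm (g x * u x))\<^sup>2 \<le> (B * norm (u x))\<^sup>2"
      by (intro power_mono) (auto simp: abs_mult intro!: mult_right_mono g)
    then show "ennreal ((norm (g x * u x))\<^sup>2) \<le> ennreal (B\<^sup>2) * ennreal ((norm (u x))\<^sup>2)"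
      by (simp add: ennreal_mult[symmetric] power_mult_distrib)
  qed
  also have "\<dots> = ennreal (B\<^sup>2) * (\<integral>\<^sup>+x. ennreal ((norm (u x))\<^sup>2) \<partial>lebesgue)"
    by (rule nn_integral_cmult) measurable
  also have "\<dots> = ennreal ((B * norm (l2_of u))\<^sup>2)"
    unfolding nn_integral_L2[OF u] by (simp add: ennreal_mult power_mult_distrib)
  finally have *: "(\<integral>\<^sup>+x. ennreal ((norm (g x * u x))\<^sup>2) \<partial>lebesgue) \<le> ennreal ((B * norm (l2_of u))\<^sup>2)" .
  show "(\<lambda>x. g x * u x) \<in> L2" by (rule L2_I_nn_integral(1)[OF _ *]) (simp_all add: B)
  show "norm (l2_of (\<lambda>x. g x * u x)) \<le> B * norm (l2_of u)" by (rule L2_I_nn_integral(2)[OF _ *]) (simp_all add: B)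
qed

lemma cutoff_tendsto:
  fixes v :: "real^'n::finite \<Rightarrow> real"
  assumes \<theta>: "\<theta> \<in> test_functions" "\<theta> 0 = 1" and v: "v \<in> L2"
  shows "(\<lambda>m. l2_of (\<lambda>x. \<theta> (inverse (real (Suc m)) *\<^sub>R x) * v x)) \<longlonglongrightarrow> l2_of v"
proof -
  obtain B where B: "B > 0" "\<And>x. \<bar>\<theta> x\<bar> \<le> B" using test_bounded[OF \<theta>(1)] by metis
  have cont: "continuous_on UNIV \<theta>" by (rule test_continuous[OF \<theta>(1)])
  have meas: "(\<lambda>x. \<theta> (inverse (real (Suc m)) *\<^sub>R x)) \<in> borel_measurable borel" for m
    using test_measurable[OF \<theta>(1)] by measurable
  have [measurable]: "(\<lambda>x. \<theta> (inverse (real (Suc m)) *\<^sub>R x)) \<in> borel_measurable lebesgue" for m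
    using meas by (intro measurable_completion) simp
  note [measurable] = L2_measurable[OF v]
  have L: "(\<lambda>x. \<theta> (inverse (real (Suc m)) *\<^sub>R x) * v x) \<in> L2" for m
    by (rule L2_mult_bounded(1)[OF v meas B(2)])
  have "(\<lambda>m. \<integral>x. (norm (\<theta> (inverse (real (Suc m)) *\<^sub>R x) * v x - v x))\<^sup>2 \<partial>lebesgue) \<longlonglongrightarrow> (\<integral>x. 0 \<partial>(lebesgue :: (real^'n) measure))"
  proof (rule integral_dominated_convergence)
    show "integrable lebesgue (\<lambda>x. (B + 1)\<^sup>2 * (norm (v x))\<^sup>2)"
      by (intro integrable_mult_right L2_integrable_square v)
    show "AE x in lebesgue. (\<lambda>m. (norm (\<theta> (inverse (real (Suc m)) *\<^sub>R x) * v x - v x))\<^sup>2) \<longlonglongrightarrow> 0"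
    proof (rule AE_I2)
      fix x :: "real^'n"
      have "(\<lambda>m. inverse (real (Suc m)) *\<^sub>R x) \<longlonglongrightarrow> 0 *\<^sub>R x"
        by (rule tendsto_scaleR[OF LIMSEQ_inverse_real_of_nat tendsto_const])
      then have "(\<lambda>m. \<theta> (inverse (real (Suc m)) *\<^sub>R x)) \<longlonglongrightarrow> \<theta> 0"
        by (intro continuous_on_tendsto_compose[OF cont]) auto
      then have "(\<lambda>m. (norm (\<theta> (inverse (real (Suc m)) *\<^sub>R x) * v x - v x))\<^sup>2) \<longlonglongrightarrow> (norm (\<theta> 0 * v x - v x))\<^sup>2"
        by (intro tendsto_intros)
      then show "(\<lambda>m. (norm (\<theta> (inverse (real (Suc m)) *\<^sub>R x) * v x - v x))\<^sup>2) \<longlonglongrightarrow> 0" by (simp add: \<theta>(2))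
    qed
    fix m
    have "norm ((norm (\<theta> (inverse (real (Suc m)) *\<^sub>R x) * v x - v x))\<^sup>2) \<le> (B + 1)\<^sup>2 * (norm (v x))\<^sup>2" for x
    proof -
      have "\<bar>\<theta> (inverse (real (Suc m)) *\<^sub>R x) - 1\<bar> \<le> B + 1"
        using B(2)[of "inverse (real (Suc m)) *\<^sub>R x"] by linarith
      then have "\<bar>\<theta> (inverse (real (Suc m)) *\<^sub>R x) - 1\<bar> * \<bar>v x\<bar> \<le> (B + 1) * \<bar>v x\<bar>" by (rule mult_right_mono) simp
      then have "\<bar>\<theta> (inverse (real (Suc m)) *\<^sub>R x) * v x - v x\<bar> \<le> (B + 1) * \<bar>v x\<bar>"
        by (simp only: abs_mult[symmetric] left_diff_distrib mult_1_left)
      then have "(norm (\<theta> (inverse (real (Suc m)) *\<^sub>R x) * v x - v x))\<^sup>2 \<le> ((B + 1) * \<bar>v x\<bar>)\<^sup>2"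
        by (intro power_mono) auto
      then show ?thesis by (simp add: power_mult_distrib)
    qed
    then show "AE x in lebesgue. norm ((norm (\<theta> (inverse (real (Suc m)) *\<^sub>R x) * v x - v x))\<^sup>2) \<le> (B + 1)\<^sup>2 * (norm (v x))\<^sup>2"
      by (rule AE_I2)
  qed measurable
  then have "(\<lambda>m. (norm (l2_of (\<lambda>x. \<theta> (inverse (real (Suc m)) *\<^sub>R x) * v x) - l2_of v))\<^sup>2) \<longlonglongrightarrow> 0"
    by (simp add: l2_of_diff L v power2_norm_l2_of L2_diff del: real_norm_def of_nat_Suc)
  then have "(\<lambda>m. sqrt ((norm (l2_of (\<lambda>x. \<theta> (inverse (real (Suc m)) *\<^sub>R x) * v x) - l2_of v))\<^sup>2)) \<longlonglongrightarrow> sqrt 0"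
    by (rule tendsto_real_sqrt)
  then have "(\<lambda>m. norm (l2_of (\<lambda>x. \<theta> (inverse (real (Suc m)) *\<^sub>R x) * v x) - l2_of v)) \<longlonglongrightarrow> 0"
    by (simp only: real_sqrt_abs abs_norm_cancel real_sqrt_zero)
  then show ?thesis by (rule LIM_zero_cancel[OF tendsto_norm_zero_cancel])
qed

lemma partials2_mult:
  assumes "smooth \<phi>" "smooth \<psi>"
  shows "partials [i, i] (\<lambda>x. \<phi> x * \<psi> x)
    = (\<lambda>x. partials [i, i] \<phi> x * \<psi> x + 2 * (partial i \<phi> x * partial i \<psi> x) + \<phi> x * partials [i, i] \<psi> x)"
proof -
  note d = smooth_differentiable[OF assms(1)] smooth_differentiable[OF assms(2)]
    smooth_differentiable[OF smooth_partial[OF assms(1)]] smooth_differentiable[OF smooth_partial[OF assms(2)]]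
  show ?thesis
    unfolding partials_Cons partials_Nil partial_mult[OF d(1,2)]
    by (subst partial_add) (auto intro!: differentiable_mult d simp: partial_mult[OF d(3,2)] partial_mult[OF d(1,4)] fun_eq_iff)
qed

text \<open>
  Mollification commutes with the Laplacian and makes \<open>u\<close> smooth with gradient in \<open>L2\<close>. The cutoffs
  \<open>\<theta> (x / m)\<close> then cost only terms that carry a factor \<open>1 / m\<close>, since every derivative of the cutoff does.
\<close>

theorem weak_laplacian_approx:
  fixes u w :: "real^'n::finite \<Rightarrow> real"
  assumes W: "weak_laplacian u w" and "e > 0"
  shows "\<exists>\<phi>\<in>test_functions. norm (l2_of \<phi> - l2_of u) < e \<and> norm (l2_of (test_laplacian \<phi>) - l2_of w) < e"
proof -
  have u: "u \<in> L2" and w: "w \<in> L2" using W by (auto simp: weak_laplacian_def)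
  have loc: "locally_integrable u" by (rule L2_locally_integrable[OF u])
  obtain k :: "nat \<Rightarrow> real^'n \<Rightarrow> real" and R where k: "\<And>n. k n \<in> test_functions" "\<And>n x. 0 \<le> k n x"
    "\<And>n. (\<integral>x. k n x \<partial>lborel) = 1" "R > 0" "\<And>n x. norm x > R / real (Suc n) \<Longrightarrow> k n x = 0"
    using ex_mollifier by metis
  have "e / 2 > 0" using \<open>e > 0\<close> by simp
  obtain N1 where N1: "\<And>n. n \<ge> N1 \<Longrightarrow> dist (l2_of (conv (k n) u)) (l2_of u) < e / 2"
    using metric_LIMSEQ_D[OF mollify_L2[where k = k and R = R, OF k u] \<open>e / 2 > 0\<close>] by blast
  obtain N2 where N2: "\<And>n. n \<ge> N2 \<Longrightarrow> dist (l2_of (conv (k n) w)) (l2_of w) < e / 2"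
    using metric_LIMSEQ_D[OF mollify_L2[where k = k and R = R, OF k w] \<open>e / 2 > 0\<close>] by blast
  define j where "j = k (max N1 N2)"
  have j: "j \<in> test_functions" by (simp add: j_def k)
  define v where "v = conv j u"
  have v_close: "dist (l2_of v) (l2_of u) < e / 2" "dist (l2_of (conv j w)) (l2_of w) < e / 2"
    using N1[of "max N1 N2"] N2[of "max N1 N2"] by (simp_all add: v_def j_def)
  have smooth_v: "smooth v" unfolding v_def by (rule smooth_conv[OF j loc])
  have vL: "v \<in> L2" unfolding v_def by (rule conv_L2(1)[OF j u])
  have dvL: "partial i v \<in> L2" for i
    unfolding v_def partial_conv[OF j loc] by (rule conv_L2(1)[OF test_partial[OF j] u])
  have lap_v: "(\<Sum>i\<in>UNIV. partials [i, i] v x) = conv j w x" for x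
    unfolding v_def by (rule conv_weak_laplacian[OF j W])
  have wL: "conv j w \<in> L2" by (rule conv_L2(1)[OF j w])
  obtain \<theta> :: "real^'n \<Rightarrow> real" where t: "\<theta> \<in> test_functions" "\<theta> 0 = 1" using ex_cutoff by metis
  define r where "r m = inverse (real (Suc m))" for m
  define \<theta>' where "\<theta>' m x = \<theta> (r m *\<^sub>R x)" for m x
  have r0: "r \<longlonglongrightarrow> 0" unfolding r_def[abs_def] by (rule LIMSEQ_inverse_real_of_nat)
  have \<theta>': "\<theta>' m \<in> test_functions" for m
    using test_affine[OF t(1), of "r m" 0] by (simp add: \<theta>'_def[abs_def] r_def)
  have d1: "partial i (\<theta>' m) x = r m * partial i \<theta> (r m *\<^sub>R x)" for i m x
    using partial_affine[OF smooth_differentiable[OF test_smooth[OF t(1)]], of i "r m" 0]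
    by (simp add: \<theta>'_def[abs_def] fun_eq_iff)
  have d2: "partials [i, i] (\<theta>' m) x = (r m)\<^sup>2 * partials [i, i] \<theta> (r m *\<^sub>R x)" for i m x
    using partials_affine[OF test_smooth[OF t(1)], of "[i, i]" "r m" 0]
    by (simp add: \<theta>'_def[abs_def] fun_eq_iff power2_eq_square)
  define \<phi> where "\<phi> m x = \<theta>' m x * v x" for m x
  have \<phi>: "\<phi> m \<in> test_functions" for m unfolding \<phi>_def[abs_def] by (rule test_mult[OF \<theta>' smooth_v])
  have lim_\<phi>: "(\<lambda>m. l2_of (\<phi> m)) \<longlonglongrightarrow> l2_of v"
    using cutoff_tendsto[OF t vL] unfolding \<phi>_def[abs_def] \<theta>'_def r_def .
  define A where "A i m x = partials [i, i] (\<theta>' m) x * v x" for i m x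
  define D where "D i m x = partial i (\<theta>' m) x * partial i v x" for i m x
  define E where "E m x = \<theta>' m x * conv j w x" for m x
  have AL: "A i m \<in> L2" and limA: "(\<lambda>m. l2_of (A i m)) \<longlonglongrightarrow> 0" for i m
  proof -
    obtain B where B: "\<And>x. \<bar>partials [i, i] \<theta> x\<bar> \<le> B" using test_bounded[OF test_partials[OF t(1)]] by metis
    have b: "\<bar>partials [i, i] (\<theta>' m) x\<bar> \<le> (r m)\<^sup>2 * B" for m x
      unfolding d2 abs_mult by (simp add: mult_left_mono B)
    note AB = L2_mult_bounded[OF vL test_measurable[OF test_partials[OF \<theta>']] b, folded A_def]
    show "A i m \<in> L2" using AB(1)[of m] by (simp add: A_def[abs_def])
    show "(\<lambda>m. l2_of (A i m)) \<longlonglongrightarrow> 0"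
    proof (rule Lim_null_comparison)
      show "\<forall>\<^sub>F m in sequentially. norm (l2_of (A i m)) \<le> (r m)\<^sup>2 * B * norm (l2_of v)"
        using AB(2) by (simp add: A_def[abs_def])
      have "(\<lambda>m. (r m)\<^sup>2 * B * norm (l2_of v)) \<longlonglongrightarrow> 0\<^sup>2 * B * norm (l2_of v)" by (intro tendsto_intros r0)
      then show "(\<lambda>m. (r m)\<^sup>2 * B * norm (l2_of v)) \<longlonglongrightarrow> 0" by simp
    qed
  qed
  have DL: "D i m \<in> L2" and limD: "(\<lambda>m. l2_of (D i m)) \<longlonglongrightarrow> 0" for i m
  proof -
    obtain B where B: "\<And>x. \<bar>partial i \<theta> x\<bar> \<le> B" using test_bounded[OF test_partial[OF t(1)]] by metis
    have b: "\<bar>partial i (\<theta>' m) x\<bar> \<le> r m * B" for m x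
      unfolding d1 abs_mult by (simp add: mult_left_mono B r_def)
    note AB = L2_mult_bounded[OF dvL[of i] test_measurable[OF test_partial[OF \<theta>']] b]
    show "D i m \<in> L2" using AB(1)[of m] by (simp add: D_def[abs_def])
    show "(\<lambda>m. l2_of (D i m)) \<longlonglongrightarrow> 0"
    proof (rule Lim_null_comparison)
      show "\<forall>\<^sub>F m in sequentially. norm (l2_of (D i m)) \<le> r m * B * norm (l2_of (partial i v))"
        using AB(2) by (simp add: D_def[abs_def])
      have "(\<lambda>m. r m * B * norm (l2_of (partial i v))) \<longlonglongrightarrow> 0 * B * norm (l2_of (partial i v))" by (intro tendsto_intros r0)
      then show "(\<lambda>m. r m * B * norm (l2_of (partial i v))) \<longlonglongrightarrow> 0" by simp
    qed
  qed
  have limE: "(\<lambda>m. l2_of (E m)) \<longlonglongrightarrow> l2_of (conv j w)"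
    using cutoff_tendsto[OF t wL] unfolding E_def[abs_def] \<theta>'_def r_def .
  have EL: "E m \<in> L2" for m
    using test_bounded[OF \<theta>'] L2_mult_bounded(1)[OF wL test_measurable[OF \<theta>']] unfolding E_def[abs_def] by metis
  have lap_\<phi>: "test_laplacian (\<phi> m) x = (\<Sum>i\<in>UNIV. A i m x + 2 *\<^sub>R D i m x) + E m x" for m x
    unfolding test_laplacian_def \<phi>_def[abs_def] partials2_mult[OF test_smooth[OF \<theta>'] smooth_v] E_def lap_v[symmetric]
    by (simp add: A_def D_def sum.distrib sum_distrib_left)
  have l2_lap: "l2_of (test_laplacian (\<phi> m)) = (\<Sum>i\<in>UNIV. l2_of (A i m) + 2 *\<^sub>R l2_of (D i m)) + l2_of (E m)" for m
  proof -
    have AD: "(\<lambda>x. A i m x + 2 *\<^sub>R D i m x) \<in> L2" for i by (intro L2_add L2_scaleR AL DL)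
    have l2_sum: "l2_of (\<lambda>x. \<Sum>i\<in>I. A i m x + 2 *\<^sub>R D i m x) = (\<Sum>i\<in>I. l2_of (A i m) + 2 *\<^sub>R l2_of (D i m))" if "finite I" for I
      using that
    proof (induction I rule: finite_induct)
      case empty
      show ?case by simp (transfer, simp)
    next
      case (insert i I)
      have "l2_of (\<lambda>x. \<Sum>i\<in>insert i I. A i m x + 2 *\<^sub>R D i m x) = l2_of (\<lambda>x. A i m x + 2 *\<^sub>R D i m x) + l2_of (\<lambda>x. \<Sum>i\<in>I. A i m x + 2 *\<^sub>R D i m x)"
        using insert by (subst l2_of_add[OF AD L2_sum[OF insert(1) AD]]) simp
      also have "l2_of (\<lambda>x. A i m x + 2 *\<^sub>R D i m x) = l2_of (A i m) + 2 *\<^sub>R l2_of (D i m)"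
        by (subst l2_of_scaleR[OF DL], subst l2_of_add[OF AL L2_scaleR[OF DL]]) simp
      finally show ?case using insert by simp
    qed
    have "l2_of (test_laplacian (\<phi> m)) = l2_of (\<lambda>x. (\<Sum>i\<in>UNIV. A i m x + 2 *\<^sub>R D i m x) + E m x)"
      unfolding lap_\<phi>[symmetric] ..
    also have "\<dots> = l2_of (\<lambda>x. \<Sum>i\<in>UNIV. A i m x + 2 *\<^sub>R D i m x) + l2_of (E m)"
      by (rule l2_of_add[symmetric, OF L2_sum[OF finite AD] EL])
    finally show ?thesis unfolding l2_sum[OF finite] .
  qed
  have "(\<lambda>m. l2_of (test_laplacian (\<phi> m))) \<longlonglongrightarrow> (\<Sum>i\<in>(UNIV :: 'n set). 0 + 2 *\<^sub>R 0) + l2_of (conv j w)"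
    unfolding l2_lap by (intro tendsto_add tendsto_sum tendsto_scaleR tendsto_const limA limD limE)
  then have lim_lap: "(\<lambda>m. l2_of (test_laplacian (\<phi> m))) \<longlonglongrightarrow> l2_of (conv j w)" by simp
  obtain M1 where M1: "\<And>m. m \<ge> M1 \<Longrightarrow> dist (l2_of (\<phi> m)) (l2_of v) < e / 2"
    using metric_LIMSEQ_D[OF lim_\<phi> \<open>e / 2 > 0\<close>] by blast
  obtain M2 where M2: "\<And>m. m \<ge> M2 \<Longrightarrow> dist (l2_of (test_laplacian (\<phi> m))) (l2_of (conv j w)) < e / 2"
    using metric_LIMSEQ_D[OF lim_lap \<open>e / 2 > 0\<close>] by blast
  define m where "m = max M1 M2"
  have "dist (l2_of (\<phi> m)) (l2_of u) < e"
    using dist_triangle[of "l2_of (\<phi> m)" "l2_of u" "l2_of v"] M1[of m] v_close(1) by (simp add: m_def)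
  moreover have "dist (l2_of (test_laplacian (\<phi> m))) (l2_of w) < e"
    using dist_triangle[of "l2_of (test_laplacian (\<phi> m))" "l2_of w" "l2_of (conv j w)"] M2[of m] v_close(2) by (simp add: m_def)
  ultimately show ?thesis using \<phi>[of m] unfolding dist_norm by blast
qed

section \<open>A Ladyzhenskaya inequality in three dimensions\<close>

lemma ennreal_power2_le_imp_le:
  fixes x y :: ennreal
  assumes "x\<^sup>2 \<le> y\<^sup>2"
  shows "x \<le> y"
proof (cases y)
  case top
  then show ?thesis by simp
next
  case (real b)
  show ?thesis
  proof (cases x)
    case top
    then show ?thesis using assms \<open>y = ennreal b\<close> \<open>0 \<le> b\<close>
      by (simp add: ennreal_power power2_eq_square[of "top :: ennreal"] ennreal_top_mult top_unique)
  next
    case (real a)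
    then show ?thesis using assms \<open>y = ennreal b\<close> \<open>0 \<le> b\<close>
      by (simp add: ennreal_power)
  qed
qed

definition point3 :: "real \<Rightarrow> real \<Rightarrow> real \<Rightarrow> real^3" where
  "point3 a b c = a *\<^sub>R axis 1 1 + b *\<^sub>R axis 2 1 + c *\<^sub>R axis 3 1"

lemma point3_nth [simp]: "point3 a b c $ 1 = a" "point3 a b c $ 2 = b" "point3 a b c $ 3 = c"
  by (simp_all add: point3_def axis_def)

lemma point3_measurable [measurable]: "(\<lambda>(a, b, c). point3 a b c) \<in> borel_measurable borel"
  unfolding point3_def split_beta by (intro borel_measurable_continuous_onI continuous_intros)

lemma prod_Basis_R3: "(\<Prod>b\<in>(Basis :: (real^3) set). x \<bullet> b) = x $ 1 * (x $ 2 * x $ 3)"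
proof -
  have B: "(Basis :: (real^3) set) = (\<lambda>i. axis i 1) ` UNIV" by (auto simp: Basis_vec_def)
  have "inj (\<lambda>i::3. axis i (1::real))" by (auto simp: inj_on_def axis_eq_axis)
  then have "(\<Prod>b\<in>(Basis :: (real^3) set). x \<bullet> b) = (\<Prod>i\<in>UNIV. x $ i)"
    unfolding B by (subst prod.reindex) (auto simp: inner_axis)
  also have "\<dots> = x $ 1 * (x $ 2 * x $ 3)" unfolding UNIV_3 by (simp add: mult.assoc)
  finally show ?thesis .
qed

text \<open>
  Writing Lebesgue measure on \<open>real^3\<close> as an image of the product measure makes Tonelli's theorem
  available in the three coordinates.
\<close>

lemma lborel_R3: "(lborel :: (real^3) measure) = distr lborel borel (\<lambda>(a, b, c). point3 a b c)"
proof (rule lborel_eqI)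
  fix l u :: "real^3" assume le: "\<And>b. b \<in> Basis \<Longrightarrow> l \<bullet> b \<le> u \<bullet> b"
  have lei: "l $ i \<le> u $ i" for i using le[of "axis i 1"] by (simp add: inner_axis axis_in_Basis_iff)
  have vimage: "(\<lambda>(a, b, c). point3 a b c) -` box l u = {l $ 1<..<u $ 1} \<times> ({l $ 2<..<u $ 2} \<times> {l $ 3<..<u $ 3})"
    by (auto simp: mem_box_cart forall_3)
  have S: "{l $ 2<..<u $ 2} \<times> {l $ 3<..<u $ 3} \<in> sets borel" by (intro borel_open open_Times) auto
  have "emeasure (distr lborel borel (\<lambda>(a, b, c). point3 a b c)) (box l u)
    = emeasure lborel ({l $ 1<..<u $ 1} \<times> ({l $ 2<..<u $ 2} \<times> {l $ 3<..<u $ 3}))"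
    by (subst emeasure_distr) (auto simp: vimage)
  also have "\<dots> = emeasure lborel {l $ 1<..<u $ 1} * (emeasure lborel {l $ 2<..<u $ 2} * emeasure lborel {l $ 3<..<u $ 3})"
    using lborel.emeasure_pair_measure_Times[of "{l $ 1<..<u $ 1}" lborel "{l $ 2<..<u $ 2} \<times> {l $ 3<..<u $ 3}"]
      lborel.emeasure_pair_measure_Times[of "{l $ 2<..<u $ 2}" lborel "{l $ 3<..<u $ 3}"]
    by (simp add: lborel_prod S)
  also have "\<dots> = ennreal (\<Prod>b\<in>Basis. (u - l) \<bullet> b)"
    unfolding prod_Basis_R3 using lei by (simp add: ennreal_mult)
  finally show "emeasure (distr lborel borel (\<lambda>(a, b, c). point3 a b c)) (box l u) = ennreal (\<Prod>b\<in>Basis. (u - l) \<bullet> b)" .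
qed simp

lemma nn_integral_R3:
  fixes f :: "real^3 \<Rightarrow> ennreal"
  assumes [measurable]: "f \<in> borel_measurable borel"
  shows "(\<integral>\<^sup>+x. f x \<partial>lborel) = (\<integral>\<^sup>+c. \<integral>\<^sup>+a. \<integral>\<^sup>+b. f (point3 a b c) \<partial>lborel \<partial>lborel \<partial>lborel)"
proof -
  have [measurable]: "(\<lambda>(a, b, c). point3 a b c) \<in> borel_measurable (lborel \<Otimes>\<^sub>M (lborel \<Otimes>\<^sub>M lborel))"
    by (simp add: lborel_prod)
  have [measurable]: "(\<lambda>x. f (point3 (g x) (h x) (k x))) \<in> borel_measurable M"
    if [measurable]: "g \<in> borel_measurable M" "h \<in> borel_measurable M" "k \<in> borel_measurable M" for g h k and M :: "'z measure"
  proof -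
    have "(\<lambda>x. point3 (g x) (h x) (k x)) \<in> borel_measurable M" unfolding point3_def by measurable
    then show ?thesis by measurable
  qed
  have "(\<integral>\<^sup>+x. f x \<partial>lborel) = (\<integral>\<^sup>+p. f (case p of (a, b, c) \<Rightarrow> point3 a b c) \<partial>lborel)"
    by (subst lborel_R3) (simp add: nn_integral_distr)
  also have "\<dots> = (\<integral>\<^sup>+a. \<integral>\<^sup>+q. f (case q of (b, c) \<Rightarrow> point3 a b c) \<partial>(lborel :: (real \<times> real) measure) \<partial>(lborel :: real measure))"
    using lborel.nn_integral_fst[of "\<lambda>p. f (case p of (a, b, c) \<Rightarrow> point3 a b c)" "lborel :: real measure"]
    by (simp add: lborel_prod)
  also have "\<dots> = (\<integral>\<^sup>+a. \<integral>\<^sup>+c. \<integral>\<^sup>+b. f (point3 a b c) \<partial>lborel \<partial>lborel \<partial>lborel)"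
  proof (rule nn_integral_cong)
    fix a :: real
    have "(\<lambda>q. f (case q of (b, c) \<Rightarrow> point3 a b c)) \<in> borel_measurable (lborel \<Otimes>\<^sub>M lborel)"
      unfolding split_beta by measurable
    from lborel_pair.nn_integral_snd[OF this]
    show "(\<integral>\<^sup>+q. f (case q of (b, c) \<Rightarrow> point3 a b c) \<partial>(lborel :: (real \<times> real) measure)) = (\<integral>\<^sup>+c. \<integral>\<^sup>+b. f (point3 a b c) \<partial>lborel \<partial>lborel)"
      by (simp add: lborel_prod)
  qed
  also have "\<dots> = (\<integral>\<^sup>+c. \<integral>\<^sup>+a. \<integral>\<^sup>+b. f (point3 a b c) \<partial>lborel \<partial>lborel \<partial>lborel)"
    by (rule lborel_pair.Fubini'[symmetric]) measurable
  finally show ?thesis .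
qed

lemma nn_integral_swap:
  fixes g :: "real \<Rightarrow> real \<Rightarrow> ennreal"
  assumes "(\<lambda>(x, y). g x y) \<in> borel_measurable (lborel \<Otimes>\<^sub>M lborel)"
  shows "(\<integral>\<^sup>+y. \<integral>\<^sup>+x. g x y \<partial>lborel \<partial>lborel) = (\<integral>\<^sup>+x. \<integral>\<^sup>+y. g x y \<partial>lborel \<partial>lborel)"
  by (rule lborel_pair.Fubini') (use assms in simp)

lemma Cauchy_Schwarz_nn_integral_2:
  fixes f g :: "real \<Rightarrow> real \<Rightarrow> ennreal"
  assumes [measurable]: "(\<lambda>(x, y). f x y) \<in> borel_measurable (lborel \<Otimes>\<^sub>M lborel)"
    "(\<lambda>(x, y). g x y) \<in> borel_measurable (lborel \<Otimes>\<^sub>M lborel)"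
  shows "(\<integral>\<^sup>+x. \<integral>\<^sup>+y. f x y * g x y \<partial>lborel \<partial>lborel)\<^sup>2
    \<le> (\<integral>\<^sup>+x. \<integral>\<^sup>+y. (f x y)\<^sup>2 \<partial>lborel \<partial>lborel) * (\<integral>\<^sup>+x. \<integral>\<^sup>+y. (g x y)\<^sup>2 \<partial>lborel \<partial>lborel)"
proof -
  have fst: "(\<integral>\<^sup>+x. \<integral>\<^sup>+y. h x y \<partial>lborel \<partial>lborel) = (\<integral>\<^sup>+p. (case p of (x, y) \<Rightarrow> h x y) \<partial>(lborel \<Otimes>\<^sub>M lborel))"
    if "(\<lambda>(x, y). h x y) \<in> borel_measurable (lborel \<Otimes>\<^sub>M lborel)" for h :: "real \<Rightarrow> real \<Rightarrow> ennreal"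
    using lborel.nn_integral_fst[OF that] by simp
  have "(\<integral>\<^sup>+p. (case p of (x, y) \<Rightarrow> f x y) * (case p of (x, y) \<Rightarrow> g x y) \<partial>(lborel \<Otimes>\<^sub>M lborel))\<^sup>2
    \<le> (\<integral>\<^sup>+p. (case p of (x, y) \<Rightarrow> f x y)\<^sup>2 \<partial>(lborel \<Otimes>\<^sub>M lborel)) * (\<integral>\<^sup>+p. (case p of (x, y) \<Rightarrow> g x y)\<^sup>2 \<partial>(lborel \<Otimes>\<^sub>M lborel))"
    by (rule Cauchy_Schwarz_nn_integral) (rule assms)+
  moreover have m: "(\<lambda>(x, y). f x y * g x y) \<in> borel_measurable (lborel \<Otimes>\<^sub>M lborel)"
    "(\<lambda>(x, y). (f x y)\<^sup>2) \<in> borel_measurable (lborel \<Otimes>\<^sub>M lborel)"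
    "(\<lambda>(x, y). (g x y)\<^sup>2) \<in> borel_measurable (lborel \<Otimes>\<^sub>M lborel)" by measurable
  ultimately show ?thesis unfolding fst[OF m(1)] fst[OF m(2)] fst[OF m(3)] by (simp add: case_prod_beta')
qed

lemma line_bound:
  fixes g g' :: "real \<Rightarrow> real"
  assumes der: "\<And>s. (g has_real_derivative g' s) (at s)" and cont: "continuous_on UNIV g'"
    and supp: "\<And>s. \<bar>s\<bar> > R \<Longrightarrow> g s = 0"
  shows "ennreal (g a) \<le> (\<integral>\<^sup>+s. ennreal \<bar>g' s\<bar> \<partial>lborel)"
proof -
  have [measurable]: "g' \<in> borel_measurable borel" using cont by (rule borel_measurable_continuous_onI)
  define L where "L = - (\<bar>a\<bar> + \<bar>R\<bar> + 1)"
  have La: "L \<le> a" unfolding L_def by linarith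
  have gL: "g L = 0" by (rule supp) (simp add: L_def)
  have hb: "has_bochner_integral lborel (\<lambda>s. g' s * indicator {L..a} s) (g a - g L)"
    by (rule has_bochner_integral_FTC_Icc_real[OF La])
      (use der cont in \<open>auto simp: has_real_derivative_iff_has_vector_derivative[symmetric] continuous_on_eq_continuous_at\<close>)
  have "ennreal (g a) \<le> ennreal (norm (\<integral>s. g' s * indicator {L..a} s \<partial>lborel))"
    using has_bochner_integral_integral_eq[OF hb] gL by (intro ennreal_leI) simp
  also have "\<dots> \<le> (\<integral>\<^sup>+s. ennreal (norm (g' s * indicator {L..a} s)) \<partial>lborel)"
    by (rule integral_norm_bound_ennreal) (use hb in \<open>simp add: has_bochner_integral_iff\<close>)
  also have "\<dots> \<le> (\<integral>\<^sup>+s. ennreal \<bar>g' s\<bar> \<partial>lborel)"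
    by (intro nn_integral_mono ennreal_leI) (auto simp: indicator_def)
  finally show ?thesis .
qed

lemma test_square_line_bound:
  fixes \<phi> :: "real^'n::finite \<Rightarrow> real"
  assumes \<phi>: "\<phi> \<in> test_functions"
  shows "ennreal ((\<phi> (x + a *\<^sub>R axis i 1))\<^sup>2)
    \<le> (\<integral>\<^sup>+s. ennreal \<bar>\<phi> (x + s *\<^sub>R axis i 1)\<bar> * ennreal (2 * \<bar>partial i \<phi> (x + s *\<^sub>R axis i 1)\<bar>) \<partial>lborel)"
proof -
  obtain R where R: "\<And>x. norm x > R \<Longrightarrow> \<phi> x = 0" using test_support[OF \<phi>] by metis
  let ?p = "\<lambda>s. x + s *\<^sub>R axis i 1"
  have der: "((\<lambda>s. \<phi> (?p s)) has_real_derivative partial i \<phi> (?p s)) (at s)" for s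
  proof -
    have line: "(?p has_derivative (\<lambda>h. h *\<^sub>R axis i 1)) (at s)" by (auto intro!: derivative_eq_intros)
    have "(\<phi> has_derivative (\<lambda>h. \<Sum>j\<in>UNIV. h $ j * partial j \<phi> (?p s))) (at (?p s))"
      by (rule differentiable_has_derivative_partial[OF smooth_differentiable[OF test_smooth[OF \<phi>]]])
    from has_derivative_compose[OF line this]
    have "((\<lambda>s. \<phi> (?p s)) has_derivative (\<lambda>h. \<Sum>j\<in>UNIV. (h *\<^sub>R axis i 1) $ j * partial j \<phi> (?p s))) (at s)" .
    moreover have "(\<Sum>j\<in>UNIV. (h *\<^sub>R axis i 1) $ j * partial j \<phi> (?p s)) = partial i \<phi> (?p s) * h" for h
    proof -
      have "(\<Sum>j\<in>UNIV. (h *\<^sub>R axis i 1) $ j * partial j \<phi> (?p s)) = (\<Sum>j\<in>UNIV. if j = i then h * partial j \<phi> (?p s) else 0)"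
        by (intro sum.cong) (auto simp: axis_def)
      then show ?thesis by simp
    qed
    ultimately show ?thesis unfolding has_field_derivative_def by simp
  qed
  have "ennreal ((\<phi> (?p a))\<^sup>2) \<le> (\<integral>\<^sup>+s. ennreal \<bar>2 * \<phi> (?p s) * partial i \<phi> (?p s)\<bar> \<partial>lborel)"
  proof (rule line_bound[where g = "\<lambda>s. (\<phi> (?p s))\<^sup>2" and g' = "\<lambda>s. 2 * \<phi> (?p s) * partial i \<phi> (?p s)" and R = "R + norm x"])
    show "((\<lambda>s. (\<phi> (?p s))\<^sup>2) has_real_derivative 2 * \<phi> (?p s) * partial i \<phi> (?p s)) (at s)" for s
      using DERIV_power[OF der, of 2 s] by (simp add: mult_ac)
    have "continuous_on UNIV (\<lambda>s. \<psi> (?p s))" if "\<psi> \<in> test_functions" for \<psi>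
      by (rule continuous_on_compose2[OF test_continuous[OF that, of UNIV]]) (auto intro!: continuous_intros)
    then show "continuous_on UNIV (\<lambda>s. 2 * \<phi> (?p s) * partial i \<phi> (?p s))"
      by (intro continuous_intros) (auto intro: \<phi> test_partial)
    show "(\<phi> (?p s))\<^sup>2 = 0" if "\<bar>s\<bar> > R + norm x" for s
    proof -
      have "\<bar>s\<bar> - norm x \<le> norm (?p s)"
        using norm_triangle_ineq2[of "s *\<^sub>R axis i 1" "- x"] by (simp add: norm_axis_1 add.commute)
      then show ?thesis using that by (simp add: R)
    qed
  qed
  then show ?thesis by (simp add: abs_mult ennreal_mult[symmetric] mult_ac)
qed

text \<open>
  By the fundamental theorem of calculus, \<open>\<phi>\<^sup>2\<close> at a point is at most the integral of \<open>2|\<phi> \<partial>\<^sub>i\<phi>|\<close>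
  over the line through that point in direction \<open>i\<close>. On a horizontal plane the bounds for \<open>i = 1\<close> and
  \<open>i = 2\<close> depend on different variables, so the integral of \<open>\<phi>\<^sup>4\<close> over the plane is at most a product of
  two plane integrals, which the Cauchy-Schwarz inequality estimates by the mass of \<open>\<phi>\<^sup>2\<close> in the plane
  times the gradient. The bound for \<open>i = 3\<close> controls that mass uniformly in the height.
\<close>

theorem ladyzhenskaya:
  fixes \<phi> :: "real^3 \<Rightarrow> real"
  assumes \<phi>: "\<phi> \<in> test_functions"
  defines "N \<equiv> (\<integral>\<^sup>+x. ennreal ((\<phi> x)\<^sup>2) \<partial>lborel)"
    and "G \<equiv> (\<Sum>i\<in>UNIV. \<integral>\<^sup>+x. ennreal ((partial i \<phi> x)\<^sup>2) \<partial>lborel)"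
  shows "(\<integral>\<^sup>+x. ennreal ((\<phi> x)^4) \<partial>lborel)\<^sup>2 \<le> 64 * (N * G^3)"
proof -
  define F where "F a b c = ennreal ((\<phi> (point3 a b c))\<^sup>2)" for a b c
  define f where "f a b c = ennreal \<bar>\<phi> (point3 a b c)\<bar>" for a b c
  define d where "d i a b c = ennreal (2 * \<bar>partial i \<phi> (point3 a b c)\<bar>)" for i a b c
  define g where "g i = (\<integral>\<^sup>+x. ennreal ((partial i \<phi> x)\<^sup>2) \<partial>lborel)" for i
  note [measurable] = test_measurable[OF \<phi>] test_measurable[OF test_partial[OF \<phi>]]
  have pm [measurable]: "(\<lambda>x. point3 (p x) (q x) (r x)) \<in> borel_measurable M"
    if [measurable]: "p \<in> borel_measurable M" "q \<in> borel_measurable M" "r \<in> borel_measurable M" for p q r and M :: "'z measure"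
    unfolding point3_def by measurable
  have [measurable]: "(\<lambda>x. F (p x) (q x) (r x)) \<in> borel_measurable M" "(\<lambda>x. f (p x) (q x) (r x)) \<in> borel_measurable M"
    "(\<lambda>x. d i (p x) (q x) (r x)) \<in> borel_measurable M"
    if [measurable]: "p \<in> borel_measurable M" "q \<in> borel_measurable M" "r \<in> borel_measurable M" for p q r i and M :: "'z measure"
    unfolding F_def f_def d_def by measurable
  have Ff: "F a b c = (f a b c)\<^sup>2" for a b c by (simp add: F_def f_def ennreal_power)
  have d2: "(d i a b c)\<^sup>2 = 4 * ennreal ((partial i \<phi> (point3 a b c))\<^sup>2)" for i a b c
    by (simp add: d_def ennreal_power power_mult_distrib ennreal_mult)
  have J: "(\<integral>\<^sup>+c. \<integral>\<^sup>+a. \<integral>\<^sup>+b. F a b c \<partial>lborel \<partial>lborel \<partial>lborel) = N"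
    unfolding N_def F_def by (subst nn_integral_R3) auto
  have Jd: "(\<integral>\<^sup>+c. \<integral>\<^sup>+a. \<integral>\<^sup>+b. (d i a b c)\<^sup>2 \<partial>lborel \<partial>lborel \<partial>lborel) = 4 * g i" for i
    unfolding g_def d2 by (subst nn_integral_R3) (auto simp: nn_integral_cmult)
  have shift: "point3 s b c = point3 0 b c + s *\<^sub>R axis 1 1" "point3 a s c = point3 a 0 c + s *\<^sub>R axis 2 1"
    "point3 a b s = point3 a b 0 + s *\<^sub>R axis 3 1" for a b c s by (simp_all add: point3_def)
  have F1: "F a b c \<le> (\<integral>\<^sup>+s. f s b c * d 1 s b c \<partial>lborel)" for a b c
    using test_square_line_bound[OF \<phi>, of "point3 0 b c" a 1]
    unfolding F_def f_def d_def by (simp only: shift(1)[symmetric])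
  have F2: "F a b c \<le> (\<integral>\<^sup>+s. f a s c * d 2 a s c \<partial>lborel)" for a b c
    using test_square_line_bound[OF \<phi>, of "point3 a 0 c" b 2]
    unfolding F_def f_def d_def by (simp only: shift(2)[symmetric])
  have F3: "F a b c \<le> (\<integral>\<^sup>+s. f a b s * d 3 a b s \<partial>lborel)" for a b c
    using test_square_line_bound[OF \<phi>, of "point3 a b 0" c 3]
    unfolding F_def f_def d_def by (simp only: shift(3)[symmetric])
  define \<tau> where "\<tau> = (\<integral>\<^sup>+c. \<integral>\<^sup>+a. \<integral>\<^sup>+b. f a b c * d 3 a b c \<partial>lborel \<partial>lborel \<partial>lborel)"
  define U where "U c = (\<integral>\<^sup>+a. \<integral>\<^sup>+b. F a b c \<partial>lborel \<partial>lborel)" for c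
  define X where "X i c = (\<integral>\<^sup>+a. \<integral>\<^sup>+b. (d i a b c)\<^sup>2 \<partial>lborel \<partial>lborel)" for i c
  have [measurable]: "X i \<in> borel_measurable borel" for i unfolding X_def[abs_def] by measurable
  have U: "U c \<le> \<tau>" for c
  proof -
    have "U c \<le> (\<integral>\<^sup>+a. \<integral>\<^sup>+b. \<integral>\<^sup>+s. f a b s * d 3 a b s \<partial>lborel \<partial>lborel \<partial>lborel)"
      unfolding U_def by (intro nn_integral_mono F3)
    also have "\<dots> = (\<integral>\<^sup>+a. \<integral>\<^sup>+s. \<integral>\<^sup>+b. f a b s * d 3 a b s \<partial>lborel \<partial>lborel \<partial>lborel)"
      by (intro nn_integral_cong nn_integral_swap) measurable
    also have "\<dots> = \<tau>" unfolding \<tau>_def by (rule nn_integral_swap) measurable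
    finally show ?thesis .
  qed
  define A where "A c = (\<integral>\<^sup>+a. \<integral>\<^sup>+b. f a b c * d 1 a b c \<partial>lborel \<partial>lborel)" for c
  define B where "B c = (\<integral>\<^sup>+a. \<integral>\<^sup>+b. f a b c * d 2 a b c \<partial>lborel \<partial>lborel)" for c
  have A: "(A c)\<^sup>2 \<le> U c * X 1 c" for c
    unfolding A_def U_def X_def Ff by (rule Cauchy_Schwarz_nn_integral_2) measurable
  have B: "(B c)\<^sup>2 \<le> U c * X 2 c" for c
    unfolding B_def U_def X_def Ff by (rule Cauchy_Schwarz_nn_integral_2) measurable
  have AB: "A c * B c \<le> \<tau> * (X 1 c + X 2 c)" for c
  proof (rule ennreal_power2_le_imp_le)
    have "(A c * B c)\<^sup>2 \<le> (U c * X 1 c) * (U c * X 2 c)"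
      unfolding power_mult_distrib by (intro mult_mono A B) auto
    also have "\<dots> = (U c * U c) * (X 1 c * X 2 c)" by (simp add: mult_ac)
    also have "\<dots> \<le> (\<tau> * \<tau>) * ((X 1 c + X 2 c) * (X 1 c + X 2 c))"
      by (intro mult_mono U) (auto simp: add_increasing add_increasing2)
    also have "\<dots> = (\<tau> * (X 1 c + X 2 c))\<^sup>2" by (simp add: power2_eq_square mult_ac)
    finally show "(A c * B c)\<^sup>2 \<le> (\<tau> * (X 1 c + X 2 c))\<^sup>2" .
  qed
  (* on the plane of height c the two line bounds depend on disjoint variables, so their product integrates to A c * B c *)
  have slice: "(\<integral>\<^sup>+a. \<integral>\<^sup>+b. F a b c * F a b c \<partial>lborel \<partial>lborel) \<le> A c * B c" for c
  proof -
    have "(\<integral>\<^sup>+a. \<integral>\<^sup>+b. F a b c * F a b c \<partial>lborel \<partial>lborel)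
      \<le> (\<integral>\<^sup>+a. \<integral>\<^sup>+b. (\<integral>\<^sup>+s. f s b c * d 1 s b c \<partial>lborel) * (\<integral>\<^sup>+s. f a s c * d 2 a s c \<partial>lborel) \<partial>lborel \<partial>lborel)"
      by (intro nn_integral_mono mult_mono F1 F2) auto
    also have "\<dots> = (\<integral>\<^sup>+a. (\<integral>\<^sup>+b. \<integral>\<^sup>+s. f s b c * d 1 s b c \<partial>lborel \<partial>lborel) * (\<integral>\<^sup>+s. f a s c * d 2 a s c \<partial>lborel) \<partial>lborel)"
      by (intro nn_integral_cong nn_integral_multc) measurable
    also have "\<dots> = (\<integral>\<^sup>+b. \<integral>\<^sup>+s. f s b c * d 1 s b c \<partial>lborel \<partial>lborel) * (\<integral>\<^sup>+a. \<integral>\<^sup>+s. f a s c * d 2 a s c \<partial>lborel \<partial>lborel)"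
      by (intro nn_integral_cmult) measurable
    also have "(\<integral>\<^sup>+b. \<integral>\<^sup>+s. f s b c * d 1 s b c \<partial>lborel \<partial>lborel) = A c"
      unfolding A_def by (rule nn_integral_swap) measurable
    finally show ?thesis unfolding B_def .
  qed
  have "(\<integral>\<^sup>+x. ennreal ((\<phi> x)^4) \<partial>lborel) = (\<integral>\<^sup>+c. \<integral>\<^sup>+a. \<integral>\<^sup>+b. F a b c * F a b c \<partial>lborel \<partial>lborel \<partial>lborel)"
    by (subst nn_integral_R3) (auto simp: F_def ennreal_mult[symmetric] power4_eq_xxxx power2_eq_square mult_ac)
  also have "\<dots> \<le> (\<integral>\<^sup>+c. \<tau> * (X 1 c + X 2 c) \<partial>lborel)"
    by (intro nn_integral_mono order_trans[OF slice AB])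
  also have "\<dots> = \<tau> * ((\<integral>\<^sup>+c. X 1 c \<partial>lborel) + (\<integral>\<^sup>+c. X 2 c \<partial>lborel))"
    by (subst nn_integral_cmult) (auto simp: nn_integral_add)
  also have "\<dots> = \<tau> * (4 * g 1 + 4 * g 2)" unfolding X_def Jd ..
  finally have main: "(\<integral>\<^sup>+x. ennreal ((\<phi> x)^4) \<partial>lborel) \<le> \<tau> * (4 * g 1 + 4 * g 2)" .
  have \<tau>: "\<tau>\<^sup>2 \<le> N * (4 * g 3)"
  proof -
    have "\<tau> = (\<integral>\<^sup>+x. ennreal \<bar>\<phi> x\<bar> * ennreal (2 * \<bar>partial 3 \<phi> x\<bar>) \<partial>lborel)"
      unfolding \<tau>_def f_def d_def by (subst nn_integral_R3) auto
    also have "(\<dots>)\<^sup>2 \<le> (\<integral>\<^sup>+x. (ennreal \<bar>\<phi> x\<bar>)\<^sup>2 \<partial>lborel) * (\<integral>\<^sup>+x. (ennreal (2 * \<bar>partial 3 \<phi> x\<bar>))\<^sup>2 \<partial>lborel)"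
      by (rule Cauchy_Schwarz_nn_integral) measurable
    also have "(\<integral>\<^sup>+x. (ennreal \<bar>\<phi> x\<bar>)\<^sup>2 \<partial>lborel) = N" by (simp add: N_def ennreal_power)
    also have "(\<integral>\<^sup>+x. (ennreal (2 * \<bar>partial 3 \<phi> x\<bar>))\<^sup>2 \<partial>lborel) = 4 * g 3"
      by (simp add: g_def ennreal_power power_mult_distrib ennreal_mult nn_integral_cmult)
    finally show ?thesis .
  qed
  have G: "G = g 1 + g 2 + g 3" unfolding G_def g_def UNIV_3 by (simp add: add.assoc)
  have "(\<integral>\<^sup>+x. ennreal ((\<phi> x)^4) \<partial>lborel)\<^sup>2 \<le> (\<tau> * (4 * g 1 + 4 * g 2))\<^sup>2"
    by (rule power_mono[OF main]) simp
  also have "\<dots> = \<tau>\<^sup>2 * (16 * ((g 1 + g 2) * (g 1 + g 2)))"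
  proof -
    have "4 * g 1 + 4 * g 2 = 4 * (g 1 + g 2)" by (simp only: distrib_left)
    then show ?thesis by (simp only: power_mult_distrib power2_eq_square[of "g 1 + g 2"]) simp
  qed
  also have "\<dots> \<le> (N * (4 * G)) * (16 * (G * G))"
    by (intro mult_mono order_trans[OF \<tau>]) (auto simp: G add_increasing add_increasing2)
  also have "\<dots> = 64 * (N * G^3)" by (simp add: power3_eq_cube mult_ac)
  finally show ?thesis .
qed

lemma lborel_distr_reflect: "distr lborel borel (\<lambda>y. x - y) = (lborel :: 'a::euclidean_space measure)"
proof -
  have "lborel = density (distr lborel borel (\<lambda>y. x + (-1) *\<^sub>R y)) (\<lambda>_. \<bar>-1::real\<bar>^DIM('a))"
    by (rule lborel_affine) simp
  then show ?thesis by (simp add: density_1)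
qed

text \<open>
  Convolution of \<open>\<psi>\<close> with the constant 1 is constant, so its derivative, the convolution of
  \<open>\<partial>\<^sub>i\<psi>\<close> with 1, is zero.
\<close>

lemma integral_partial_test:
  fixes \<psi> :: "real^'n::finite \<Rightarrow> real"
  assumes \<psi>: "\<psi> \<in> test_functions"
  shows "(\<integral>x. partial i \<psi> x \<partial>lborel) = 0"
proof -
  have reflect: "conv \<xi> (\<lambda>_. 1) x = (\<integral>y. \<xi> y \<partial>lborel)" if "\<xi> \<in> test_functions" for \<xi> :: "real^'n \<Rightarrow> real" and x
  proof -
    note [measurable] = test_measurable[OF that]
    have "conv \<xi> (\<lambda>_. 1) x = (\<integral>y. \<xi> (x - y) \<partial>lborel)"
      unfolding conv_def mult_1_right by (rule integral_completion) measurable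
    also have "\<dots> = (\<integral>y. \<xi> y \<partial>distr lborel borel (\<lambda>y. x - y))"
      by (rule integral_distr[symmetric]) measurable
    finally show ?thesis by (simp add: lborel_distr_reflect)
  qed
  have loc: "locally_integrable (\<lambda>_::real^'n. 1::real)"
    unfolding locally_integrable_def set_integrable_def
  proof (intro allI impI)
    fix K :: "(real^'n) set" assume "compact K"
    then have "K \<in> lmeasurable" by (rule lmeasurable_compact)
    then show "integrable lebesgue (\<lambda>x. indicat_real K x *\<^sub>R (1::real))"
      by (auto intro: integrable_real_indicator simp: fmeasurable_def)
  qed
  have "(\<integral>x. partial i \<psi> x \<partial>lborel) = partial i (conv \<psi> (\<lambda>_. 1)) 0"
    unfolding partial_conv[OF \<psi> loc] by (rule reflect[OF test_partial[OF \<psi>], symmetric])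
  also have "conv \<psi> (\<lambda>_. 1) = (\<lambda>x. \<integral>y. \<psi> y \<partial>lborel)" by (rule ext) (rule reflect[OF \<psi>])
  finally show ?thesis by simp
qed

lemma dirichlet_integral_test:
  fixes \<phi> :: "real^'n::finite \<Rightarrow> real"
  assumes \<phi>: "\<phi> \<in> test_functions"
  shows "(\<Sum>i\<in>UNIV. \<integral>\<^sup>+x. ennreal ((partial i \<phi> x)\<^sup>2) \<partial>lborel) = ennreal (- (l2_of (test_laplacian \<phi>) \<bullet> l2_of \<phi>))"
    "- (l2_of (test_laplacian \<phi>) \<bullet> l2_of \<phi>) \<ge> 0"
proof -
  define D where "D i = (\<integral>x. (partial i \<phi> x)\<^sup>2 \<partial>lborel)" for i
  have int1: "integrable lborel (\<lambda>x. (partial i \<phi> x)\<^sup>2)" for i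
    using test_integrable_lborel[OF test_mult[OF test_partial[OF \<phi>] test_smooth[OF test_partial[OF \<phi>]]]]
    by (simp add: power2_eq_square)
  have int2: "integrable lborel (\<lambda>x. partials [i, i] \<phi> x * \<phi> x)" for i
    by (rule test_integrable_lborel[OF test_mult[OF test_partials[OF \<phi>] test_smooth[OF \<phi>]]])
  have parts: "(\<integral>x. partials [i, i] \<phi> x * \<phi> x \<partial>lborel) = - D i" for i
  proof -
    have "partial i (\<lambda>x. partial i \<phi> x * \<phi> x) = (\<lambda>x. partials [i, i] \<phi> x * \<phi> x + (partial i \<phi> x)\<^sup>2)"
      using smooth_differentiable[OF test_smooth[OF \<phi>]] smooth_differentiable[OF test_smooth[OF test_partial[OF \<phi>]]]
      by (subst partial_mult) (auto simp: partials_Cons power2_eq_square)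
    then have "0 = (\<integral>x. partials [i, i] \<phi> x * \<phi> x + (partial i \<phi> x)\<^sup>2 \<partial>lborel)"
      using integral_partial_test[OF test_mult[OF test_partial[OF \<phi>] test_smooth[OF \<phi>]], of i i] by simp
    also have "\<dots> = (\<integral>x. partials [i, i] \<phi> x * \<phi> x \<partial>lborel) + D i"
      unfolding D_def by (rule Bochner_Integration.integral_add[OF int2 int1])
    finally show ?thesis by simp
  qed
  have "l2_of (test_laplacian \<phi>) \<bullet> l2_of \<phi> = (\<integral>x. test_laplacian \<phi> x * \<phi> x \<partial>lebesgue)"
    by (simp add: inner_l2_of test_L2 test_laplacian_test \<phi> L2_inner_def)
  also have "\<dots> = (\<integral>x. test_laplacian \<phi> x * \<phi> x \<partial>lborel)"
    using test_measurable[OF \<phi>] test_measurable[OF test_laplacian_test[OF \<phi>]] by (intro integral_completion) simp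
  also have "\<dots> = (\<Sum>i\<in>UNIV. \<integral>x. partials [i, i] \<phi> x * \<phi> x \<partial>lborel)"
    unfolding test_laplacian_def sum_distrib_right by (rule Bochner_Integration.integral_sum[OF int2])
  finally have eq: "- (l2_of (test_laplacian \<phi>) \<bullet> l2_of \<phi>) = (\<Sum>i\<in>UNIV. D i)"
    by (simp add: parts sum_negf)
  have D0: "D i \<ge> 0" for i unfolding D_def by simp
  show "- (l2_of (test_laplacian \<phi>) \<bullet> l2_of \<phi>) \<ge> 0" unfolding eq by (intro sum_nonneg D0)
  have "(\<integral>\<^sup>+x. ennreal ((partial i \<phi> x)\<^sup>2) \<partial>lborel) = ennreal (D i)" for i
    unfolding D_def by (rule nn_integral_eq_integral[OF int1]) simp
  then show "(\<Sum>i\<in>UNIV. \<integral>\<^sup>+x. ennreal ((partial i \<phi> x)\<^sup>2) \<partial>lborel) = ennreal (- (l2_of (test_laplacian \<phi>) \<bullet> l2_of \<phi>))"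
    unfolding eq by (simp add: sum_ennreal D0)
qed

text \<open>
  With \<open>G\<close> the Dirichlet integral and \<open>N\<close> the squared norm of \<open>\<phi>\<close>, the left side \<open>y\<close> satisfies
  \<open>y\<^sup>4 \<le> K N G\<^sup>3\<close>, and \<open>K N G\<^sup>3 \<le> (G + K N)\<^sup>4\<close>.
\<close>

lemma form_bound_test:
  fixes W :: "real^3 \<Rightarrow> real"
  assumes W: "W \<in> L2"
  shows "\<exists>K\<ge>0. \<forall>\<phi>\<in>test_functions. (\<integral>\<^sup>+x. ennreal (\<bar>W x\<bar> * (\<phi> x)\<^sup>2) \<partial>lebesgue)
    \<le> ennreal (- (l2_of (test_laplacian \<phi>) \<bullet> l2_of \<phi>) + K * (norm (l2_of \<phi>))\<^sup>2)"
proof -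
  define \<omega> where "\<omega> = (norm (l2_of W))\<^sup>2"
  define K where "K = 64 * \<omega>\<^sup>2"
  have \<omega>0: "\<omega> \<ge> 0" and K0: "K \<ge> 0" by (simp_all add: \<omega>_def K_def)
  note [measurable] = L2_measurable[OF W]
  have "(\<integral>\<^sup>+x. ennreal (\<bar>W x\<bar> * (\<phi> x)\<^sup>2) \<partial>lebesgue)
    \<le> ennreal (- (l2_of (test_laplacian \<phi>) \<bullet> l2_of \<phi>) + K * (norm (l2_of \<phi>))\<^sup>2)" if \<phi>: "\<phi> \<in> test_functions" for \<phi>
  proof -
    note [measurable] = test_measurable_lebesgue[OF \<phi>]
    define y where "y = (\<integral>\<^sup>+x. ennreal (\<bar>W x\<bar> * (\<phi> x)\<^sup>2) \<partial>lebesgue)"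
    define G where "G = - (l2_of (test_laplacian \<phi>) \<bullet> l2_of \<phi>)"
    define N where "N = (norm (l2_of \<phi>))\<^sup>2"
    have G0: "G \<ge> 0" unfolding G_def by (rule dirichlet_integral_test(2)[OF \<phi>])
    have N0: "N \<ge> 0" by (simp add: N_def)
    have N: "(\<integral>\<^sup>+x. ennreal ((\<phi> x)\<^sup>2) \<partial>lborel) = ennreal N"
      using nn_integral_L2[OF test_L2[OF \<phi>]] by (simp add: N_def nn_integral_completion)
    define Q where "Q = (\<integral>\<^sup>+x. ennreal ((\<phi> x)^4) \<partial>lborel)"
    have Q: "Q\<^sup>2 \<le> ennreal (64 * (N * G^3))"
      using ladyzhenskaya[OF \<phi>] G0 N0
      unfolding dirichlet_integral_test(1)[OF \<phi>] N Q_def[symmetric] G_def[symmetric]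
      by (simp add: ennreal_mult ennreal_power)
    have "y = (\<integral>\<^sup>+x. ennreal \<bar>W x\<bar> * ennreal ((\<phi> x)\<^sup>2) \<partial>lebesgue)"
      unfolding y_def by (simp add: ennreal_mult)
    also have "(\<dots>)\<^sup>2 \<le> (\<integral>\<^sup>+x. (ennreal \<bar>W x\<bar>)\<^sup>2 \<partial>lebesgue) * (\<integral>\<^sup>+x. (ennreal ((\<phi> x)\<^sup>2))\<^sup>2 \<partial>lebesgue)"
      by (rule Cauchy_Schwarz_nn_integral) measurable
    also have "(\<integral>\<^sup>+x. (ennreal \<bar>W x\<bar>)\<^sup>2 \<partial>lebesgue) = ennreal \<omega>"
      using nn_integral_L2[OF W] by (simp add: ennreal_power \<omega>_def)
    also have "(\<integral>\<^sup>+x. (ennreal ((\<phi> x)\<^sup>2))\<^sup>2 \<partial>lebesgue) = Q"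
      by (simp add: Q_def nn_integral_completion ennreal_power)
    finally have y2: "y\<^sup>2 \<le> ennreal \<omega> * Q" .
    have "(y\<^sup>2)\<^sup>2 \<le> (ennreal \<omega> * Q)\<^sup>2" by (rule power_mono[OF y2]) simp
    also have "\<dots> = ennreal (\<omega>\<^sup>2) * Q\<^sup>2" by (simp add: power_mult_distrib ennreal_power \<omega>0)
    also have "\<dots> \<le> ennreal (\<omega>\<^sup>2) * ennreal (64 * (N * G^3))" by (rule mult_left_mono[OF Q]) simp
    also have "\<dots> = ennreal (K * N * G^3)" 
      using G0 N0 by (subst ennreal_mult[symmetric]) (auto simp: K_def mult_ac)
    also have "K * N * G^3 \<le> ((G + K * N)\<^sup>2)\<^sup>2"
    proof -
      have "K * N * G^3 \<le> (G + K * N) * (G + K * N)^3"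
        using G0 K0 N0 by (intro mult_mono power_mono) auto
      also have "\<dots> = ((G + K * N)\<^sup>2)\<^sup>2" by (simp add: power2_eq_square power3_eq_cube mult_ac)
      finally show ?thesis .
    qed
    then have "ennreal (K * N * G^3) \<le> ennreal (((G + K * N)\<^sup>2)\<^sup>2)" by (rule ennreal_leI)
    also have "\<dots> = ((ennreal (G + K * N))\<^sup>2)\<^sup>2"
      using G0 K0 N0 by (simp only: ennreal_power add_nonneg_nonneg mult_nonneg_nonneg zero_le_power2)
    finally have "y \<le> ennreal (G + K * N)" 
    by (rule ennreal_power2_le_imp_le[OF ennreal_power2_le_imp_le])
    then show ?thesis unfolding y_def G_def N_def .
  qed
  then show ?thesis using K0 by blast
qed

section \<open>Nonlinearities with bounded difference quotients\<close>

text \<open>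
  The supremum over a punctured neighbourhood decreases with its radius, so its limit at 0 exists
  and is its infimum.
\<close>

lemma upper_D2_less:
  assumes "upper_D2 f x t < c"
  obtains \<eta> where "\<eta> > 0" "\<And>s. 0 < \<bar>s - t\<bar> \<Longrightarrow> \<bar>s - t\<bar> < \<eta> \<Longrightarrow> ereal ((f x s - f x t) / (s - t)) < c"
proof -
  define Q where "Q \<eta> = (SUP s\<in>{s. 0 < \<bar>s - t\<bar> \<and> \<bar>s - t\<bar> < \<eta>}. ereal ((f x s - f x t) / (s - t)))" for \<eta>
  have mono: "Q \<eta> \<le> Q \<eta>'" if "\<eta> \<le> \<eta>'" for \<eta> \<eta>' unfolding Q_def by (rule SUP_subset_mono) (use that in auto)
  define l where "l = (INF \<eta>\<in>{0<..}. Q \<eta>)"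
  have "(Q \<longlongrightarrow> l) (at_right 0)"
  proof (rule order_tendstoI)
    fix a assume "a < l"
    then have "a < Q \<eta>" if "\<eta> > 0" for \<eta>
      using that unfolding l_def by (metis INF_lower greaterThan_iff less_le_trans)
    then show "\<forall>\<^sub>F \<eta> in at_right 0. a < Q \<eta>" by (rule eventually_mono[OF eventually_at_right_less])
  next
    fix a assume "l < a"
    then obtain \<eta>0 where \<eta>0: "\<eta>0 > 0" "Q \<eta>0 < a" unfolding l_def INF_less_iff by auto
    have "\<forall>\<^sub>F \<eta> in at_right 0. \<eta> \<in> {0<..<\<eta>0}" by (rule eventually_at_right_real[OF \<eta>0(1)])
    then show "\<forall>\<^sub>F \<eta> in at_right 0. Q \<eta> < a"
      by (rule eventually_mono) (use le_less_trans[OF mono \<eta>0(2)] in auto)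
  qed
  then have "upper_D2 f x t = l"
    unfolding upper_D2_def Q_def[symmetric] by (intro tendsto_Lim) simp
  then have "l < c" using assms by simp
  then obtain \<eta> where "\<eta> > 0" "Q \<eta> < c" unfolding l_def INF_less_iff by auto
  moreover have "ereal ((f x s - f x t) / (s - t)) \<le> Q \<eta>" if "0 < \<bar>s - t\<bar>" "\<bar>s - t\<bar> < \<eta>" for s
    unfolding Q_def by (rule SUP_upper) (use that in simp)
  ultimately show ?thesis using that by (meson le_less_trans)
qed

lemma lower_D2_greater:
  assumes "c < lower_D2 f x t"
  obtains \<eta> where "\<eta> > 0" "\<And>s. 0 < \<bar>s - t\<bar> \<Longrightarrow> \<bar>s - t\<bar> < \<eta> \<Longrightarrow> c < ereal ((f x s - f x t) / (s - t))"
proof -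
  define Q where "Q \<eta> = (INF s\<in>{s. 0 < \<bar>s - t\<bar> \<and> \<bar>s - t\<bar> < \<eta>}. ereal ((f x s - f x t) / (s - t)))" for \<eta>
  have mono: "Q \<eta>' \<le> Q \<eta>" if "\<eta> \<le> \<eta>'" for \<eta> \<eta>' unfolding Q_def by (rule INF_superset_mono) (use that in auto)
  define l where "l = (SUP \<eta>\<in>{0<..}. Q \<eta>)"
  have "(Q \<longlongrightarrow> l) (at_right 0)"
  proof (rule order_tendstoI)
    fix a assume "l < a"
    then have "Q \<eta> < a" if "\<eta> > 0" for \<eta>
      using that unfolding l_def by (metis SUP_upper greaterThan_iff le_less_trans)
    then show "\<forall>\<^sub>F \<eta> in at_right 0. Q \<eta> < a" by (rule eventually_mono[OF eventually_at_right_less])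
  next
    fix a assume "a < l"
    then obtain \<eta>0 where \<eta>0: "\<eta>0 > 0" "a < Q \<eta>0" unfolding l_def less_SUP_iff by auto
    have "\<forall>\<^sub>F \<eta> in at_right 0. \<eta> \<in> {0<..<\<eta>0}" by (rule eventually_at_right_real[OF \<eta>0(1)])
    then show "\<forall>\<^sub>F \<eta> in at_right 0. a < Q \<eta>"
      by (rule eventually_mono) (use less_le_trans[OF \<eta>0(2) mono] in auto)
  qed
  then have "lower_D2 f x t = l"
    unfolding lower_D2_def Q_def[symmetric] by (intro tendsto_Lim) simp
  then have "c < l" using assms by simp
  then obtain \<eta> where "\<eta> > 0" "c < Q \<eta>" unfolding l_def less_SUP_iff by auto
  moreover have "Q \<eta> \<le> ereal ((f x s - f x t) / (s - t))" if "0 < \<bar>s - t\<bar>" "\<bar>s - t\<bar> < \<eta>" for s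
    unfolding Q_def by (rule INF_lower) (use that in simp)
  ultimately show ?thesis using that by (meson less_le_trans)
qed

text \<open>
  A bisection argument: the inequality for intervals is additive, and it holds for all short
  intervals around each point.
\<close>

lemma increment_le_of_local:
  fixes g :: "real \<Rightarrow> real"
  assumes loc: "\<And>t. \<exists>\<eta>>0. \<forall>s. 0 < \<bar>s - t\<bar> \<longrightarrow> \<bar>s - t\<bar> < \<eta> \<longrightarrow> (g s - g t) / (s - t) \<le> c" and "a \<le> b"
  shows "g b - g a \<le> c * (b - a)"
  using \<open>a \<le> b\<close>
proof (induction rule: Bolzano)
  case (trans a b d)
  then show ?case by (simp add: algebra_simps)
next
  case (local x)
  obtain \<eta> where \<eta>: "\<eta> > 0" "\<And>s. 0 < \<bar>s - x\<bar> \<Longrightarrow> \<bar>s - x\<bar> < \<eta> \<Longrightarrow> (g s - g x) / (s - x) \<le> c" using loc[of x] by blast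
  have "g b - g a \<le> c * (b - a)" if "a \<le> x" "x \<le> b" "b - a < \<eta>" for a b
  proof -
    have "g b - g x \<le> c * (b - x)"
    proof (cases "b = x")
      case False
      then have "b - x > 0" using that by simp
      then show ?thesis using \<eta>(2)[of b] that by (simp add: pos_divide_le_eq)
    qed simp
    moreover have "g x - g a \<le> c * (x - a)"
    proof (cases "a = x")
      case False
      then have "a - x < 0" using that by simp
      then show ?thesis using \<eta>(2)[of a] that by (simp add: neg_divide_le_eq algebra_simps)
    qed simp
    ultimately show ?thesis by (simp add: algebra_simps)
  qed
  then show ?case using \<eta>(1) by blast
qed

lemma increment_le_of_upper_D2:
  assumes ub: "\<And>t. upper_D2 f x t \<le> ereal c" and "a \<le> b"
  shows "f x b - f x a \<le> c * (b - a)"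
proof (rule field_le_epsilon)
  fix e :: real assume "e > 0"
  define e' where "e' = e / (b - a + 1)"
  have e': "e' > 0" using \<open>e > 0\<close> \<open>a \<le> b\<close> by (simp add: e'_def)
  have "f x b - f x a \<le> (c + e') * (b - a)"
  proof (rule increment_le_of_local[OF _ \<open>a \<le> b\<close>])
    fix t
    have "upper_D2 f x t < ereal (c + e')"
      by (rule le_less_trans[OF ub]) (use e' in simp)
    from upper_D2_less[OF this]
    show "\<exists>\<eta>>0. \<forall>s. 0 < \<bar>s - t\<bar> \<longrightarrow> \<bar>s - t\<bar> < \<eta> \<longrightarrow> (f x s - f x t) / (s - t) \<le> c + e'"
      unfolding less_ereal.simps by (metis less_imp_le)
  qed
  moreover have "e' * (b - a) \<le> e" using \<open>e > 0\<close> \<open>a \<le> b\<close> by (simp add: e'_def field_simps)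
  ultimately show "f x b - f x a \<le> c * (b - a) + e" by (simp add: distrib_right)
qed

lemma increment_ge_of_lower_D2:
  assumes lb: "\<And>t. ereal c \<le> lower_D2 f x t" and "a \<le> b"
  shows "c * (b - a) \<le> f x b - f x a"
proof (rule field_le_epsilon)
  fix e :: real assume "e > 0"
  define e' where "e' = e / (b - a + 1)"
  have e': "e' > 0" using \<open>e > 0\<close> \<open>a \<le> b\<close> by (simp add: e'_def)
  have "- f x b - - f x a \<le> (- c + e') * (b - a)"
  proof (rule increment_le_of_local[OF _ \<open>a \<le> b\<close>])
    fix t
    have "ereal (c - e') < lower_D2 f x t"
      by (rule less_le_trans[OF _ lb]) (use e' in simp)
    from lower_D2_greater[OF this]
    obtain \<eta> where \<eta>: "\<eta> > 0" "\<And>s. 0 < \<bar>s - t\<bar> \<Longrightarrow> \<bar>s - t\<bar> < \<eta> \<Longrightarrow> c - e' < (f x s - f x t) / (s - t)"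
      unfolding less_ereal.simps by metis
    have "(- f x s - - f x t) / (s - t) \<le> - c + e'" if "0 < \<bar>s - t\<bar>" "\<bar>s - t\<bar> < \<eta>" for s
    proof -
      have "(- f x s - - f x t) / (s - t) = - ((f x s - f x t) / (s - t))"
        by (simp add: diff_divide_distrib)
      then show ?thesis using \<eta>(2)[OF that] by simp
    qed
    then show "\<exists>\<eta>>0. \<forall>s. 0 < \<bar>s - t\<bar> \<longrightarrow> \<bar>s - t\<bar> < \<eta> \<longrightarrow> (- f x s - - f x t) / (s - t) \<le> - c + e'"
      using \<eta>(1) by blast
  qed
  moreover have "e' * (b - a) \<le> e" using \<open>e > 0\<close> \<open>a \<le> b\<close> by (simp add: e'_def field_simps)
  ultimately show "c * (b - a) \<le> f x b - f x a + e" by (simp add: algebra_simps)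
qed

lemma centred_lipschitz:
  fixes g :: "real \<Rightarrow> real"
  assumes "\<And>a b. a \<le> b \<Longrightarrow> \<beta> * (b - a) \<le> g b - g a" "\<And>a b. a \<le> b \<Longrightarrow> g b - g a \<le> \<gamma> * (b - a)"
  shows "\<bar>(g s - (\<beta> + \<gamma>) / 2 * s) - (g t - (\<beta> + \<gamma>) / 2 * t)\<bar> \<le> (\<gamma> - \<beta>) / 2 * \<bar>s - t\<bar>"
proof -
  have *: "\<bar>(g b - (\<beta> + \<gamma>) / 2 * b) - (g a - (\<beta> + \<gamma>) / 2 * a)\<bar> \<le> (\<gamma> - \<beta>) / 2 * (b - a)" if "a \<le> b" for a b
    using assms(1)[OF that] assms(2)[OF that] by (simp add: abs_le_iff field_simps)
  show ?thesis
  proof (cases "t \<le> s")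
    case True
    then show ?thesis using *[OF True] by simp
  next
    case False
    then show ?thesis using *[of s t] by (simp add: abs_minus_commute)
  qed
qed

text \<open>
  Replace \<open>u\<close> by functions with countably many values, for which measurability in the first argument
  suffices, and pass to the limit with continuity in the second.
\<close>

lemma caratheodory_measurable:
  fixes f :: "'a::euclidean_space \<Rightarrow> real \<Rightarrow> real"
  assumes f: "caratheodory f" and u [measurable]: "u \<in> borel_measurable lebesgue"
  shows "(\<lambda>x. f x (u x)) \<in> borel_measurable lebesgue"
proof -
  define s where "s n x = real_of_int \<lfloor>real (Suc n) * u x\<rfloor> / real (Suc n)" for n x
  have [measurable]: "(\<lambda>x. f x (s n x)) \<in> borel_measurable lebesgue" for n
  proof -
    have "(\<lambda>x. f x (real_of_int \<lfloor>real (Suc n) * u x\<rfloor> / real (Suc n))) \<in> borel_measurable lebesgue"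
    proof (rule measurable_compose_countable[where f = "\<lambda>i x. f x (real_of_int i / real (Suc n))"
          and g = "\<lambda>x. \<lfloor>real (Suc n) * u x\<rfloor>"])
      show "(\<lambda>x. f x (real_of_int i / real (Suc n))) \<in> borel_measurable lebesgue" for i :: int
        using f by (simp add: caratheodory_def)
      show "(\<lambda>x. \<lfloor>real (Suc n) * u x\<rfloor>) \<in> lebesgue \<rightarrow>\<^sub>M count_space UNIV" by measurable
    qed
    then show ?thesis by (simp add: s_def)
  qed
  have s: "(\<lambda>n. s n x) \<longlonglongrightarrow> u x" for x
  proof (rule LIM_zero_cancel, rule Lim_null_comparison)
    have "norm (s n x - u x) \<le> inverse (real (Suc n))" for n
    proof -
      have "\<bar>real_of_int \<lfloor>real (Suc n) * u x\<rfloor> - real (Suc n) * u x\<bar> \<le> 1" by linarith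
      moreover have "s n x - u x = (real_of_int \<lfloor>real (Suc n) * u x\<rfloor> - real (Suc n) * u x) / real (Suc n)"
        by (simp add: s_def field_simps del: of_nat_Suc)
      ultimately show ?thesis by (simp add: inverse_eq_divide divide_right_mono del: of_nat_Suc)
    qed
    then show "\<forall>\<^sub>F n in sequentially. norm (s n x - u x) \<le> inverse (real (Suc n))" by simp
  qed (rule LIMSEQ_inverse_real_of_nat)
  have "(\<lambda>x. lim (\<lambda>n. f x (s n x))) \<in> borel_measurable lebesgue"
    by (rule borel_measurable_lim_metric) measurable
  then show ?thesis
  proof (rule borel_measurable_AE)
    have "AE x in lebesgue. continuous_on UNIV (f x)" using f by (simp add: caratheodory_def)
    then show "AE x in lebesgue. lim (\<lambda>n. f x (s n x)) = f x (u x)"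
    proof eventually_elim
      case (elim x)
      have "(\<lambda>n. f x (s n x)) \<longlonglongrightarrow> f x (u x)"
        by (rule continuous_on_tendsto_compose[OF elim s]) auto
      then show ?case by (rule limI)
    qed
  qed
qed

section \<open>Symmetry and semiboundedness\<close>

lemma weak_laplacian_approx_sequence:
  fixes u w :: "real^'n::finite \<Rightarrow> real"
  assumes W: "weak_laplacian u w"
  obtains \<phi> :: "nat \<Rightarrow> real^'n \<Rightarrow> real" where "\<And>n. \<phi> n \<in> test_functions"
    "(\<lambda>n. l2_of (\<phi> n)) \<longlonglongrightarrow> l2_of u" "(\<lambda>n. l2_of (test_laplacian (\<phi> n))) \<longlonglongrightarrow> l2_of w"
proof -
  have "\<forall>n. \<exists>\<phi>\<in>test_functions. norm (l2_of \<phi> - l2_of u) < inverse (real (Suc n))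
      \<and> norm (l2_of (test_laplacian \<phi>) - l2_of w) < inverse (real (Suc n))"
    by (intro allI weak_laplacian_approx[OF W]) simp
  then obtain \<phi> where \<phi>: "\<And>n. \<phi> n \<in> test_functions"
    "\<And>n. norm (l2_of (\<phi> n) - l2_of u) < inverse (real (Suc n))"
    "\<And>n. norm (l2_of (test_laplacian (\<phi> n)) - l2_of w) < inverse (real (Suc n))" by metis
  have "(\<lambda>n. l2_of (\<phi> n)) \<longlonglongrightarrow> l2_of u"
    by (rule LIM_zero_cancel[OF Lim_null_comparison[OF _ LIMSEQ_inverse_real_of_nat]])
      (intro always_eventually allI less_imp_le \<phi>)
  moreover have "(\<lambda>n. l2_of (test_laplacian (\<phi> n))) \<longlonglongrightarrow> l2_of w"
    by (rule LIM_zero_cancel[OF Lim_null_comparison[OF _ LIMSEQ_inverse_real_of_nat]])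
      (intro always_eventually allI less_imp_le \<phi>)
  ultimately show ?thesis using that \<phi>(1) by blast
qed

text \<open>
  For a test function in place of \<open>u'\<close> the identity is the definition of \<^const>\<open>weak_laplacian\<close>, and
  both sides are continuous in the pair of \<open>u'\<close> and \<open>w'\<close>.
\<close>

theorem weak_laplacian_symmetric:
  fixes u w u' w' :: "real^'n::finite \<Rightarrow> real"
  assumes W: "weak_laplacian u w" and W': "weak_laplacian u' w'"
  shows "l2_of w \<bullet> l2_of u' = l2_of u \<bullet> l2_of w'"
proof -
  obtain \<phi> where \<phi>: "\<And>n. \<phi> n \<in> test_functions"
    "(\<lambda>n. l2_of (\<phi> n)) \<longlonglongrightarrow> l2_of u'" "(\<lambda>n. l2_of (test_laplacian (\<phi> n))) \<longlonglongrightarrow> l2_of w'"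
    using weak_laplacian_approx_sequence[OF W'] by metis
  have L: "u \<in> L2" "w \<in> L2" using W by (simp_all add: weak_laplacian_def)
  have "l2_of w \<bullet> l2_of (\<phi> n) = l2_of u \<bullet> l2_of (test_laplacian (\<phi> n))" for n
  proof -
    have "(\<integral>x. test_laplacian (\<phi> n) x * u x \<partial>lebesgue) = (\<integral>x. \<phi> n x * w x \<partial>lebesgue)"
      using W \<phi>(1) by (simp add: weak_laplacian_def)
    then show ?thesis
      by (simp add: inner_l2_of L test_L2 \<phi>(1) test_laplacian_test L2_inner_def mult.commute)
  qed
  then have "(\<lambda>n. l2_of w \<bullet> l2_of (\<phi> n)) \<longlonglongrightarrow> l2_of u \<bullet> l2_of w'"
    by (simp only:) (intro tendsto_intros \<phi>)
  moreover have "(\<lambda>n. l2_of w \<bullet> l2_of (\<phi> n)) \<longlonglongrightarrow> l2_of w \<bullet> l2_of u'"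
    by (intro tendsto_intros \<phi>)
  ultimately show ?thesis by (rule LIMSEQ_unique[symmetric])
qed

text \<open>
  Fatou's lemma carries the estimate from test functions to their limits, as a subsequence converges
  almost everywhere.
\<close>

theorem form_bound:
  fixes W :: "real^3 \<Rightarrow> real"
  assumes W: "W \<in> L2"
  shows "\<exists>K\<ge>0. \<forall>u w. weak_laplacian u w \<longrightarrow>
    (\<integral>\<^sup>+x. ennreal (\<bar>W x\<bar> * (u x)\<^sup>2) \<partial>lebesgue) \<le> ennreal (- (l2_of w \<bullet> l2_of u) + K * (norm (l2_of u))\<^sup>2)"
proof -
  obtain K where K: "K \<ge> 0" and bound: "\<And>\<phi>. \<phi> \<in> test_functions \<Longrightarrow> (\<integral>\<^sup>+x. ennreal (\<bar>W x\<bar> * (\<phi> x)\<^sup>2) \<partial>lebesgue)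
    \<le> ennreal (- (l2_of (test_laplacian \<phi>) \<bullet> l2_of \<phi>) + K * (norm (l2_of \<phi>))\<^sup>2)"
    using form_bound_test[OF W] by blast
  note [measurable] = L2_measurable[OF W]
  have "(\<integral>\<^sup>+x. ennreal (\<bar>W x\<bar> * (u x)\<^sup>2) \<partial>lebesgue) \<le> ennreal (- (l2_of w \<bullet> l2_of u) + K * (norm (l2_of u))\<^sup>2)"
    if uw: "weak_laplacian u w" for u w
  proof -
    obtain \<phi> where \<phi>: "\<And>n. \<phi> n \<in> test_functions"
      "(\<lambda>n. l2_of (\<phi> n)) \<longlonglongrightarrow> l2_of u" "(\<lambda>n. l2_of (test_laplacian (\<phi> n))) \<longlonglongrightarrow> l2_of w"
      using weak_laplacian_approx_sequence[OF uw] by metis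
    have u: "u \<in> L2" using uw by (simp add: weak_laplacian_def)
    note [measurable] = test_measurable_lebesgue[OF \<phi>(1)]
    have diff: "(\<lambda>x. \<phi> n x - u x) \<in> L2" for n by (rule L2_diff[OF test_L2[OF \<phi>(1)] u])
    have "(\<lambda>n. (norm (l2_of (\<phi> n) - l2_of u))\<^sup>2) \<longlonglongrightarrow> (norm (l2_of u - l2_of u))\<^sup>2"
      by (intro tendsto_intros \<phi>)
    then have lim: "(\<lambda>n. \<integral>x. norm ((norm (\<phi> n x - u x))\<^sup>2) \<partial>lebesgue) \<longlonglongrightarrow> 0"
      unfolding l2_of_diff[OF test_L2[OF \<phi>(1)] u] power2_norm_l2_of[OF diff] by simp
    obtain r where r: "strict_mono r" and ae: "AE x in lebesgue. (\<lambda>n. (norm (\<phi> (r n) x - u x))\<^sup>2) \<longlonglongrightarrow> 0"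
      using tendsto_L1_AE_subseq[OF L2_integrable_square[OF diff] lim] by auto
    have "(\<integral>\<^sup>+x. ennreal (\<bar>W x\<bar> * (u x)\<^sup>2) \<partial>lebesgue)
      = (\<integral>\<^sup>+x. liminf (\<lambda>n. ennreal (\<bar>W x\<bar> * (\<phi> (r n) x)\<^sup>2)) \<partial>lebesgue)"
    proof (rule nn_integral_cong_AE)
      show "AE x in lebesgue. ennreal (\<bar>W x\<bar> * (u x)\<^sup>2) = liminf (\<lambda>n. ennreal (\<bar>W x\<bar> * (\<phi> (r n) x)\<^sup>2))"
        using ae
      proof eventually_elim
        case (elim x)
        then have "(\<lambda>n. sqrt ((norm (\<phi> (r n) x - u x))\<^sup>2)) \<longlonglongrightarrow> sqrt 0" by (rule tendsto_real_sqrt)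
        then have "(\<lambda>n. norm (\<phi> (r n) x - u x)) \<longlonglongrightarrow> 0" by simp
        then have "(\<lambda>n. \<phi> (r n) x) \<longlonglongrightarrow> u x" by (rule LIM_zero_cancel[OF tendsto_norm_zero_cancel])
        then have "(\<lambda>n. ennreal (\<bar>W x\<bar> * (\<phi> (r n) x)\<^sup>2)) \<longlonglongrightarrow> ennreal (\<bar>W x\<bar> * (u x)\<^sup>2)"
          by (intro tendsto_ennrealI tendsto_mult tendsto_const tendsto_power)
        then show ?case by (rule lim_imp_Liminf[OF trivial_limit_sequentially, symmetric])
      qed
    qed
    also have "\<dots> \<le> liminf (\<lambda>n. \<integral>\<^sup>+x. ennreal (\<bar>W x\<bar> * (\<phi> (r n) x)\<^sup>2) \<partial>lebesgue)"
      by (rule nn_integral_liminf) measurable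
    also have "\<dots> \<le> liminf (\<lambda>n. ennreal (- (l2_of (test_laplacian (\<phi> (r n))) \<bullet> l2_of (\<phi> (r n))) + K * (norm (l2_of (\<phi> (r n))))\<^sup>2))"
      by (intro Liminf_mono always_eventually allI bound \<phi>)
    also have "\<dots> = ennreal (- (l2_of w \<bullet> l2_of u) + K * (norm (l2_of u))\<^sup>2)"
    proof (rule lim_imp_Liminf[OF trivial_limit_sequentially])
      have "(\<lambda>n. ennreal (- (l2_of (test_laplacian (\<phi> n)) \<bullet> l2_of (\<phi> n)) + K * (norm (l2_of (\<phi> n)))\<^sup>2))
        \<longlonglongrightarrow> ennreal (- (l2_of w \<bullet> l2_of u) + K * (norm (l2_of u))\<^sup>2)"
        by (intro tendsto_ennrealI tendsto_add tendsto_minus tendsto_inner tendsto_mult tendsto_const tendsto_power tendsto_norm \<phi>)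
      from LIMSEQ_subseq_LIMSEQ[OF this r]
      show "(\<lambda>n. ennreal (- (l2_of (test_laplacian (\<phi> (r n))) \<bullet> l2_of (\<phi> (r n))) + K * (norm (l2_of (\<phi> (r n))))\<^sup>2))
        \<longlonglongrightarrow> ennreal (- (l2_of w \<bullet> l2_of u) + K * (norm (l2_of u))\<^sup>2)" by (simp add: o_def)
    qed
    finally show ?thesis .
  qed
  then show ?thesis using K by blast
qed

section \<open>The Schroedinger operator\<close>

lemma weak_laplacian_component:
  fixes u :: "real^'n::finite \<Rightarrow> complex" and T :: "complex \<Rightarrow> real"
  assumes T: "bounded_linear T" and u: "u \<in> sobolev_H 2"
  shows "weak_laplacian (\<lambda>x. T (u x)) (\<lambda>x. T (laplacian u x))"
proof -
  have W: "weak_laplacian (\<lambda>x. T (u x)) (laplacian (\<lambda>x. T (u x)))"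
    by (rule weak_laplacian_laplacian[OF sobolev_bounded_linear[OF T u]])
  have lap: "(\<lambda>x. T (laplacian u x)) \<in> L2" by (rule L2_bounded_linear[OF T laplacian_L2[OF u]])
  have lap': "laplacian (\<lambda>x. T (u x)) \<in> L2" using W by (simp add: weak_laplacian_def)
  have "(\<integral>x. \<phi> x * laplacian (\<lambda>x. T (u x)) x \<partial>lebesgue) = (\<integral>x. \<phi> x * T (laplacian u x) \<partial>lebesgue)"
    if "\<phi> \<in> test_functions" for \<phi>
  proof (rule integral_cong_AE)
    note [measurable] = test_measurable_lebesgue[OF that] L2_measurable[OF lap] L2_measurable[OF lap']
    show "(\<lambda>x. \<phi> x * laplacian (\<lambda>x. T (u x)) x) \<in> borel_measurable lebesgue" by measurable
    show "(\<lambda>x. \<phi> x * T (laplacian u x)) \<in> borel_measurable lebesgue" by measurable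
    show "AE x in lebesgue. \<phi> x * laplacian (\<lambda>x. T (u x)) x = \<phi> x * T (laplacian u x)"
      using laplacian_bounded_linear[OF T u] by eventually_elim simp
  qed
  with W lap show ?thesis by (simp add: weak_laplacian_def)
qed

lemma schroedinger_measurable:
  assumes V: "V \<in> borel_measurable lebesgue" and u: "u \<in> sobolev_H 2"
  shows "schroedinger V u \<in> borel_measurable lebesgue"
proof -
  note [measurable] = V L2_measurable[OF sobolev_L2[OF u]] L2_measurable[OF laplacian_L2[OF u]]
  have "(\<lambda>x. complex_of_real (V x)) \<in> borel_measurable lebesgue"
    by (rule measurable_compose[OF V]) (intro borel_measurable_continuous_onI continuous_intros)
  then show ?thesis unfolding schroedinger_def by measurable
qed

text \<open>A point of the resolvent set forces the operator to map into \<open>L2\<close>: the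
  norm of a function outside \<open>L2\<close> has the value 0, so the resolvent bound would make such a \<open>u\<close> vanish.\<close>

lemma schroedinger_L2:
  assumes V: "V \<in> borel_measurable lebesgue" and z: "z \<in> schroedinger_resolvent_set V" and u: "u \<in> sobolev_H 2"
  shows "schroedinger V u \<in> L2"
proof -
  define g where "g x = schroedinger V u x - z * u x" for x
  have uL: "u \<in> L2" by (rule sobolev_L2[OF u])
  have zu: "(\<lambda>x. z * u x) \<in> L2" by (rule L2_bounded_linear[OF bounded_linear_mult_right uL])
  note Sm = schroedinger_measurable[OF V u]
  have gm: "g \<in> borel_measurable lebesgue" unfolding g_def[abs_def]
    by (intro borel_measurable_diff Sm L2_measurable[OF zu])
  show ?thesis
  proof (cases "g \<in> L2")
    case True
    from L2_add[OF this zu] show ?thesis by (simp add: g_def)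
  next
    case False
    then have "L2_norm g = 0" unfolding L2_norm_def
      using gm by (simp add: L2_def not_integrable_integral_eq)
    moreover obtain C where "\<And>u. u \<in> sobolev_H 2 \<Longrightarrow> L2_norm u \<le> C * L2_norm (\<lambda>x. schroedinger V u x - z * u x)"
      using z unfolding resolvent_set_def by blast
    ultimately have "L2_norm u \<le> 0" using u unfolding g_def[abs_def] by fastforce
    then have "norm (l2_of u) \<le> 0" by (simp add: norm_l2_of[OF uL])
    then have "l2_of u = l2_of (\<lambda>x. 0)" by simp (transfer, simp)
    then have ae: "AE x in lebesgue. u x = 0" using l2_of_eq_iff[OF uL L2_zero] by simp
    show ?thesis
    proof (rule L2_cong_AE[OF L2_zero Sm])
      show "AE x in lebesgue. 0 = schroedinger V u x"
        using ae laplacian_AE_zero[OF u ae] by eventually_elim (simp add: schroedinger_def)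
    qed
  qed
qed

definition schroedinger_graph ::
    "(real^3 \<Rightarrow> real) \<Rightarrow> ((real^3, complex) l2 \<times> (real^3, complex) l2) set" where
  "schroedinger_graph V = (\<lambda>u. (l2_of u, l2_of (schroedinger V u))) ` sobolev_H 2"

lemma graph_resolvent_iff:
  assumes SL: "\<And>u. u \<in> sobolev_H 2 \<Longrightarrow> schroedinger V u \<in> L2"
  shows "complex_of_real z \<in> schroedinger_resolvent_set V \<longleftrightarrow> z \<in> graph_resolvent_set (schroedinger_graph V)"
proof -
  let ?T = "\<lambda>u x. schroedinger V u x - complex_of_real z * u x"
  have zL: "(\<lambda>x. complex_of_real z * u x) \<in> L2" if "u \<in> L2" for u :: "real^3 \<Rightarrow> complex"
    by (rule L2_bounded_linear[OF bounded_linear_mult_right that])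
  have TL: "?T u \<in> L2" if "u \<in> sobolev_H 2" for u
    by (intro L2_diff SL that zL sobolev_L2[OF that])
  have T: "l2_of (schroedinger V u) - z *\<^sub>R l2_of u = l2_of (?T u)" if u: "u \<in> sobolev_H 2" for u
    using l2_of_diff[OF SL[OF u] zL[OF sobolev_L2[OF u]]] l2_of_scaleR[OF sobolev_L2[OF u], of z]
    by (simp add: scaleR_conv_of_real)
  have inj: "(AE x in lebesgue. ?T u x = ?T v x) \<longleftrightarrow> l2_of (?T u) = l2_of (?T v)"
    "(AE x in lebesgue. u x = v x) \<longleftrightarrow> l2_of u = l2_of v"
    if "u \<in> sobolev_H 2" "v \<in> sobolev_H 2" for u v
    using that by (simp_all only: l2_of_eq_iff TL sobolev_L2)
  have surj: "(\<forall>g\<in>L2. \<exists>u\<in>sobolev_H 2. AE x in lebesgue. ?T u x = g x) \<longleftrightarrow> (\<forall>g. \<exists>u\<in>sobolev_H 2. l2_of (?T u) = g)"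
  proof (intro iffI allI ballI)
    fix g :: "(real^3, complex) l2"
    assume A: "\<forall>g\<in>L2. \<exists>u\<in>sobolev_H 2. AE x in lebesgue. ?T u x = g x"
    obtain h where h: "h \<in> L2" "g = l2_of h" by (rule l2_of_cases)
    from bspec[OF A h(1)] obtain u where u: "u \<in> sobolev_H 2" "AE x in lebesgue. ?T u x = h x" by blast
    have "l2_of (?T u) = l2_of h" by (rule iffD2[OF l2_of_eq_iff[OF TL[OF u(1)] h(1)] u(2)])
    then show "\<exists>u\<in>sobolev_H 2. l2_of (?T u) = g" using h(2) u(1) by blast
  next
    fix g :: "real^3 \<Rightarrow> complex"
    assume A: "\<forall>g. \<exists>u\<in>sobolev_H 2. l2_of (?T u) = g" and g: "g \<in> L2"
    from A obtain u where u: "u \<in> sobolev_H 2" "l2_of (?T u) = l2_of g" by blast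
    have "AE x in lebesgue. ?T u x = g x" by (rule iffD1[OF l2_of_eq_iff[OF TL[OF u(1)] g] u(2)])
    then show "\<exists>u\<in>sobolev_H 2. AE x in lebesgue. ?T u x = g x" using u(1) by blast
  qed
  have bound: "L2_norm u \<le> C * L2_norm (?T u) \<longleftrightarrow> norm (l2_of u) \<le> C * norm (l2_of (?T u))"
    if "u \<in> sobolev_H 2" for u C
    using that by (simp only: norm_l2_of TL sobolev_L2)
  show ?thesis
    unfolding resolvent_set_def graph_resolvent_set_def schroedinger_graph_def mem_Collect_eq ball_simps bex_simps case_prod_conv surj
    by (simp only: inj bound T cong: ball_cong bex_cong)
qed

lemma inner_l2_complex:
  fixes u v :: "'a::euclidean_space \<Rightarrow> complex"
  assumes u: "u \<in> L2" and v: "v \<in> L2"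
  shows "l2_of u \<bullet> l2_of v = l2_of (\<lambda>x. Re (u x)) \<bullet> l2_of (\<lambda>x. Re (v x)) + l2_of (\<lambda>x. Im (u x)) \<bullet> l2_of (\<lambda>x. Im (v x))"
proof -
  note L = L2_bounded_linear[OF bounded_linear_Re u] L2_bounded_linear[OF bounded_linear_Re v]
    L2_bounded_linear[OF bounded_linear_Im u] L2_bounded_linear[OF bounded_linear_Im v]
  have "(\<integral>x. u x \<bullet> v x \<partial>lebesgue) = (\<integral>x. Re (u x) \<bullet> Re (v x) + Im (u x) \<bullet> Im (v x) \<partial>lebesgue)"
    by (simp add: inner_complex_def)
  also have "\<dots> = (\<integral>x. Re (u x) \<bullet> Re (v x) \<partial>lebesgue) + (\<integral>x. Im (u x) \<bullet> Im (v x) \<partial>lebesgue)"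
    by (rule Bochner_Integration.integral_add[OF L2_inner_integrable[OF L(1,2)] L2_inner_integrable[OF L(3,4)]])
  finally show ?thesis unfolding inner_l2_of[OF u v] inner_l2_of[OF L(1,2)] inner_l2_of[OF L(3,4)] L2_inner_def .
qed

lemma potential_L2:
  assumes "schroedinger V u \<in> L2" "u \<in> sobolev_H 2"
  shows "(\<lambda>x. complex_of_real (V x) * u x) \<in> L2"
  using L2_add[OF assms(1) laplacian_L2[OF assms(2)]] by (simp add: schroedinger_def)

lemma schroedinger_inner:
  assumes Su: "schroedinger V u \<in> L2" and u: "u \<in> sobolev_H 2" and v: "v \<in> L2"
  shows "l2_of (schroedinger V u) \<bullet> l2_of v = (\<integral>x. V x * (u x \<bullet> v x) \<partial>lebesgue) - l2_of (laplacian u) \<bullet> l2_of v"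
proof -
  note pot = potential_L2[OF Su u] and lap = laplacian_L2[OF u]
  have "l2_of (schroedinger V u) = l2_of (\<lambda>x. complex_of_real (V x) * u x) - l2_of (laplacian u)"
    by (simp add: l2_of_diff[OF pot lap] schroedinger_def)
  then have "l2_of (schroedinger V u) \<bullet> l2_of v = l2_of (\<lambda>x. complex_of_real (V x) * u x) \<bullet> l2_of v - l2_of (laplacian u) \<bullet> l2_of v"
    by (simp add: inner_diff_left)
  moreover have "l2_of (\<lambda>x. complex_of_real (V x) * u x) \<bullet> l2_of v = (\<integral>x. V x * (u x \<bullet> v x) \<partial>lebesgue)"
    unfolding inner_l2_of[OF pot v] L2_inner_def by (simp add: scaleR_conv_of_real[symmetric])
  ultimately show ?thesis by simp
qed

lemma schroedinger_graph_symmetric: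
  assumes SL: "\<And>u. u \<in> sobolev_H 2 \<Longrightarrow> schroedinger V u \<in> L2"
  shows "graph_symmetric (schroedinger_graph V)"
proof -
  have "l2_of (schroedinger V u) \<bullet> l2_of v = l2_of u \<bullet> l2_of (schroedinger V v)"
    if u: "u \<in> sobolev_H 2" and v: "v \<in> sobolev_H 2" for u v
  proof -
    note uL = sobolev_L2[OF u] and vL = sobolev_L2[OF v]
    have "l2_of (laplacian u) \<bullet> l2_of v = l2_of u \<bullet> l2_of (laplacian v)"
      unfolding inner_l2_complex[OF laplacian_L2[OF u] vL] inner_l2_complex[OF uL laplacian_L2[OF v]]
      using weak_laplacian_symmetric[OF weak_laplacian_component[OF bounded_linear_Re u] weak_laplacian_component[OF bounded_linear_Re v]]
        weak_laplacian_symmetric[OF weak_laplacian_component[OF bounded_linear_Im u] weak_laplacian_component[OF bounded_linear_Im v]]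
      by simp
    then show ?thesis
      using schroedinger_inner[OF SL[OF u] u vL] schroedinger_inner[OF SL[OF v] v uL]
      by (simp add: inner_commute)
  qed
  then show ?thesis unfolding graph_symmetric_def schroedinger_graph_def by auto
qed

text \<open>
  Applied to the real and the imaginary part of \<open>u\<close>, the form bound lets the Dirichlet integral absorb
  the \<open>L2\<close> part of the potential; the bounded part costs a multiple of \<open>|u|\<^sup>2\<close>.
\<close>

lemma schroedinger_graph_semibounded:
  assumes V: "V \<in> L2_plus_Linfty" and SL: "\<And>u. u \<in> sobolev_H 2 \<Longrightarrow> schroedinger V u \<in> L2"
  shows "\<exists>m. \<forall>(x, x')\<in>schroedinger_graph V. x' \<bullet> x \<ge> m * (x \<bullet> x)"
proof -
  obtain V2 Vinf where V2: "V2 \<in> L2" and Vinf: "Vinf \<in> Linfty" and V_eq: "\<And>x. V x = V2 x + Vinf x"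
    using V unfolding L2_plus_Linfty_def by blast
  obtain C0 where C0: "AE x in lebesgue. norm (Vinf x) \<le> C0" using Vinf unfolding Linfty_def by blast
  obtain K where K: "K \<ge> 0" and bound: "\<And>u w. weak_laplacian u w \<Longrightarrow>
    (\<integral>\<^sup>+x. ennreal (\<bar>V2 x\<bar> * (u x)\<^sup>2) \<partial>lebesgue) \<le> ennreal (- (l2_of w \<bullet> l2_of u) + K * (norm (l2_of u))\<^sup>2)"
    using form_bound[OF V2] by blast
  note [measurable] = L2_measurable[OF V2]
  have "- (K + \<bar>C0\<bar>) * (l2_of u \<bullet> l2_of u) \<le> l2_of (schroedinger V u) \<bullet> l2_of u" if u: "u \<in> sobolev_H 2" for u
  proof -
    note uL = sobolev_L2[OF u]
    have part: "integrable lebesgue (\<lambda>x. \<bar>V2 x\<bar> * (T (u x))\<^sup>2)"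
      "(\<integral>x. \<bar>V2 x\<bar> * (T (u x))\<^sup>2 \<partial>lebesgue)
        \<le> - (l2_of (\<lambda>x. T (laplacian u x)) \<bullet> l2_of (\<lambda>x. T (u x))) + K * (norm (l2_of (\<lambda>x. T (u x))))\<^sup>2"
      if T: "bounded_linear T" for T :: "complex \<Rightarrow> real"
    proof -
      let ?b = "- (l2_of (\<lambda>x. T (laplacian u x)) \<bullet> l2_of (\<lambda>x. T (u x))) + K * (norm (l2_of (\<lambda>x. T (u x))))\<^sup>2"
      note TL = L2_bounded_linear[OF T uL]
      note [measurable] = L2_measurable[OF TL]
      note b = bound[OF weak_laplacian_component[OF T u]]
      show int: "integrable lebesgue (\<lambda>x. \<bar>V2 x\<bar> * (T (u x))\<^sup>2)"
        by (rule integrableI_bounded) (use b in \<open>auto intro: order_le_less_trans\<close>)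
      (* ennreal sends negative numbers to 0, so the real estimate needs a bound that is known to be nonnegative *)
      have "?b \<ge> 0"
      proof -
        obtain \<phi> where \<phi>: "\<And>n. \<phi> n \<in> test_functions" "(\<lambda>n. l2_of (\<phi> n)) \<longlonglongrightarrow> l2_of (\<lambda>x. T (u x))"
          "(\<lambda>n. l2_of (test_laplacian (\<phi> n))) \<longlonglongrightarrow> l2_of (\<lambda>x. T (laplacian u x))"
          using weak_laplacian_approx_sequence[OF weak_laplacian_component[OF T u]] by metis
        have "(\<lambda>n. - (l2_of (test_laplacian (\<phi> n)) \<bullet> l2_of (\<phi> n))) \<longlonglongrightarrow> - (l2_of (\<lambda>x. T (laplacian u x)) \<bullet> l2_of (\<lambda>x. T (u x)))"
          by (intro tendsto_minus tendsto_inner \<phi>)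
        then have "0 \<le> - (l2_of (\<lambda>x. T (laplacian u x)) \<bullet> l2_of (\<lambda>x. T (u x)))"
          by (rule LIMSEQ_le_const) (use dirichlet_integral_test(2)[OF \<phi>(1)] in blast)
        moreover have "0 \<le> K * (norm (l2_of (\<lambda>x. T (u x))))\<^sup>2" using K by simp
        ultimately show ?thesis by linarith
      qed
      moreover have "ennreal (\<integral>x. \<bar>V2 x\<bar> * (T (u x))\<^sup>2 \<partial>lebesgue) \<le> ennreal ?b"
        using b by (subst (asm) nn_integral_eq_integral[OF int]) auto
      ultimately show "(\<integral>x. \<bar>V2 x\<bar> * (T (u x))\<^sup>2 \<partial>lebesgue) \<le> ?b"
        by (subst (asm) ennreal_le_iff) auto
    qed
    note re = part[OF bounded_linear_Re] and im = part[OF bounded_linear_Im]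
    have pot: "integrable lebesgue (\<lambda>x. V x * (u x \<bullet> u x))"
      using L2_inner_integrable[OF potential_L2[OF SL[OF u] u] uL] by (simp add: scaleR_conv_of_real[symmetric])
    have sq: "integrable lebesgue (\<lambda>x. \<bar>C0\<bar> * (norm (u x))\<^sup>2)"
      by (rule integrable_mult_right[OF L2_integrable_square[OF uL]])
    have "(\<integral>x. - (\<bar>V2 x\<bar> * (Re (u x))\<^sup>2 + \<bar>V2 x\<bar> * (Im (u x))\<^sup>2 + \<bar>C0\<bar> * (norm (u x))\<^sup>2) \<partial>lebesgue)
      \<le> (\<integral>x. V x * (u x \<bullet> u x) \<partial>lebesgue)"
    proof (rule integral_mono_AE)
      show "integrable lebesgue (\<lambda>x. - (\<bar>V2 x\<bar> * (Re (u x))\<^sup>2 + \<bar>V2 x\<bar> * (Im (u x))\<^sup>2 + \<bar>C0\<bar> * (norm (u x))\<^sup>2))"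
        by (intro integrable_minus Bochner_Integration.integrable_add re im sq)
      show "AE x in lebesgue. - (\<bar>V2 x\<bar> * (Re (u x))\<^sup>2 + \<bar>V2 x\<bar> * (Im (u x))\<^sup>2 + \<bar>C0\<bar> * (norm (u x))\<^sup>2) \<le> V x * (u x \<bullet> u x)"
        using C0
      proof eventually_elim
        case (elim x)
        have n: "u x \<bullet> u x = (Re (u x))\<^sup>2 + (Im (u x))\<^sup>2" "(norm (u x))\<^sup>2 = u x \<bullet> u x"
          by (simp add: inner_complex_def power2_eq_square, rule power2_norm_eq_inner)
        have "- (\<bar>V2 x\<bar> + \<bar>C0\<bar>) \<le> V x" using elim V_eq[of x] by (simp add: abs_le_iff) linarith
        then have "- (\<bar>V2 x\<bar> + \<bar>C0\<bar>) * (u x \<bullet> u x) \<le> V x * (u x \<bullet> u x)" by (rule mult_right_mono) simp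
        then show ?case unfolding n(2) by (simp add: n(1) algebra_simps)
      qed
    qed (rule pot)
    also have "(\<integral>x. - (\<bar>V2 x\<bar> * (Re (u x))\<^sup>2 + \<bar>V2 x\<bar> * (Im (u x))\<^sup>2 + \<bar>C0\<bar> * (norm (u x))\<^sup>2) \<partial>lebesgue)
      = - ((\<integral>x. \<bar>V2 x\<bar> * (Re (u x))\<^sup>2 \<partial>lebesgue) + (\<integral>x. \<bar>V2 x\<bar> * (Im (u x))\<^sup>2 \<partial>lebesgue) + \<bar>C0\<bar> * (norm (l2_of u))\<^sup>2)"
      using re(1) im(1) sq by (simp add: power2_norm_l2_of[OF uL])
    finally have lower: "- ((\<integral>x. \<bar>V2 x\<bar> * (Re (u x))\<^sup>2 \<partial>lebesgue) + (\<integral>x. \<bar>V2 x\<bar> * (Im (u x))\<^sup>2 \<partial>lebesgue) + \<bar>C0\<bar> * (norm (l2_of u))\<^sup>2)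
      \<le> (\<integral>x. V x * (u x \<bullet> u x) \<partial>lebesgue)" .
    have split_lap: "l2_of (laplacian u) \<bullet> l2_of u
      = l2_of (\<lambda>x. Re (laplacian u x)) \<bullet> l2_of (\<lambda>x. Re (u x)) + l2_of (\<lambda>x. Im (laplacian u x)) \<bullet> l2_of (\<lambda>x. Im (u x))"
      by (rule inner_l2_complex[OF laplacian_L2[OF u] uL])
    have split_norm: "(norm (l2_of u))\<^sup>2 = (norm (l2_of (\<lambda>x. Re (u x))))\<^sup>2 + (norm (l2_of (\<lambda>x. Im (u x))))\<^sup>2"
      unfolding power2_norm_eq_inner by (rule inner_l2_complex[OF uL uL])
    have "K * (norm (l2_of u))\<^sup>2 = K * (norm (l2_of (\<lambda>x. Re (u x))))\<^sup>2 + K * (norm (l2_of (\<lambda>x. Im (u x))))\<^sup>2"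
      by (simp add: split_norm distrib_left)
    then have "- (K * (norm (l2_of u))\<^sup>2) - \<bar>C0\<bar> * (norm (l2_of u))\<^sup>2 \<le> l2_of (schroedinger V u) \<bullet> l2_of u"
      unfolding schroedinger_inner[OF SL[OF u] u uL] split_lap using lower re(2) im(2) by linarith
    then show ?thesis by (simp add: power2_norm_eq_inner algebra_simps)
  qed
  then have "\<forall>(x, x')\<in>schroedinger_graph V. x' \<bullet> x \<ge> - (K + \<bar>C0\<bar>) * (x \<bullet> x)"
    unfolding schroedinger_graph_def by auto
  then show ?thesis by blast
qed

section \<open>Solving the equation\<close>

lemma norm_l2_of_mono:
  fixes u :: "'a::euclidean_space \<Rightarrow> 'b::euclidean_space" and v :: "'a \<Rightarrow> 'c::euclidean_space"
  assumes u: "u \<in> L2" and v: "v \<in> L2" and le: "AE x in lebesgue. norm (u x) \<le> C * norm (v x)" and "C \<ge> 0"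
  shows "norm (l2_of u) \<le> C * norm (l2_of v)"
proof -
  have "(norm (l2_of u))\<^sup>2 \<le> (\<integral>x. C\<^sup>2 * (norm (v x))\<^sup>2 \<partial>lebesgue)"
    unfolding power2_norm_l2_of[OF u]
  proof (rule integral_mono_AE[OF L2_integrable_square[OF u] integrable_mult_right[OF L2_integrable_square[OF v]]])
    show "AE x in lebesgue. (norm (u x))\<^sup>2 \<le> C\<^sup>2 * (norm (v x))\<^sup>2"
      using le
    proof eventually_elim
      case (elim x)
      have "(norm (u x))\<^sup>2 \<le> (C * norm (v x))\<^sup>2" by (rule power_mono[OF elim]) simp
      then show ?case by (simp add: power_mult_distrib)
    qed
  qed
  also have "\<dots> = (C * norm (l2_of v))\<^sup>2"
    by (simp add: power_mult_distrib power2_norm_l2_of[OF v])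
  finally show ?thesis by (rule power2_le_imp_le) (use \<open>C \<ge> 0\<close> in simp)
qed

text \<open>
  The fixed point equation is \<open>v = Re (R (h - N(v)))\<close> in real \<open>L2\<close>. The resolvent \<open>R\<close> acts on complex
  functions; taking the real part does not increase norms and commutes with the real operator, so the
  real part of \<open>R (h - N(v))\<close> solves the equation.
\<close>

lemma contraction_solution:
  fixes V :: "real^3 \<Rightarrow> real" and N :: "real^3 \<Rightarrow> real \<Rightarrow> real"
  assumes lin: "bounded_linear R" and R: "\<And>g. (R g, g - c *\<^sub>R R g) \<in> schroedinger_graph V"
    and norm_R: "\<And>g. norm (R g) \<le> norm g / d"
    and SL: "\<And>u. u \<in> sobolev_H 2 \<Longrightarrow> schroedinger V u \<in> L2"
    and N: "\<And>u. u \<in> borel_measurable lebesgue \<Longrightarrow> (\<lambda>x. N x (u x)) \<in> borel_measurable lebesgue"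
    and lip: "AE x in lebesgue. \<forall>s t. \<bar>N x s - N x t\<bar> \<le> q * \<bar>s - t\<bar>" and N0: "AE x in lebesgue. N x 0 = 0"
    and q: "0 \<le> q" "q < d" and h: "h \<in> L2"
  shows "\<exists>u::real^3 \<Rightarrow> real. u \<in> sobolev_H 2 \<and>
    (AE x in lebesgue. - laplacian u x + V x * u x + c * u x + N x (u x) = h x)"
proof -
  interpret R: bounded_linear R by fact
  have NL: "(\<lambda>x. N x (u x)) \<in> L2" if u: "u \<in> L2" for u
  proof (rule L2_dominated[OF u N[OF L2_measurable[OF u]]])
    show "AE x in lebesgue. norm (N x (u x)) \<le> q * norm (u x)"
      using lip N0
    proof eventually_elim
      case (elim x)
      then show ?case using elim(1)[rule_format, of "u x" 0] by simp
    qed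
  qed
  define rhs where "rhs u x = complex_of_real (h x - N x (u x))" for u x
  have rhsL: "rhs u \<in> L2" if "u \<in> L2" for u
    unfolding rhs_def[abs_def] by (rule L2_bounded_linear[OF bounded_linear_of_real L2_diff[OF h NL[OF that]]])
  have "\<exists>w. w \<in> sobolev_H 2 \<and> R g = l2_of w \<and> g - c *\<^sub>R R g = l2_of (schroedinger V w)" for g
    using R[of g] unfolding schroedinger_graph_def by blast
  then obtain w where w: "\<And>g. w g \<in> sobolev_H 2" and Rw: "\<And>g. R g = l2_of (w g)"
    and Sw: "\<And>g. g - c *\<^sub>R R g = l2_of (schroedinger V (w g))" by metis
  have "\<exists>u. u \<in> L2 \<and> v = l2_of u" for v :: "(real^3, real) l2" by (metis l2_of_cases)
  then obtain rep :: "(real^3, real) l2 \<Rightarrow> real^3 \<Rightarrow> real"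
    where rep: "\<And>v. rep v \<in> L2" "\<And>v. v = l2_of (rep v)" by metis
  define W where "W v = w (l2_of (rhs (rep v)))" for v
  have WL: "W v \<in> L2" for v unfolding W_def by (rule sobolev_L2[OF w])
  have ReW: "(\<lambda>x. Re (W v x)) \<in> L2" for v by (rule L2_bounded_linear[OF bounded_linear_Re WL])
  define \<Phi> where "\<Phi> v = l2_of (\<lambda>x. Re (W v x))" for v
  have contract: "norm (\<Phi> v - \<Phi> v') \<le> q / d * norm (v - v')" for v v'
  proof -
    have "norm (\<Phi> v - \<Phi> v') = norm (l2_of (\<lambda>x. Re (W v x) - Re (W v' x)))"
      unfolding \<Phi>_def l2_of_diff[OF ReW ReW] ..
    also have "\<dots> \<le> 1 * norm (l2_of (\<lambda>x. W v x - W v' x))"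
      by (rule norm_l2_of_mono[OF L2_diff[OF ReW ReW] L2_diff[OF WL WL]])
        (auto intro!: AE_I2 simp flip: minus_complex.simps simp: abs_Re_le_cmod)
    also have "l2_of (\<lambda>x. W v x - W v' x) = R (l2_of (rhs (rep v)) - l2_of (rhs (rep v')))"
      unfolding l2_of_diff[OF WL WL, symmetric] R.diff unfolding Rw W_def ..
    also have "norm \<dots> \<le> norm (l2_of (rhs (rep v)) - l2_of (rhs (rep v'))) / d" by (rule norm_R)
    also have "norm (l2_of (rhs (rep v)) - l2_of (rhs (rep v'))) \<le> q * norm (v - v')"
    proof -
      have "norm (l2_of (\<lambda>x. rhs (rep v) x - rhs (rep v') x)) \<le> q * norm (l2_of (\<lambda>x. rep v x - rep v' x))"
      proof (rule norm_l2_of_mono[OF L2_diff[OF rhsL[OF rep(1)] rhsL[OF rep(1)]] L2_diff[OF rep(1) rep(1)] _ q(1)])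
        show "AE x in lebesgue. norm (rhs (rep v) x - rhs (rep v') x) \<le> q * norm (rep v x - rep v' x)"
          using lip
        proof eventually_elim
          case (elim x)
          have "rhs (rep v) x - rhs (rep v') x = complex_of_real (N x (rep v' x) - N x (rep v x))"
            by (simp add: rhs_def)
          then have "norm (rhs (rep v) x - rhs (rep v') x) = \<bar>N x (rep v x) - N x (rep v' x)\<bar>"
            by (simp only: norm_of_real abs_minus_commute)
          then show ?case using elim by simp
        qed
      qed
      then show ?thesis
        using rep(2)[of v] rep(2)[of v'] l2_of_diff[OF rhsL[OF rep(1)] rhsL[OF rep(1)], of v v'] l2_of_diff[OF rep(1) rep(1), of v v']
        by simp
    qed
    finally show ?thesis using q by (simp add: divide_right_mono)
  qed
  have "\<exists>!v. \<Phi> v = v"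
  proof (rule banach_fix_type)
    show "0 \<le> q / d" "q / d < 1" using q by simp_all
    show "\<forall>v v'. dist (\<Phi> v) (\<Phi> v') \<le> q / d * dist v v'" unfolding dist_norm using contract by blast
  qed
  then obtain v where v: "\<Phi> v = v" by blast
  define u where "u x = Re (W v x)" for x
  have WH: "W v \<in> sobolev_H 2" unfolding W_def by (rule w)
  have uH: "u \<in> sobolev_H 2" unfolding u_def[abs_def] by (rule sobolev_bounded_linear[OF bounded_linear_Re WH])
  have "l2_of u = l2_of (rep v)" using v rep(2)[of v] unfolding \<Phi>_def u_def[abs_def] by simp
  then have fixed: "AE x in lebesgue. u x = rep v x"
    using l2_of_eq_iff[OF ReW[of v, folded u_def] rep(1)] by simp
  have lap: "AE x in lebesgue. laplacian u x = Re (laplacian (W v) x)"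
    unfolding u_def[abs_def] by (rule laplacian_bounded_linear[OF bounded_linear_Re WH])
  have cW: "(\<lambda>x. c *\<^sub>R W v x) \<in> L2" by (rule L2_scaleR[OF WL])
  have "l2_of (schroedinger V (W v)) = l2_of (rhs (rep v)) - c *\<^sub>R l2_of (W v)"
    unfolding W_def Sw[symmetric] Rw ..
  also have "\<dots> = l2_of (\<lambda>x. rhs (rep v) x - c *\<^sub>R W v x)"
    unfolding l2_of_scaleR[OF WL] by (rule l2_of_diff[OF rhsL[OF rep(1)] cW])
  finally have eqn: "AE x in lebesgue. schroedinger V (W v) x = rhs (rep v) x - c *\<^sub>R W v x"
    by (rule iffD1[OF l2_of_eq_iff[OF SL[OF WH] L2_diff[OF rhsL[OF rep(1)] cW]]])
  have "AE x in lebesgue. - laplacian u x + V x * u x + c * u x + N x (u x) = h x"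
    using eqn lap fixed
  proof eventually_elim
    case (elim x)
    have "Re (schroedinger V (W v) x) = Re (rhs (rep v) x - c *\<^sub>R W v x)" by (simp only: elim(1))
    then have "- Re (laplacian (W v) x) + V x * u x = h x - N x (rep v x) - c * u x"
      by (simp add: schroedinger_def rhs_def u_def)
    then show ?case using elim(2,3) by simp
  qed
  then show ?thesis using uH by blast
qed

theorem theorem3p7:
  fixes V :: "real^3 \<Rightarrow> real"
    and f :: "real^3 \<Rightarrow> real \<Rightarrow> real"
    and a :: "real^3 \<Rightarrow> real"
    and b \<alpha> \<beta> \<delta> :: real
  assumes "V \<in> L2_plus_Linfty"
    and "0 \<in> schroedinger_spectrum V"
    and "\<delta> > 0"
    and "complex_of_real ` {-\<delta><..<0} \<subseteq> schroedinger_resolvent_set V"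
    and "caratheodory f"
    and "AE x in lebesgue. f x 0 = 0"
    and "a \<in> L2"
    and "b > 0"
    and "AE x in lebesgue. \<forall>t. \<bar>f x t\<bar> \<le> a x + b * \<bar>t\<bar>"
    and "AE x in lebesgue. mono (f x)"
    and "\<alpha> > 0"
    and "\<beta> > 0"
    and "AE x in lebesgue. \<forall>t. ereal \<beta> \<le> lower_D2 f x t \<and>
           lower_D2 f x t \<le> upper_D2 f x t \<and> upper_D2 f x t \<le> ereal (1 / \<alpha>)"
    and "\<alpha> > - Inf {r. complex_of_real r \<in> schroedinger_spectrum V} / \<delta>\<^sup>2"
  shows "\<forall>h::real^3 \<Rightarrow> real. h \<in> L2 \<longrightarrow>
           (\<exists>u::real^3 \<Rightarrow> real. u \<in> sobolev_H 2 \<and>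
              (AE x in lebesgue. - laplacian u x + V x * u x + f x (u x) = h x))"
proof (intro allI impI)
  fix h :: "real^3 \<Rightarrow> real" assume h: "h \<in> L2"
  note V = assms(1) and \<delta> = assms(3) and cara = assms(5)
  have V_meas: "V \<in> borel_measurable lebesgue"
  proof -
    obtain V2 Vinf where "V2 \<in> L2" "Vinf \<in> Linfty" "\<And>x. V x = V2 x + Vinf x"
      using V unfolding L2_plus_Linfty_def by blast
    then have "V = (\<lambda>x. V2 x + Vinf x)" "V2 \<in> borel_measurable lebesgue" "Vinf \<in> borel_measurable lebesgue"
      by (auto simp: L2_def Linfty_def)
    then show ?thesis by simp
  qed
  have mem: "complex_of_real z \<in> schroedinger_resolvent_set V" if "- \<delta> < z" "z < 0" for z
    using assms(4) that by (auto simp: image_subset_iff)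
  have SL: "schroedinger V u \<in> L2" if "u \<in> sobolev_H 2" for u
    by (rule schroedinger_L2[OF V_meas mem[of "- \<delta> / 2"] that]) (use \<delta> in auto)
  note iff = graph_resolvent_iff[OF SL]
  let ?G = "schroedinger_graph V"
  define X where "X = {r. complex_of_real r \<in> schroedinger_spectrum V}"
  have X: "r \<in> X \<longleftrightarrow> r \<notin> graph_resolvent_set ?G" for r
    unfolding X_def spectrum_def using iff[of r] by simp
  have gap: "z \<in> graph_resolvent_set ?G" if "- \<delta> < z" "z < 0" for z
    using mem[OF that] iff by blast
  note sym = schroedinger_graph_symmetric[OF SL]
  have bdd: "bdd_below X"
  proof -
    obtain m where m: "\<forall>(x, x')\<in>?G. x' \<bullet> x \<ge> m * (x \<bullet> x)"
      using schroedinger_graph_semibounded[OF V SL] by blast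
    have "z \<in> graph_resolvent_set ?G" if "z < m" for z
      by (rule semibounded_resolvent[OF sym gap[of "- \<delta> / 2"] _ that]) (use \<delta> m in auto)
    then show ?thesis using X by (intro bdd_belowI[of X m]) (meson not_le)
  qed
  define \<gamma> where "\<gamma> = 1 / \<alpha>"
  have slopes: "AE x in lebesgue. \<forall>s t. s \<le> t \<longrightarrow> \<beta> * (t - s) \<le> f x t - f x s \<and> f x t - f x s \<le> \<gamma> * (t - s)"
    using assms(13)
  proof eventually_elim
    case (elim x)
    then show ?case unfolding \<gamma>_def using increment_le_of_upper_D2[of f x "1 / \<alpha>"] increment_ge_of_lower_D2[of \<beta> f x] by blast
  qed
  have \<beta>\<gamma>: "\<beta> \<le> \<gamma>"
  proof (rule ccontr)
    assume "\<not> \<beta> \<le> \<gamma>"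
    (* the whole space is not a null set, so the slope bounds hold at some point *)
    have "AE x::real^3 in lebesgue. x \<in> {}"
      using slopes
    proof eventually_elim
      case (elim x)
      then have "\<beta> * (1 - 0) \<le> \<gamma> * (1 - 0)" by (metis order_trans zero_le_one)
      with \<open>\<not> \<beta> \<le> \<gamma>\<close> show ?case by simp
    qed
    then show False using mem_closed_if_AE_lebesgue[of "{}"] by blast
  qed
  define c where "c = (\<beta> + \<gamma>) / 2"
  define q where "q = (\<gamma> - \<beta>) / 2"
  have c: "c > 0" "c \<le> \<gamma>" "c = \<gamma> - q" and q: "0 \<le> q" "q < c"
    using \<beta>\<gamma> assms(12) by (auto simp: c_def q_def field_simps)
  obtain d where d: "q < d" "{- c - d<..<- c + d} \<subseteq> graph_resolvent_set ?G"
  proof (cases "\<exists>r0\<in>X. r0 < 0")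
    case True
    then obtain r0 where r0: "r0 \<in> X" "r0 < 0" by blast
    then have "r0 \<le> - \<delta>" using gap[of r0] X by force
    then have "Inf X \<le> - \<delta>" using cInf_lower[OF r0(1) bdd] by linarith
    then have "\<delta> / \<delta>\<^sup>2 \<le> - Inf X / \<delta>\<^sup>2" by (intro divide_right_mono) auto
    then have "1 / \<delta> < \<alpha>" using assms(14) \<delta> unfolding X_def[symmetric] by (simp add: power2_eq_square)
    then have "\<gamma> < \<delta>" unfolding \<gamma>_def using \<delta> assms(11) by (simp add: field_simps)
    then have "q < min c (\<delta> - c)" using c q by simp
    moreover have "{- c - min c (\<delta> - c)<..<- c + min c (\<delta> - c)} \<subseteq> graph_resolvent_set ?G"
      using gap by (auto simp: min_def split: if_splits)
    ultimately show ?thesis using that by blast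
  next
    case False
    then have "{- c - c<..<- c + c} \<subseteq> graph_resolvent_set ?G" using X by auto
    with q show ?thesis using that by blast
  qed
  then have "d > 0" using q by linarith
  from symmetric_resolvent_bound[OF sym this d(2)]
  obtain R where R: "bounded_linear R" "\<And>g. (R g, g + (- c) *\<^sub>R R g) \<in> ?G" "\<And>g. norm (R g) \<le> norm g / d"
    by blast
  have "\<exists>u. u \<in> sobolev_H 2 \<and> (AE x in lebesgue. - laplacian u x + V x * u x + c * u x + (f x (u x) - c * u x) = h x)"
  proof (rule contraction_solution[where N = "\<lambda>x t. f x t - c * t", OF R(1) _ R(3) SL _ _ _ q(1) d(1) h])
    show "(R g, g - c *\<^sub>R R g) \<in> ?G" for g using R(2)[of g] by simp
    show "(\<lambda>x. f x (u x) - c * u x) \<in> borel_measurable lebesgue" if [measurable]: "u \<in> borel_measurable lebesgue" for u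
      using caratheodory_measurable[OF cara that] by measurable
    show "AE x in lebesgue. \<forall>s t. \<bar>(f x s - c * s) - (f x t - c * t)\<bar> \<le> q * \<bar>s - t\<bar>"
      using slopes
    proof eventually_elim
      case (elim x)
      then show ?case unfolding c_def q_def by (intro allI centred_lipschitz) blast+
    qed
    show "AE x in lebesgue. f x 0 - c * 0 = 0" using assms(6) by eventually_elim simp
  qed
  then show "\<exists>u. u \<in> sobolev_H 2 \<and> (AE x in lebesgue. - laplacian u x + V x * u x + f x (u x) = h x)"
    by (simp add: algebra_simps)
qed

end
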